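(* Let $N=4$, and let $u$, the balanced comb strategy $\mathcal J^b_{\mathcal C}\in\mathcal V$ and the function $$\underline u^\delta(x):=\sqrt\delta\,\inf_{\alpha\in\mathcal U}\mathbb{E}^{\alpha,\mathcal J^b_{\mathcal C}}\Big[R_T^{x/\sqrt\delta}\Big],\qquad x\in\mathbb{R}^4,\ \delta>0,$$ be as defined in the context, where $R_T^{x/\sqrt\delta}$ is the regret of the player at time $T$ starting from the state $X_0=x/\sqrt\delta$. Then $\mathcal J^b_{\mathcal C}$ is asymptotically optimal for nature, in the sense that, as $\delta\downarrow0$, $$\underline u^\delta(x)=u(x)+o(1),$$ where the $o(1)$ is locally uniform in $x\in\mathbb{R}^4$.
   Context: Notation: $e_1,\dots,e_4$ is the canonical basis of $\mathbb{R}^4$; for $J\subseteq\{1,2,3,4\}$, $e_J:=\sum_{j\in J}e_j$; $\Phi(x):=\max_i x_i$; $\partial^2u$ is the Hessian. The game. There are $N=4$ experts. At each time $t=1,2,\dots$, the player chooses a probability distribution $\alpha_t$ on $\{1,\dots,4\}$ and, simultaneously, nature chooses a probability distribution $\beta_t$ on the power set of $\{1,\dots,4\}$; both may depend on the past history of gains $\{(G^i_s,G_s): s\le t-1,\ i=1,\dots,4\}$. Given the past, $I_t\sim\alpha_t$ and $J_t\sim\beta_t$ are drawn independently. The gains are updated by $G^i_t=G^i_{t-1}+\mathbf 1_{\{i\in J_t\}}$ (experts) and $G_t=G_{t-1}+\mathbf 1_{\{I_t\in J_t\}}$ (player). Put $X_t=(G^1_t-G_t,\dots,G^4_t-G_t)\in\mathbb{R}^4$,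 with an arbitrary initial state $X_0\in\mathbb{R}^4$. The regret is $R_t=\max_iG^i_t-G_t=\Phi(X_t)$. The maturity $T$ is a geometric random variable with parameter $\delta>0$, $\mathbb{P}(T=t)=\delta(1-\delta)^t$, $t=0,1,2,\dots$, independent of the play. $\mathcal U$ and $\mathcal V$ are the sets of strategies $\alpha=\{\alpha_t\}$ of the player and $\beta=\{\beta_t\}$ of nature. The value of the game (the two expressions are known to coincide) is $$V^\delta(X_0):=\sup_{\beta\in\mathcal V}\inf_{\alpha\in\mathcal U}\mathbb{E}^{\alpha,\beta}[R_T]=\inf_{\alpha\in\mathcal U}\sup_{\beta\in\mathcal V}\mathbb{E}^{\alpha,\beta}[R_T].$$ The function $u$. With $u^\delta(x):=\sqrt\delta\,V^\delta(x/\sqrt\delta)$, it is known that $u^\delta$ converges locally uniformly as $\delta\downarrow0$ to a function $u:\mathbb{R}^4\to\mathbb{R}$, which is the unique viscosity solution, in the class of functions with linear growth, of $$u(x)-\frac12\sup_{J\subseteq\{1,2,3,4\}}e_J^\top\,\partial^2u(x)\,e_J=\Phi(x),\qquad x\in\mathbb{R}^4.$$ Comb strategies. For $x\in\mathbb{R}^4$ write $x_{i_1}\le x_{i_2}\le x_{i_3}\le x_{i_4}$ with $\{i_1,i_2,i_3,i_4\}=\{1,2,3,4\}$, with the tie convention that if $x_i=x_j$ and $i<j$ then $i$ precedes $j$ in the ordering. The comb choice is $\mathcal J_{\mathcal C}(x):=\{i_4,i_2\}$ (the leading and third leading experts), and $\mathcal J^c_{\mathcal C}(x)$ is its complement in $\{1,2,3,4\}$.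 The balanced comb strategy $\mathcal J^b_{\mathcal C}\in\mathcal V$ is the strategy of nature which, when the state of the game is $X_{t-1}=x/\sqrt\delta$, chooses the set $\mathcal J_{\mathcal C}(x)$ with probability $\tfrac12$ and the set $\mathcal J_{\mathcal C}^c(x)$ with probability $\tfrac12$. *)

theory Defs
  imports "HOL-Probability.Probability"
begin

text \<open>
  Experts are the elements \<open>1, 2, 3, 4\<close> of the numeral type \<open>4\<close>. In this type \<open>4 = 0\<close>, so its
  built-in order puts expert 4 first; that order is never used below.
\<close>

definition eJ :: "4 set \<Rightarrow> real^4" where
  "eJ J = (\<Sum>j\<in>J. axis j 1)"

definition \<Phi> :: "real^4 \<Rightarrow> real" where
  "\<Phi> x = (MAX i. x $ i)"


section \<open>The game\<close>

text \<open>
  A pair of type \<open>gains\<close> consists of the vector of the experts' gains and the player's gain.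
  The history after \<open>t\<close> rounds is a list of length \<open>t + 1\<close>, most recent gains first; its last
  entry holds the initial gains.
\<close>

type_synonym gains = "(real^4) \<times> real"
type_synonym history = "gains list"
type_synonym player_strategy = "history \<Rightarrow> 4 pmf"
type_synonym nature_strategy = "history \<Rightarrow> 4 set pmf"

definition state :: "gains \<Rightarrow> real^4" where
  "state g = (\<chi> i. fst g $ i - snd g)"

definition update :: "gains \<Rightarrow> 4 \<times> 4 set \<Rightarrow> gains" where
  "update g IJ = (case IJ of (I, J) \<Rightarrow> (fst g + eJ J, snd g + of_bool (I \<in> J)))"

text \<open>
  The initial state \<open>X0\<close> is realised by expert gains \<open>X0\<close> and player gain \<open>0\<close>.
\<close>

primrec play :: "player_strategy \<Rightarrow> nature_strategy \<Rightarrow> real^4 \<Rightarrow> nat \<Rightarrow> history pmf" where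
  "play \<alpha> \<beta> X0 0 = return_pmf [(X0, 0)]"
| "play \<alpha> \<beta> X0 (Suc t) =
     bind_pmf (play \<alpha> \<beta> X0 t)
       (\<lambda>h. map_pmf (\<lambda>IJ. update (hd h) IJ # h) (pair_pmf (\<alpha> h) (\<beta> h)))"

text \<open>
  The maturity is drawn independently of the play. In the library,
  \<open>pmf (geometric_pmf \<delta>) t = (1 - \<delta>) ^ t * \<delta>\<close> for \<open>0 < \<delta> \<le> 1\<close>.
\<close>

definition expected_regret ::
    "real \<Rightarrow> player_strategy \<Rightarrow> nature_strategy \<Rightarrow> real^4 \<Rightarrow> real" where
  "expected_regret \<delta> \<alpha> \<beta> X0 =
     measure_pmf.expectation (bind_pmf (geometric_pmf \<delta>) (play \<alpha> \<beta> X0))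
       (\<lambda>h. \<Phi> (state (hd h)))"

text \<open>
  The regret at time \<open>t\<close> is bounded by \<open>\<bar>\<Phi> X0\<bar> + t\<close>, so for \<open>0 < \<delta> \<le> 1\<close> all expectations exist
  and the real-valued suprema and infima below are over bounded nonempty sets.
\<close>

definition game_value :: "real \<Rightarrow> real^4 \<Rightarrow> real" where
  "game_value \<delta> X0 = (SUP \<beta>. INF \<alpha>. expected_regret \<delta> \<alpha> \<beta> X0)"

definition scaled_value :: "real \<Rightarrow> real^4 \<Rightarrow> real" where
  "scaled_value \<delta> x = sqrt \<delta> * game_value \<delta> (x /\<^sub>R sqrt \<delta>)"


section \<open>The balanced comb strategy\<close>

text \<open>
  The function \<open>sort_key\<close> is stable, so tied experts stay in the order \<open>1, 2, 3, 4\<close>.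
  List positions start at \<open>0\<close>.
\<close>

definition ranking :: "real^4 \<Rightarrow> 4 list" where
  "ranking x = sort_key (\<lambda>i. x $ i) [1, 2, 3, 4]"

definition comb :: "real^4 \<Rightarrow> 4 set" where
  "comb x = {ranking x ! 3, ranking x ! 1}"

definition balanced_comb :: "real \<Rightarrow> nature_strategy" where
  "balanced_comb \<delta> h =
     (let x = sqrt \<delta> *\<^sub>R state (hd h)
      in map_pmf (\<lambda>b. if b then comb x else - comb x) (bernoulli_pmf (1/2)))"

definition comb_value :: "real \<Rightarrow> real^4 \<Rightarrow> real" where
  "comb_value \<delta> x =
     sqrt \<delta> * (INF \<alpha>. expected_regret \<delta> \<alpha> (balanced_comb \<delta>) (x /\<^sub>R sqrt \<delta>))"


section \<open>Viscosity solutions of the limiting equation\<close>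

text \<open>\<open>\<phi>\<close> is twice continuously differentiable with gradient \<open>g\<close> and Hessian matrix \<open>H\<close>.\<close>

definition C2_with ::
    "(real^4 \<Rightarrow> real) \<Rightarrow> (real^4 \<Rightarrow> real^4) \<Rightarrow> (real^4 \<Rightarrow> real^4^4) \<Rightarrow> bool" where
  "C2_with \<phi> g H \<longleftrightarrow>
     (\<forall>x. (\<phi> has_derivative (\<lambda>h. g x \<bullet> h)) (at x)) \<and>
     (\<forall>x. (g has_derivative (\<lambda>h. H x *v h)) (at x)) \<and>
     continuous_on UNIV H"

definition max_curvature :: "real^4^4 \<Rightarrow> real" where
  "max_curvature A = (SUP J. eJ J \<bullet> (A *v eJ J))"

definition viscosity_subsolution :: "(real^4 \<Rightarrow> real) \<Rightarrow> bool" where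
  "viscosity_subsolution u \<longleftrightarrow>
     (\<forall>\<phi> g H x. C2_with \<phi> g H \<longrightarrow>
        (\<forall>\<^sub>F y in nhds x. u y - \<phi> y \<le> u x - \<phi> x) \<longrightarrow>
        u x - 1/2 * max_curvature (H x) \<le> \<Phi> x)"

definition viscosity_supersolution :: "(real^4 \<Rightarrow> real) \<Rightarrow> bool" where
  "viscosity_supersolution u \<longleftrightarrow>
     (\<forall>\<phi> g H x. C2_with \<phi> g H \<longrightarrow>
        (\<forall>\<^sub>F y in nhds x. u y - \<phi> y \<ge> u x - \<phi> x) \<longrightarrow>
        u x - 1/2 * max_curvature (H x) \<ge> \<Phi> x)"

definition viscosity_solution :: "(real^4 \<Rightarrow> real) \<Rightarrow> bool" where
  "viscosity_solution u \<longleftrightarrow>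
     continuous_on UNIV u \<and> viscosity_subsolution u \<and> viscosity_supersolution u"

definition linear_growth :: "(real^4 \<Rightarrow> real) \<Rightarrow> bool" where
  "linear_growth u \<longleftrightarrow> (\<exists>C. \<forall>x. \<bar>u x\<bar> \<le> C * (1 + norm x))"

end

theory Submission
  imports Defs
begin

text \<open>
  Against the balanced comb strategy every expert gains with probability \<open>1/2\<close> in every
  round, whatever the player does, so the expected regret does not depend on the player. Up to a
  common shift of all experts it is the expectation of \<open>\<Phi>\<close> at a geometric time along
  a random walk with steps \<open>\<plusminus> sqrt \<delta>\<close> times the comb vector, and it
  solves a discrete form of \<open>w - 1/2 * (second derivative of w along the comb vector) =
  \<Phi>\<close>. The proof exhibits the solution \<open>w\<close> of this linear equation in closed
  form, shows that no other choice of \<open>J\<close> gives a larger second derivative, so that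
  \<open>w\<close> solves the viscosity equation and is therefore \<open>u\<close>, and shows that the
  scaled expected regret differs from \<open>w\<close> by \<open>O(sqrt \<delta>)\<close>.

  The closed form lives in three coordinates, one for each splitting of the experts into two pairs,
  scaled by \<open>1 / sqrt 2\<close>. Permutations of the experts act on them by permutations and
  even sign changes. A pair \<open>J\<close> moves the state along a coordinate axis, a single expert
  or a triple along a diagonal, and the comb set moves it along the axis whose coordinate has the
  middle absolute value. On the fundamental domain \<open>\<bar>q\<bar> \<le> t \<le> p\<close> the
  comb axis is that of \<open>t\<close>. There \<open>sqrt 2 * (w - \<Phi>)\<close> equals its own
  second derivative in \<open>t\<close>; with normal reflection at the walls and boundedness this
  forces \<open>cosh p * arctan (exp (-p)) * cosh t * cosh q + sinh p * artanh (exp (-p)) * sinh t *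
  sinh q - sinh (t + q) / 2\<close>, the function \<open>excess\<close>.

  Three facts about this function carry the proof. Along the comb axis its second differences are
  those demanded by the equation up to a cubic error that is uniform in the state
  (\<open>potential_second_difference\<close>). Near a wall of the fundamental domain the formulas of
  the two sides differ only cubically (\<open>potential_chamber_close\<close>), so second-order
  statements may be checked with one formula. Along every other step direction the second derivative
  is at most that along the comb axis (\<open>sector_inequality\<close>); after division by
  \<open>cosh t * cosh q\<close> this is the nonnegativity of a bilinear form in \<open>tanh t\<close>
  and \<open>tanh q\<close> on a triangle, which reduces to inequalities in one variable at its
  corners. The first fact makes \<open>w\<close> a subsolution, all three make it a supersolution, and
  the first one again, summed along the play, gives the rate of convergence
  (\<open>balanced_comb_regret\<close>).
\<close>

section \<open>The scalar functions of the leading coordinate\<close>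

text \<open>
  The function \<open>cosh p / 2\<close> times the integral of \<open>1 / cosh\<close> over \<open>[p,
  \<infinity>)\<close>. As coefficient of \<open>cosh t * cosh q\<close> it produces the even part of
  the reflection condition at the wall \<open>t = p\<close>.
\<close>

definition lead_even :: "real \<Rightarrow> real" where
  "lead_even p = cosh p * arctan (exp (- p))"

text \<open>
  The same with \<open>sinh\<close> in place of \<open>cosh\<close>, for the odd part. At \<open>p =
  0\<close>, where \<open>artanh 1\<close> has no meaningful value, the factor \<open>sinh p\<close>
  vanishes.
\<close>

definition lead_odd :: "real \<Rightarrow> real" where
  "lead_odd p = sinh p * artanh (exp (- p))"

lemma nondecreasing_from_0:
  fixes f f' :: "real \<Rightarrow> real"
  assumes "0 \<le> r" "\<And>x. 0 \<le> x \<Longrightarrow> x \<le> r \<Longrightarrow> (f has_real_derivative f' x) (at x)"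
    and "\<And>x. 0 \<le> x \<Longrightarrow> x \<le> r \<Longrightarrow> 0 \<le> f' x"
  shows "f 0 \<le> f r"
  using DERIV_nonneg_imp_nondecreasing[of 0 r f] assms by blast

text \<open>
  The four estimates that follow come from truncating the power series: the derivative of the
  difference is a single remainder term of constant sign. The number of terms is dictated by the
  inequalities below; the tightest of them differs from an equality only by a term of order
  \<open>q^4\<close> in \<open>q = exp (-2 p)\<close>.
\<close>

lemma arctan_ge_poly:
  assumes "0 \<le> (r::real)"
  shows "r - r^3/3 + r^5/5 - r^7/7 \<le> arctan r"
proof -
  let ?f = "\<lambda>x::real. arctan x - (x - x^3/3 + x^5/5 - x^7/7)"
  have "?f 0 \<le> ?f r"
  proof (rule nondecreasing_from_0[where f' = "\<lambda>x. x^8 / (1 + x^2)"])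
    fix x :: real
    have nz: "1 + x^2 \<noteq> 0" by (smt (verit) zero_le_power2)
    have "inverse (1 + x^2) - (1 - x^2 + x^4 - x^6) = x^8 / (1 + x^2)"
      using nz by (simp add: divide_simps) (simp add: algebra_simps power2_eq_square eval_nat_numeral)
    then show "(?f has_real_derivative x^8 / (1 + x^2)) (at x)"
      by (auto intro!: derivative_eq_intros simp: eval_nat_numeral)
    show "0 \<le> x^8 / (1 + x^2)" by simp
  qed (use assms in auto)
  then show ?thesis by simp
qed

lemma arctan_le_poly:
  assumes "0 \<le> (r::real)"
  shows "arctan r \<le> r - r^3/3 + r^5/5 - r^7/7 + r^9/9"
proof -
  let ?f = "\<lambda>x::real. (x - x^3/3 + x^5/5 - x^7/7 + x^9/9) - arctan x"
  have "?f 0 \<le> ?f r"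
  proof (rule nondecreasing_from_0[where f' = "\<lambda>x. x^10 / (1 + x^2)"])
    fix x :: real
    have nz: "1 + x^2 \<noteq> 0" by (smt (verit) zero_le_power2)
    have "(1 - x^2 + x^4 - x^6 + x^8) - inverse (1 + x^2) = x^10 / (1 + x^2)"
      using nz by (simp add: divide_simps) (simp add: algebra_simps power2_eq_square eval_nat_numeral)
    then show "(?f has_real_derivative x^10 / (1 + x^2)) (at x)"
      by (auto intro!: derivative_eq_intros simp: eval_nat_numeral)
    show "0 \<le> x^10 / (1 + x^2)" by simp
  qed (use assms in auto)
  then show ?thesis by simp
qed

lemma artanh_ge_poly:
  assumes "0 \<le> (r::real)" "r < 1"
  shows "r + r^3/3 + r^5/5 + r^7/7 \<le> artanh r"
proof -
  let ?f = "\<lambda>x::real. artanh x - (x + x^3/3 + x^5/5 + x^7/7)"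
  have "?f 0 \<le> ?f r"
  proof (rule nondecreasing_from_0[where f' = "\<lambda>x. x^8 / (1 - x^2)"])
    fix x :: real assume x: "0 \<le> x" "x \<le> r"
    have pos: "0 < 1 - x^2" using x assms by (simp add: power_less_one_iff abs_square_less_1)
    have "1 / (1 - x^2) - (1 + x^2 + x^4 + x^6) = x^8 / (1 - x^2)"
      using pos by (simp add: divide_simps) (simp add: algebra_simps power2_eq_square eval_nat_numeral)
    then show "(?f has_real_derivative x^8 / (1 - x^2)) (at x)"
      using x assms
      by (auto intro!: derivative_eq_intros simp: eval_nat_numeral)
    show "0 \<le> x^8 / (1 - x^2)" using pos by simp
  qed (use assms in auto)
  then show ?thesis by simp
qed

lemma artanh_le_poly:
  assumes "0 \<le> (r::real)" "r < 1"
  shows "(1 - r^2) * artanh r \<le> (1 - r^2) * (r + r^3/3 + r^5/5 + r^7/7) + r^9/9"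
proof -
  let ?f = "\<lambda>x::real. (x + x^3/3 + x^5/5 + x^7/7) + x^9 / (9 * (1 - x^2)) - artanh x"
  have "?f 0 \<le> ?f r"
  proof (rule nondecreasing_from_0[where f' = "\<lambda>x. 2 * x^10 / (9 * (1 - x^2)^2)"])
    fix x :: real assume x: "0 \<le> x" "x \<le> r"
    have pos: "0 < 1 - x^2" using x assms by (simp add: power_less_one_iff abs_square_less_1)
    have nz: "9 - x^2 * 9 \<noteq> 0" using pos by simp
    have eq: "(1 + x^2 + x^4 + x^6) + (9 * x^8 * (9 * (1 - x^2)) + x^9 * (18 * x)) / (9 * (1 - x^2))^2
        - 1 / (1 - x^2) = 2 * x^10 / (9 * (1 - x^2)^2)"
      using pos by (simp add: divide_simps) (simp add: algebra_simps power2_eq_square eval_nat_numeral)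
    show "(?f has_real_derivative 2 * x^10 / (9 * (1 - x^2)^2)) (at x)"
      unfolding eq[symmetric] using x assms pos nz
      by (auto intro!: derivative_eq_intros simp: eval_nat_numeral)
    show "0 \<le> 2 * x^10 / (9 * (1 - x^2)^2)" using pos by simp
  qed (use assms in auto)
  then have *: "artanh r \<le> (r + r^3/3 + r^5/5 + r^7/7) + r^9 / (9 * (1 - r^2))" by simp
  have pos: "0 < 1 - r^2" using assms by (simp add: power_less_one_iff abs_square_less_1)
  have "(1 - r^2) * artanh r \<le> (1 - r^2) * ((r + r^3/3 + r^5/5 + r^7/7) + r^9 / (9 * (1 - r^2)))"
    using * pos by (intro mult_left_mono) auto
  also have "\<dots> = (1 - r^2) * (r + r^3/3 + r^5/5 + r^7/7) + r^9/9"
    using pos by (simp add: field_simps)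
  finally show ?thesis .
qed

text \<open>
  The substitution \<open>q = exp (-2 p)\<close> makes \<open>tanh p\<close> rational and leaves, of
  each scalar function, one factor \<open>a\<close> or \<open>b\<close> that lies between polynomials
  in \<open>q\<close>. Since the inequalities below are linear in the two scalar functions, each
  becomes a polynomial inequality on \<open>(0, 1)\<close>.
\<close>

lemma lead_param:
  assumes "0 < p"
  obtains q a b where "0 < q" "q < 1"
    "lead_even p = (1 + q) * a / 2" "lead_odd p = (1 - q) * b / 2" "tanh p = (1 - q) / (1 + q)"
    "1 - q/3 + q^2/5 - q^3/7 \<le> a" "a \<le> 1 - q/3 + q^2/5 - q^3/7 + q^4/9"
    "1 + q/3 + q^2/5 + q^3/7 \<le> b"
    "(1 - q) * b \<le> (1 - q) * (1 + q/3 + q^2/5 + q^3/7) + q^4/9"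
proof
  define r where "r = exp (- p)"
  have r: "0 < r" "r < 1" using assms by (auto simp: r_def)
  have ir: "exp p = 1 / r" by (simp add: r_def exp_minus field_simps)
  let ?q = "r^2" and ?a = "arctan r / r" and ?b = "artanh r / r"
  show "0 < ?q" "?q < 1" using r by (auto simp: power_less_one_iff abs_square_less_1)
  show "lead_even p = (1 + ?q) * ?a / 2"
    using r by (simp add: lead_even_def cosh_field_def r_def[symmetric] ir field_simps power2_eq_square)
  show "lead_odd p = (1 - ?q) * ?b / 2"
    using r by (simp add: lead_odd_def sinh_field_def r_def[symmetric] ir field_simps power2_eq_square)
  show "tanh p = (1 - ?q) / (1 + ?q)"
    using r by (simp add: tanh_altdef r_def[symmetric] ir) (simp add: divide_simps add_nonneg_eq_0_iff power2_eq_square)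
  have pw: "r * (1 - ?q/3 + ?q^2/5 - ?q^3/7) = r - r^3/3 + r^5/5 - r^7/7"
     "r * (1 - ?q/3 + ?q^2/5 - ?q^3/7 + ?q^4/9) = r - r^3/3 + r^5/5 - r^7/7 + r^9/9"
     "r * (1 + ?q/3 + ?q^2/5 + ?q^3/7) = r + r^3/3 + r^5/5 + r^7/7"
     "r * ((1 - ?q) * (1 + ?q/3 + ?q^2/5 + ?q^3/7) + ?q^4/9) = (1 - r^2) * (r + r^3/3 + r^5/5 + r^7/7) + r^9/9"
    by (simp_all add: eval_nat_numeral algebra_simps)
  show "1 - ?q/3 + ?q^2/5 - ?q^3/7 \<le> ?a"
    using arctan_ge_poly[of r] r pw(1) by (simp add: pos_le_divide_eq mult.commute)
  show "?a \<le> 1 - ?q/3 + ?q^2/5 - ?q^3/7 + ?q^4/9"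
    using arctan_le_poly[of r] r pw(2) by (simp add: pos_divide_le_eq mult.commute)
  show "1 + ?q/3 + ?q^2/5 + ?q^3/7 \<le> ?b"
    using artanh_ge_poly[of r] r pw(3) by (simp add: pos_le_divide_eq mult.commute)
  have "(1 - ?q) * artanh r / r \<le> (1 - ?q) * (1 + ?q/3 + ?q^2/5 + ?q^3/7) + ?q^4/9"
    using artanh_le_poly[of r] r pw(4) by (subst pos_divide_le_eq) (auto simp: mult.commute)
  then show "(1 - ?q) * ?b \<le> (1 - ?q) * (1 + ?q/3 + ?q^2/5 + ?q^3/7) + ?q^4/9" by simp
qed

context
  fixes p F G T :: real
  assumes p: "0 < p"
  defines "F \<equiv> lead_even p" and "G \<equiv> lead_odd p" and "T \<equiv> tanh p"
begin

lemma lead_bounds: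
  "0 < T" "T < 1" "1/2 \<le> F" "F * T \<le> 1/2" "T / 2 \<le> G" "G \<le> 1/2"
proof -
  obtain q a b :: real where q: "0 < q" "q < 1"
    and FGT: "lead_even p = (1 + q) * a / 2" "lead_odd p = (1 - q) * b / 2" "tanh p = (1 - q) / (1 + q)"
    and a: "1 - q/3 + q^2/5 - q^3/7 \<le> a" "a \<le> 1 - q/3 + q^2/5 - q^3/7 + q^4/9"
    and b: "1 + q/3 + q^2/5 + q^3/7 \<le> b" "(1 - q) * b \<le> (1 - q) * (1 + q/3 + q^2/5 + q^3/7) + q^4/9"
    by (rule lead_param[OF p])
  have pw: "q^2 \<le> q" "q^3 \<le> q^2" "q^4 \<le> q^3" "0 < q^4" "0 < q^3" "0 < q^2"
    using q power_decreasing[of 1 2 q] power_decreasing[of 2 3 q] power_decreasing[of 3 4 q] by auto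
  show "0 < T" "T < 1" using q by (auto simp: T_def FGT)
  have a1: "1 - q/3 \<le> a" using a(1) pw by linarith
  have "1 \<le> (1 + q) * (1 - q/3)"
    using q pw by (simp add: algebra_simps power2_eq_square) 
  also have "\<dots> \<le> (1 + q) * a" using a1 q by (intro mult_left_mono) auto
  finally show "1/2 \<le> F" by (simp add: F_def FGT)
  have "a \<le> 1" using a(2) pw by linarith
  then have "(1 - q) * a \<le> (1 - q) * 1" using q by (intro mult_left_mono) auto
  then have "(1 - q) * a \<le> 1" using q by (simp only: mult_1_right)
  moreover have "F * T = (1 - q) * a / 2"
    using q unfolding F_def T_def FGT by (simp add: divide_simps) (simp add: algebra_simps)
  ultimately show "F * T \<le> 1/2" by simp
  have "1 \<le> b" using b(1) pw q by linarith
  then have "(1 - q) * 1 \<le> (1 - q) * b" using q by (intro mult_left_mono) auto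
  moreover have "T \<le> 1 - q" using q unfolding T_def FGT by (simp add: pos_divide_le_eq) 
  ultimately show "T / 2 \<le> G" by (simp add: G_def FGT)
  have "(1 - q) * (1 + q/3 + q^2/5 + q^3/7) + q^4/9 = 1 - 2/3*q - 2/15*q^2 - 2/35*q^3 - 2/63*q^4"
    by (simp add: field_simps eval_nat_numeral)
  then have "(1 - q) * (1 + q/3 + q^2/5 + q^3/7) + q^4/9 \<le> 1" using pw q by linarith
  with b(2) show "G \<le> 1/2" by (simp add: G_def FGT)
qed

lemma lead_exp_bounds:
  "F \<le> (1 + exp (- 2 * p)) / 2" "(1 - exp (- 2 * p)) / 2 \<le> G"
proof -
  define r where "r = exp (- p)"
  have r: "0 < r" "r < 1" using p by (auto simp: r_def)
  have ir: "exp p = 1 / r" by (simp add: r_def exp_minus field_simps)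
  have e2: "exp (- (2 * p)) = r^2" by (simp add: r_def flip: exp_double)
  have pw: "r^5 \<le> r^3" "r^9 \<le> r^7" "0 \<le> r^3" "0 \<le> r^5" "0 \<le> r^7"
    using r power_decreasing[of 3 5 r] power_decreasing[of 7 9 r] by auto
  have "arctan r \<le> r" using arctan_le_poly[of r] r pw by linarith
  then have "cosh p * arctan r \<le> cosh p * r" by (intro mult_left_mono) auto
  also have "\<dots> = (1 + r^2) / 2"
    using r by (simp add: cosh_field_def r_def[symmetric] ir field_simps power2_eq_square)
  finally show "F \<le> (1 + exp (- 2 * p)) / 2" by (simp add: F_def lead_even_def e2 flip: r_def)
  have "r \<le> artanh r" using artanh_ge_poly[of r] r pw by linarith
  then have "sinh p * r \<le> sinh p * artanh r" using p by (intro mult_left_mono) auto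
  moreover have "sinh p * r = (1 - r^2) / 2"
    using r by (simp add: sinh_field_def r_def[symmetric] ir field_simps power2_eq_square)
  ultimately show "(1 - exp (- 2 * p)) / 2 \<le> G" by (simp add: G_def lead_odd_def e2 flip: r_def)
qed

text \<open>
  This inequality and its companions below are the values at the corners of the triangle
  \<open>\<bar>b\<bar> \<le> a \<le> T\<close> of the bilinear forms in
  \<open>sector_bilinear_nonneg\<close>, or bounds on the slopes of these forms; the last one does the
  same for the sign of \<open>excess\<close>. After clearing denominators and inserting the truncated
  series each of them reads \<open>q^k\<close> times a polynomial whose constant term dominates; the
  exponent \<open>k\<close> records how nearly the inequality is an equality for large
  \<open>p\<close>.
\<close>

lemma corner_minus_nonneg: "G * (2 + T^2) \<le> F * (1 + 2 * T^2)"
proof -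
  obtain q a b :: real where q: "0 < q" "q < 1"
    and FGT: "lead_even p = (1 + q) * a / 2" "lead_odd p = (1 - q) * b / 2" "tanh p = (1 - q) / (1 + q)"
    and a: "1 - q/3 + q^2/5 - q^3/7 \<le> a" "a \<le> 1 - q/3 + q^2/5 - q^3/7 + q^4/9"
    and b: "1 + q/3 + q^2/5 + q^3/7 \<le> b" "(1 - q) * b \<le> (1 - q) * (1 + q/3 + q^2/5 + q^3/7) + q^4/9"
    by (rule lead_param[OF p])
  let ?al = "1 - q/3 + q^2/5 - q^3/7" and ?ah = "1 - q/3 + q^2/5 - q^3/7 + q^4/9"
  let ?bl = "1 + q/3 + q^2/5 + q^3/7" and ?bh = "(1 - q) * (1 + q/3 + q^2/5 + q^3/7) + q^4/9"
  have pw: "q^2 \<le> q" "q^3 \<le> q^2" "q^4 \<le> q^3" "0 < q^4" "0 < q^3" "0 < q^2"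
    using q power_decreasing[of 1 2 q] power_decreasing[of 2 3 q] power_decreasing[of 3 4 q] by auto
  define \<beta> where "\<beta> = (1 - q) * b"
  have "0 \<le> q^3 * (512/105 + 218/315 * q^2 - q/3 - q^3/3)"
    by (rule mult_nonneg_nonneg[OF zero_le_power]; use q pw in linarith)
  also have "\<dots> = (1 + q) * (3 - 2*q + 3*q^2) * ?al - (3 + 2*q + 3*q^2) * ?bh"
    by (simp add: field_simps eval_nat_numeral)
  also have "\<dots> \<le> (1 + q) * (3 - 2*q + 3*q^2) * a - (3 + 2*q + 3*q^2) * \<beta>"
    using q a b unfolding \<beta>_def by (intro diff_mono mult_left_mono) auto
  also have "\<dots> = 2 * (1 + q)^2 * (F * (1 + 2 * T^2) - G * (2 + T^2))"
    using q unfolding F_def G_def T_def FGT \<beta>_def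
    by (simp add: power_divide) (simp add: divide_simps, simp add: algebra_simps eval_nat_numeral)
  finally show ?thesis using q by (simp add: zero_le_mult_iff)
qed

lemma corner_plus_nonneg: "3 * T \<le> F * (1 + 2 * T^2) + G * (2 + T^2)"
proof -
  obtain q a b :: real where q: "0 < q" "q < 1"
    and FGT: "lead_even p = (1 + q) * a / 2" "lead_odd p = (1 - q) * b / 2" "tanh p = (1 - q) / (1 + q)"
    and a: "1 - q/3 + q^2/5 - q^3/7 \<le> a" "a \<le> 1 - q/3 + q^2/5 - q^3/7 + q^4/9"
    and b: "1 + q/3 + q^2/5 + q^3/7 \<le> b" "(1 - q) * b \<le> (1 - q) * (1 + q/3 + q^2/5 + q^3/7) + q^4/9"
    by (rule lead_param[OF p])
  let ?al = "1 - q/3 + q^2/5 - q^3/7" and ?ah = "1 - q/3 + q^2/5 - q^3/7 + q^4/9"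
  let ?bl = "1 + q/3 + q^2/5 + q^3/7" and ?bh = "(1 - q) * (1 + q/3 + q^2/5 + q^3/7) + q^4/9"
  have pw: "q^2 \<le> q" "q^3 \<le> q^2" "q^4 \<le> q^3" "0 < q^4" "0 < q^3" "0 < q^2"
    using q power_decreasing[of 1 2 q] power_decreasing[of 2 3 q] power_decreasing[of 3 4 q] by auto
  have "0 \<le> q^2 * (128/15 - 66/35 * q^2 - 6/7 * q^4)"
    by (rule mult_nonneg_nonneg[OF zero_le_power]; use q pw in linarith)
  also have "\<dots> = (1 + q) * (3 - 2*q + 3*q^2) * ?al + (1 - q) * (3 + 2*q + 3*q^2) * ?bl - 6 * (1 - q^2)"
    by (simp add: field_simps eval_nat_numeral)
  also have "\<dots> \<le> (1 + q) * (3 - 2*q + 3*q^2) * a + (1 - q) * (3 + 2*q + 3*q^2) * b - 6 * (1 - q^2)"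
    using q a b by (intro diff_mono add_mono mult_left_mono) auto
  also have "\<dots> = 2 * (1 + q)^2 * (F * (1 + 2 * T^2) + G * (2 + T^2) - 3 * T)"
    using q unfolding F_def G_def T_def FGT
    by (simp add: power_divide) (simp add: divide_simps, simp add: algebra_simps eval_nat_numeral)
  finally show ?thesis using q by (simp add: zero_le_mult_iff)
qed

text \<open>
  The tightest case, of order \<open>q^4\<close>: it compares moving the leader alone with the comb at
  the point where the three other experts are tied. The coefficient \<open>c\<close> of
  \<open>a\<close> changes sign on \<open>(0, 1)\<close>, so the inequality is checked at both ends of
  the interval for \<open>a\<close>.
\<close>

lemma corner_leader_nonneg: "0 \<le> F * (1 - 6 * T^2) - G * (6 - T^2) + 5 * T"
proof -
  obtain q a b :: real where q: "0 < q" "q < 1"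
    and FGT: "lead_even p = (1 + q) * a / 2" "lead_odd p = (1 - q) * b / 2" "tanh p = (1 - q) / (1 + q)"
    and a: "1 - q/3 + q^2/5 - q^3/7 \<le> a" "a \<le> 1 - q/3 + q^2/5 - q^3/7 + q^4/9"
    and b: "1 + q/3 + q^2/5 + q^3/7 \<le> b" "(1 - q) * b \<le> (1 - q) * (1 + q/3 + q^2/5 + q^3/7) + q^4/9"
    by (rule lead_param[OF p])
  let ?al = "1 - q/3 + q^2/5 - q^3/7" and ?ah = "1 - q/3 + q^2/5 - q^3/7 + q^4/9"
  let ?bl = "1 + q/3 + q^2/5 + q^3/7" and ?bh = "(1 - q) * (1 + q/3 + q^2/5 + q^3/7) + q^4/9"
  have pw: "q^2 \<le> q" "q^3 \<le> q^2" "q^4 \<le> q^3" "0 < q^4" "0 < q^3" "0 < q^2"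
    using q power_decreasing[of 1 2 q] power_decreasing[of 2 3 q] power_decreasing[of 3 4 q] by auto
  define \<beta> where "\<beta> = (1 - q) * b"
  define c where "c = (1 + q) * (-5 + 14*q - 5*q^2)"
  have "0 \<le> q^4 * (1199/315 - 14/9 * q + 55/63 * q^2)"
    by (rule mult_nonneg_nonneg[OF zero_le_power]; use q pw in linarith)
  also have "\<dots> = c * ?al - (5 + 14*q + 5*q^2) * ?bh + 10 * (1 - q^2)"
    unfolding c_def by (simp add: field_simps eval_nat_numeral)
  finally have lo: "0 \<le> c * ?al - (5 + 14*q + 5*q^2) * ?bh + 10 * (1 - q^2)" .
  have "0 \<le> q^4 * (1024/315 - 5/9 * q + 118/63 * q^2 - 5/9 * q^3)"
    by (rule mult_nonneg_nonneg[OF zero_le_power]; use q pw in linarith)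
  also have "\<dots> = c * ?ah - (5 + 14*q + 5*q^2) * ?bh + 10 * (1 - q^2)"
    unfolding c_def by (simp add: field_simps eval_nat_numeral)
  finally have hi: "0 \<le> c * ?ah - (5 + 14*q + 5*q^2) * ?bh + 10 * (1 - q^2)" .
  have "c * ?al \<le> c * a \<or> c * ?ah \<le> c * a"
    using a by (cases "0 \<le> c") (auto intro: mult_left_mono mult_left_mono_neg)
  moreover have "(5 + 14*q + 5*q^2) * \<beta> \<le> (5 + 14*q + 5*q^2) * ?bh"
    using q b unfolding \<beta>_def by (intro mult_left_mono) auto
  ultimately have "0 \<le> c * a - (5 + 14*q + 5*q^2) * \<beta> + 10 * (1 - q^2)" using lo hi by linarith
  also have "\<dots> = 2 * (1 + q)^2 * (F * (1 - 6 * T^2) - G * (6 - T^2) + 5 * T)"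
    using q unfolding F_def G_def T_def FGT \<beta>_def c_def
    by (simp add: power_divide) (simp add: divide_simps, simp add: algebra_simps eval_nat_numeral)
  finally show ?thesis using q by (simp add: zero_le_mult_iff)
qed

lemma slope_dominates_curvature: "5/2 \<le> 4 * (F * T) + G * (2 / T - T)"
proof -
  obtain q a b :: real where q: "0 < q" "q < 1"
    and FGT: "lead_even p = (1 + q) * a / 2" "lead_odd p = (1 - q) * b / 2" "tanh p = (1 - q) / (1 + q)"
    and a: "1 - q/3 + q^2/5 - q^3/7 \<le> a" "a \<le> 1 - q/3 + q^2/5 - q^3/7 + q^4/9"
    and b: "1 + q/3 + q^2/5 + q^3/7 \<le> b" "(1 - q) * b \<le> (1 - q) * (1 + q/3 + q^2/5 + q^3/7) + q^4/9"
    by (rule lead_param[OF p])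
  let ?al = "1 - q/3 + q^2/5 - q^3/7" and ?ah = "1 - q/3 + q^2/5 - q^3/7 + q^4/9"
  let ?bl = "1 + q/3 + q^2/5 + q^3/7" and ?bh = "(1 - q) * (1 + q/3 + q^2/5 + q^3/7) + q^4/9"
  have pw: "q^2 \<le> q" "q^3 \<le> q^2" "q^4 \<le> q^3" "0 < q^4" "0 < q^3" "0 < q^2"
    using q power_decreasing[of 1 2 q] power_decreasing[of 2 3 q] power_decreasing[of 3 4 q] by auto
  have pos: "0 \<le> 4 * (1 - q^2)" using q pw by simp
  have pos': "0 \<le> 1 + 6*q + q^2" using q pw by linarith
  have "0 \<le> q^3 * (256/105 + 9/35 * q + 5/7 * q^2)"
    by (rule mult_nonneg_nonneg[OF zero_le_power]; use q pw in linarith)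
  also have "\<dots> = 4 * (1 - q^2) * ?al + (1 + 6*q + q^2) * ?bl - 5 * (1 + q)"
    by (simp add: field_simps eval_nat_numeral)
  also have "\<dots> \<le> 4 * (1 - q^2) * a + (1 + 6*q + q^2) * b - 5 * (1 + q)"
    using a b pos pos' by (intro diff_mono add_mono mult_left_mono order_refl)
  also have "\<dots> = 2 * (1 + q) * (4 * (F * T) + G * (2 / T - T) - 5/2)"
    using q unfolding F_def G_def T_def FGT
    by (simp add: power_divide) (simp add: divide_simps, simp add: algebra_simps eval_nat_numeral)
  finally show ?thesis using q by (simp add: zero_le_mult_iff)
qed

lemma curvature_nonneg: "0 \<le> 1 / (2 * T) - 2 * F + G"
proof -
  obtain q a b :: real where q: "0 < q" "q < 1"
    and FGT: "lead_even p = (1 + q) * a / 2" "lead_odd p = (1 - q) * b / 2" "tanh p = (1 - q) / (1 + q)"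
    and a: "1 - q/3 + q^2/5 - q^3/7 \<le> a" "a \<le> 1 - q/3 + q^2/5 - q^3/7 + q^4/9"
    and b: "1 + q/3 + q^2/5 + q^3/7 \<le> b" "(1 - q) * b \<le> (1 - q) * (1 + q/3 + q^2/5 + q^3/7) + q^4/9"
    by (rule lead_param[OF p])
  let ?al = "1 - q/3 + q^2/5 - q^3/7" and ?ah = "1 - q/3 + q^2/5 - q^3/7 + q^4/9"
  let ?bl = "1 + q/3 + q^2/5 + q^3/7" and ?bh = "(1 - q) * (1 + q/3 + q^2/5 + q^3/7) + q^4/9"
  have pw: "q^2 \<le> q" "q^3 \<le> q^2" "q^4 \<le> q^3" "0 < q^4" "0 < q^3" "0 < q^2"
    using q power_decreasing[of 1 2 q] power_decreasing[of 2 3 q] power_decreasing[of 3 4 q] by auto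
  have ah: "a \<le> 1 - q/3 + q^2/5" using a(2) pw by linarith
  have "0 \<le> q^2 * (32/15 - 62/105 * q + 11/35 * q^2 + q^3/7)"
    by (rule mult_nonneg_nonneg[OF zero_le_power]; use q pw in linarith)
  also have "\<dots> = (1 + q) - 2 * (1 - q^2) * (1 - q/3 + q^2/5) + (1 - q)^2 * ?bl"
    by (simp add: field_simps eval_nat_numeral)
  also have "\<dots> \<le> (1 + q) - 2 * (1 - q^2) * a + (1 - q)^2 * b"
    using q a b pw ah by (intro diff_mono add_mono mult_left_mono) auto
  also have "\<dots> = 2 * (1 - q) * (1 / (2 * T) - 2 * F + G)"
    using q unfolding F_def G_def T_def FGT
    by (simp add: power_divide) (simp add: divide_simps, simp add: algebra_simps eval_nat_numeral)
  finally show ?thesis using q by (simp add: zero_le_mult_iff)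
qed

lemma excess_corner_nonneg: "T \<le> F + G * T^2"
proof -
  obtain q a b :: real where q: "0 < q" "q < 1"
    and FGT: "lead_even p = (1 + q) * a / 2" "lead_odd p = (1 - q) * b / 2" "tanh p = (1 - q) / (1 + q)"
    and a: "1 - q/3 + q^2/5 - q^3/7 \<le> a" "a \<le> 1 - q/3 + q^2/5 - q^3/7 + q^4/9"
    and b: "1 + q/3 + q^2/5 + q^3/7 \<le> b" "(1 - q) * b \<le> (1 - q) * (1 + q/3 + q^2/5 + q^3/7) + q^4/9"
    by (rule lead_param[OF p])
  let ?al = "1 - q/3 + q^2/5 - q^3/7" and ?ah = "1 - q/3 + q^2/5 - q^3/7 + q^4/9"
  let ?bl = "1 + q/3 + q^2/5 + q^3/7" and ?bh = "(1 - q) * (1 + q/3 + q^2/5 + q^3/7) + q^4/9"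
  have pw: "q^2 \<le> q" "q^3 \<le> q^2" "q^4 \<le> q^3" "0 < q^4" "0 < q^3" "0 < q^2"
    using q power_decreasing[of 1 2 q] power_decreasing[of 2 3 q] power_decreasing[of 3 4 q] by auto
  have pos: "0 \<le> (1 + q)^3" "0 \<le> (1 - q)^3" using q by auto
  have "0 \<le> q^2 * (32/5 - 34/105 * q^2 - 2/7 * q^4)"
    by (rule mult_nonneg_nonneg[OF zero_le_power]; use q pw in linarith)
  also have "\<dots> = (1 + q)^3 * ?al + (1 - q)^3 * ?bl - 2 * (1 - q^2)"
    by (simp add: field_simps eval_nat_numeral)
  also have "\<dots> \<le> (1 + q)^3 * a + (1 - q)^3 * b - 2 * (1 - q^2)"
    using a b pos by (intro diff_mono add_mono mult_left_mono order_refl)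
  also have "\<dots> = 2 * (1 + q)^2 * (F + G * T^2 - T)"
    using q unfolding F_def G_def T_def FGT
    by (simp add: power_divide) (simp add: divide_simps, simp add: algebra_simps eval_nat_numeral)
  finally show ?thesis using q by (simp add: zero_le_mult_iff)
qed

end

section \<open>The explicit potential and its symmetries\<close>

text \<open>
  The core inequality. With \<open>a = tanh t\<close>, \<open>b = tanh q\<close> and \<open>T = tanh
  p\<close>, the form is the amount, divided by \<open>cosh t * cosh q\<close>, by which four times
  the second derivative along the comb axis exceeds the second derivative along
  \<open>(\<epsilon>\<^sub>1, \<epsilon>\<^sub>2, \<epsilon>\<^sub>3)\<close>, where \<open>\<sigma> =
  \<epsilon>\<^sub>1 \<epsilon>\<^sub>2\<close> and \<open>\<tau> = \<epsilon>\<^sub>1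
  \<epsilon>\<^sub>3\<close>. It is bilinear in \<open>(a, b)\<close>. Signs of its slopes push the
  minimum to the corner \<open>(T, T)\<close> or \<open>(T, -T)\<close> of the triangle, where the
  corner inequalities apply.
\<close>

lemma sector_bilinear_nonneg:
  fixes F G T U a b \<sigma> \<tau> :: real
  assumes T: "0 < T" "T < 1" and U: "U = 1 / T"
    and F: "F * T \<le> 1/2" and G: "T / 2 \<le> G" "G \<le> 1/2"
    and I1: "G * (2 + T^2) \<le> F * (1 + 2 * T^2)"
    and I2: "3 * T \<le> F * (1 + 2 * T^2) + G * (2 + T^2)"
    and I3: "0 \<le> F * (1 - 6 * T^2) - G * (6 - T^2) + 5 * T"
    and I4: "5/2 \<le> 4 * (F * T) + G * (2 / T - T)"
    and I5: "0 \<le> 1 / (2 * T) - 2 * F + G"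
    and ab: "\<bar>b\<bar> \<le> a" "a \<le> T" and sg: "\<sigma> = 1 \<or> \<sigma> = -1" "\<tau> = 1 \<or> \<tau> = -1"
  shows "0 \<le> F * (1 - 2*\<sigma>*T*a - 2*\<tau>*T*b - 2*\<sigma>*\<tau>*a*b)
           + G * (a*b - 2*\<sigma>*b*U - 2*\<tau>*a*U - 2*\<sigma>*\<tau>)
           + (- (a + b) + T/2 + a*b*U/2 + (\<sigma> + \<tau> + \<sigma>*\<tau>) * (a + b))"
proof -
  have TU: "T * U = 1" using T U by simp
  have TTU: "T * (T * U) = T" using TU by simp
  have b_bounds: "b \<le> a" "- a \<le> b" "0 \<le> a" using ab by linarith+
  \<comment> \<open>When both signs are \<open>1\<close> the form is \<open>c0 - (a + b) * c1 + a * b * c2\<close>; when both are \<open>-1\<close>, the sign of \<open>c1\<close> changes.\<close>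
  define c0 where "c0 = F - 2*G + T/2"
  define c1 where "c1 = 2*F*T + 2*G*U - 2"
  define c2 where "c2 = U/2 - 2*F + G"
  have c2: "0 \<le> c2" using I5 by (simp add: c2_def U)
  have "c1 - T * c2 = 4*(F*T) + G * (2 * U - T) - 5/2"
    using TU by (simp add: c1_def c2_def algebra_simps)
  then have "c1 - T * c2 = 4*(F*T) + G * (2 / T - T) - 5/2" by (simp add: U)
  then have "0 \<le> c1 - T * c2" using I4 by linarith
  then have c1T: "T * c2 \<le> c1" by simp
  have c1a: "x * c2 \<le> c1" if "x \<le> T" for x
    using c1T mult_right_mono[OF that c2] by linarith
  have c1: "0 \<le> c1" using c1a[of 0] T by simp
  \<comment> \<open>When the signs differ, the linear coefficients of \<open>a\<close> and \<open>b\<close> are \<open>-2 - k\<close> and \<open>-2 + k\<close> in one order or the other.\<close>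
  define k where "k = 2*(G*U - F*T)"
  have "1/2 \<le> G*U" using G T by (simp add: U field_simps)
  then have k: "0 \<le> k" using F by (simp add: k_def)
  define d0 where "d0 = F + 2*G + T/2"
  define e where "e = 2*F + G + U/2"
  have "e * T = 2*(F*T) + G*T + 1/2" using TU by (simp add: e_def algebra_simps)
  moreover have "G * T \<le> 1/2 * 1" using G T by (intro mult_mono) auto
  ultimately have eT: "e * T \<le> 2" using F by linarith
  have F0: "0 \<le> F"
  proof -
    have "0 \<le> G * (2 + T^2)" using G T by (intro mult_nonneg_nonneg) auto
    then have "0 \<le> F * (1 + 2*T^2)" using I1 by linarith
    moreover have "0 < 1 + 2*T^2" by (simp add: add_pos_nonneg)
    ultimately show ?thesis by (simp add: zero_le_mult_iff)
  qed
  have "0 \<le> e" using F0 G T by (auto simp: e_def U)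
  then have ex: "e * x \<le> 2" if "x \<le> T" for x
    using eT mult_left_mono[OF that, of e] by linarith
  have corner_minus: "0 \<le> d0 - 2*k*T - e*T^2"
  proof -
    have "d0 - 2*k*T - e*T^2 = F * (1 + 2 * T^2) - G * (2 + T^2)"
      using T unfolding d0_def k_def e_def U by (simp add: field_simps power2_eq_square)
    then show ?thesis using I1 by simp
  qed
  have corner_plus: "0 \<le> d0 - 4*T + e*T^2"
  proof -
    have "d0 - 4*T + e*T^2 = F * (1 + 2 * T^2) + G * (2 + T^2) - 3 * T"
      using T unfolding d0_def k_def e_def U by (simp add: field_simps power2_eq_square)
    then show ?thesis using I2 by simp
  qed
  consider (pp) "\<sigma> = 1" "\<tau> = 1" | (mm) "\<sigma> = -1" "\<tau> = -1" | (mp) "\<sigma> = -1" "\<tau> = 1" | (pm) "\<sigma> = 1" "\<tau> = -1"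
    using sg by blast
  then show ?thesis
  proof cases
    case pp
    have "F * (1 - 6 * T^2) - G * (6 - T^2) + 5 * T + (T - a)*((c1 - T*c2) + (c1 - a*c2)) + (a - b)*(c1 - a*c2)
       = c0 - (a + b)*c1 + a*b*c2"
      using T unfolding c0_def c1_def c2_def U by (simp add: field_simps power2_eq_square)
    moreover have "0 \<le> (T - a)*((c1 - T*c2) + (c1 - a*c2))" "0 \<le> (a - b)*(c1 - a*c2)"
      using ab b_bounds c1T c1a[of a] by (auto intro!: mult_nonneg_nonneg)
    ultimately have "0 \<le> c0 - (a + b)*c1 + a*b*c2" using I3 by linarith
    then show ?thesis unfolding pp c0_def c1_def c2_def by (simp add: algebra_simps)
  next
    case mm
    have "F * (1 + 2 * T^2) - G * (2 + T^2) + (T^2 - a^2)*c2 + (a + b)*(c1 + a*c2) = c0 + (a + b)*c1 + a*b*c2"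
      using T unfolding c0_def c1_def c2_def U by (simp add: field_simps power2_eq_square)
    moreover have "0 \<le> (T^2 - a^2)*c2" "0 \<le> (a + b)*(c1 + a*c2)"
      using ab b_bounds c1 c2 by (auto intro!: mult_nonneg_nonneg add_nonneg_nonneg power_mono)
    ultimately have "0 \<le> c0 + (a + b)*c1 + a*b*c2" using I1 by linarith
    then show ?thesis unfolding mm c0_def c1_def c2_def by (simp add: algebra_simps)
  next
    case mp
    \<comment> \<open>The form decreases in \<open>a\<close>; on the edge \<open>a = T\<close> it interpolates linearly between the corners.\<close>
    have "2*T*(d0 - (2+k)*a - (2-k)*b + e*a*b)
        = (T + b)*(d0 - 4*T + e*T^2) + (T - b)*(d0 - 2*k*T - e*T^2) + 2*T*((T - a)*(2 + k - e*b))"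
      by (simp add: algebra_simps power2_eq_square)
    moreover have "0 \<le> (T + b)*(d0 - 4*T + e*T^2)" "0 \<le> (T - b)*(d0 - 2*k*T - e*T^2)"
      "0 \<le> 2*T*((T - a)*(2 + k - e*b))"
      using corner_minus corner_plus ab b_bounds T k ex[of b] by (auto intro!: mult_nonneg_nonneg)
    ultimately have "0 \<le> 2*T*(d0 - (2+k)*a - (2-k)*b + e*a*b)" by linarith
    then have "0 \<le> d0 - (2+k)*a - (2-k)*b + e*a*b" using T by (simp add: zero_le_mult_iff)
    then show ?thesis unfolding mp d0_def k_def e_def by (simp add: algebra_simps)
  next
    case pm
    have "d0 - (2-k)*a - (2+k)*b + e*a*b
        = (d0 - 4*T + e*T^2) + (T - a)*((2 - e*T) + (2 - e*a)) + (a - b)*(2 + k - e*a)"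
      by (simp add: algebra_simps power2_eq_square)
    moreover have "0 \<le> (T - a)*((2 - e*T) + (2 - e*a))" "0 \<le> (a - b)*(2 + k - e*a)"
      using ab b_bounds T k ex[of a] eT by (auto intro!: mult_nonneg_nonneg)
    ultimately have "0 \<le> d0 - (2-k)*a - (2+k)*b + e*a*b" using corner_plus by linarith
    then show ?thesis unfolding pm d0_def k_def e_def by (simp add: algebra_simps)
  qed
qed

text \<open>
  The functions \<open>maxabs\<close> and \<open>evenmax\<close> are invariant under permutations and
  even sign changes of the three arguments; \<open>evenmax\<close> is the maximum of
  \<open>\<plusminus>a \<plusminus> b \<plusminus> c\<close> over an even number of minus signs.
\<close>

definition maxabs :: "real \<Rightarrow> real \<Rightarrow> real \<Rightarrow> real" where
  "maxabs a b c = max \<bar>a\<bar> (max \<bar>b\<bar> \<bar>c\<bar>)"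

definition evenmax :: "real \<Rightarrow> real \<Rightarrow> real \<Rightarrow> real" where
  "evenmax a b c = max (max (a + b + c) (a - b - c)) (max (- a + b - c) (- a - b + c))"

text \<open>
  Up to scaling, the amount by which the solution exceeds \<open>\<Phi>\<close>. In the region where
  \<open>p\<close> is the largest of \<open>p\<close>, \<open>\<bar>t\<bar>\<close>,
  \<open>\<bar>q\<bar>\<close>, the equation along the comb axis says that the excess equals its
  second derivative in \<open>t\<close>, so it is a combination of \<open>cosh t\<close> and
  \<open>sinh t\<close>; the coefficients are determined by boundedness and by the reflection
  conditions at the walls between permuted copies of the region. Written with \<open>maxabs\<close>
  and \<open>evenmax\<close>, one formula covers all copies.
\<close>

definition excess :: "real \<Rightarrow> real \<Rightarrow> real \<Rightarrow> real" where
  "excess a b c =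
     cosh a * cosh b * cosh c * arctan (exp (- maxabs a b c))
   + sinh a * sinh b * sinh c * artanh (exp (- maxabs a b c))
   - sinh (evenmax a b c - maxabs a b c) / 2"

definition potential :: "real \<Rightarrow> real \<Rightarrow> real \<Rightarrow> real" where
  "potential a b c = evenmax a b c / 2 + excess a b c"

text \<open>
  The part of the potential that depends on the gap \<open>z\<close> between the two leaders. The
  function is twice continuously differentiable: the corner of \<open>\<bar>z\<bar>\<close> cancels
  against that of \<open>sinh \<bar>z\<bar>\<close>.
\<close>

definition kink :: "real \<Rightarrow> real" where
  "kink z = (\<bar>z\<bar> - sinh \<bar>z\<bar>) / 2"

text \<open>
  The potential on the region where the first coordinate leads. As a formula it is twice continuously
  differentiable for all \<open>t\<close> and \<open>q\<close> as long as \<open>0 < p\<close>, so it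
  can be used beyond the walls \<open>\<bar>t\<bar> = p\<close> and \<open>\<bar>q\<bar> = p\<close>
  as well.
\<close>

definition chamber :: "real \<Rightarrow> real \<Rightarrow> real \<Rightarrow> real" where
  "chamber p t q = p / 2 + kink (t + q) + lead_even p * (cosh t * cosh q) + lead_odd p * (sinh t * sinh q)"

lemma maxabs_sym: "maxabs a b c = maxabs b a c" "maxabs a b c = maxabs a c b" "maxabs (- a) (- b) c = maxabs a b c"
  by (simp_all add: maxabs_def max.commute max.left_commute)

lemma evenmax_sym: "evenmax a b c = evenmax b a c" "evenmax a b c = evenmax a c b" "evenmax (- a) (- b) c = evenmax a b c"
  by (auto simp: evenmax_def max_def)

lemma excess_swap12: "excess a b c = excess b a c"
  and excess_swap23: "excess a b c = excess a c b"
  and excess_flip12: "excess (- a) (- b) c = excess a b c"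
  unfolding excess_def maxabs_sym(3) evenmax_sym(3)
  using maxabs_sym(1,2)[of a b c] evenmax_sym(1,2)[of a b c] by (simp_all add: mult_ac)

lemma potential_swap12: "potential a b c = potential b a c"
  and potential_swap23: "potential a b c = potential a c b"
  and potential_flip12: "potential (- a) (- b) c = potential a b c"
  unfolding potential_def evenmax_sym(3) excess_flip12
  using evenmax_sym(1,2)[of a b c] excess_swap12[of a b c] excess_swap23[of a b c] by simp_all

text \<open>
  Permutations and even sign changes form the symmetry group of a tetrahedron, the image of the
  permutations of the four experts; \<open>\<bar>q\<bar> \<le> t \<le> p\<close> is a fundamental
  domain.
\<close>

lemma tetrahedral_wlog:
  fixes P :: "real \<Rightarrow> real \<Rightarrow> real \<Rightarrow> bool"
  assumes swap12: "\<And>a b c. P a b c \<Longrightarrow> P b a c"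
    and swap23: "\<And>a b c. P a b c \<Longrightarrow> P a c b"
    and flip12: "\<And>a b c. P a b c \<Longrightarrow> P (- a) (- b) c"
    and ordered: "\<And>p t q. \<bar>q\<bar> \<le> t \<Longrightarrow> t \<le> p \<Longrightarrow> P p t q"
  shows "P a b c"
proof -
  have flip13: "P (- a) b (- c)" if "P a b c" for a b c
    using swap23[OF flip12[OF swap23[OF that]]] .
  have flip23: "P a (- b) (- c)" if "P a b c" for a b c
    using swap12[OF flip13[OF swap12[OF that]]] .
  have 1: "P a b c" if "\<bar>c\<bar> \<le> \<bar>b\<bar>" "\<bar>b\<bar> \<le> \<bar>a\<bar>" for a b c
  proof -
    consider "0 \<le> a" "0 \<le> b" | "0 \<le> a" "b < 0" | "a < 0" "b < 0" | "a < 0" "0 \<le> b" by linarith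
    then show ?thesis
    proof cases
      case 1 then show ?thesis using ordered[of c b a] that by auto
    next
      case 2 then show ?thesis using flip23[of a "- b" "- c"] ordered[of "- c" "- b" a] that by auto
    next
      case 3 then show ?thesis using flip12[of "- a" "- b" c] ordered[of c "- b" "- a"] that by auto
    next
      case 4 then show ?thesis using flip13[of "- a" b "- c"] ordered[of "- c" b "- a"] that by auto
    qed
  qed
  have first: "P a b c" if "\<bar>b\<bar> \<le> \<bar>a\<bar>" "\<bar>c\<bar> \<le> \<bar>a\<bar>" for a b c
    using 1[of c b a] swap23[OF 1[of b c a]] that by (cases "\<bar>c\<bar> \<le> \<bar>b\<bar>") auto
  consider "\<bar>b\<bar> \<le> \<bar>a\<bar>" "\<bar>c\<bar> \<le> \<bar>a\<bar>" | "\<bar>a\<bar> \<le> \<bar>b\<bar>" "\<bar>c\<bar> \<le> \<bar>b\<bar>" | "\<bar>a\<bar> \<le> \<bar>c\<bar>" "\<bar>b\<bar> \<le> \<bar>c\<bar>" by linarith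
  then show ?thesis
  proof cases
    case 1 then show ?thesis by (rule first)
  next
    case 2 then show ?thesis using swap12[OF first[of a b c]] by simp
  next
    case 3 then show ?thesis using swap23[OF swap12[OF first[of a c b]]] by simp
  qed
qed

lemma evenmax_chamber: "\<bar>t\<bar> \<le> p \<Longrightarrow> \<bar>q\<bar> \<le> p \<Longrightarrow> evenmax p t q = p + \<bar>t + q\<bar>"
  by (auto simp: evenmax_def max_def)

lemma maxabs_chamber: "\<bar>t\<bar> \<le> p \<Longrightarrow> \<bar>q\<bar> \<le> p \<Longrightarrow> maxabs p t q = p"
  by (auto simp: maxabs_def max_def)

lemma excess_chamber:
  assumes "\<bar>t\<bar> \<le> p" "\<bar>q\<bar> \<le> p"
  shows "excess p t q = lead_even p * (cosh t * cosh q) + lead_odd p * (sinh t * sinh q) - sinh \<bar>t + q\<bar> / 2"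
  unfolding excess_def maxabs_chamber[OF assms] evenmax_chamber[OF assms]
  by (simp add: lead_even_def lead_odd_def mult_ac)

lemma potential_chamber:
  assumes "\<bar>t\<bar> \<le> p" "\<bar>q\<bar> \<le> p"
  shows "potential p t q = chamber p t q"
  unfolding potential_def excess_chamber[OF assms] evenmax_chamber[OF assms] chamber_def kink_def
  by (simp add: field_simps)

text \<open>
  The lower bound compares the comb with the empty set, which leaves the state where it is. The upper
  bound reflects that the coefficients of \<open>cosh\<close> and \<open>sinh\<close> differ from
  \<open>1/2\<close> by \<open>exp (-2 p)\<close> at most, so that the growing exponentials cancel.
\<close>

lemma excess_bounds: "0 \<le> excess a b c \<and> excess a b c \<le> 1"
proof (induction a b c rule: tetrahedral_wlog)
  case (4 p t q)
  have tq: "\<bar>t\<bar> \<le> p" "\<bar>q\<bar> \<le> p" "0 \<le> t + q" "0 \<le> t" "0 \<le> p" using 4 by linarith+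
  show ?case
  proof (cases "p = 0")
    case True
    then have "t = 0" "q = 0" using tq by auto
    have "pi / 4 \<le> 1" using pi_less_4 by simp
    then show ?thesis using True \<open>t = 0\<close> \<open>q = 0\<close>
      by (simp add: excess_def maxabs_def evenmax_def arctan_one)
  next
    case False
    then have p: "0 < p" using tq by simp
    note lb = lead_bounds[OF p] and eb = lead_exp_bounds[OF p]
    let ?F = "lead_even p" and ?G = "lead_odd p" and ?T = "tanh p" and ?a = "tanh t" and ?b = "tanh q"
    have ab: "?b \<le> ?a" "?a \<le> ?T" "0 \<le> ?a" using 4 tq by auto
    have ex: "excess p t q = ?F * (cosh t * cosh q) + ?G * (sinh t * sinh q) - sinh (t + q) / 2"
      using excess_chamber[OF tq(1,2)] tq by simp
    also have "\<dots> = cosh t * cosh q * (?F + ?G * (?a * ?b) - (?a + ?b) / 2)"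
      by (simp add: sinh_add tanh_def field_simps)
    finally have ex2: "excess p t q = cosh t * cosh q * (?F + ?G * (?a * ?b) - (?a + ?b) / 2)" .
    have Gle: "?G * (?T + ?a) \<le> 1/2 * 2" "?G * ?a \<le> 1/2 * 1"
      by (rule mult_mono; use lb ab in linarith)+
    have "?F + ?G * (?a * ?b) - (?a + ?b) / 2
      = (?F + ?G * ?T^2 - ?T) + (?T - ?a) * (1 - ?G * (?T + ?a)) + (?a - ?b) * (1/2 - ?G * ?a)"
      by (simp add: field_simps power2_eq_square)
    moreover have "0 \<le> (?T - ?a) * (1 - ?G * (?T + ?a))" "0 \<le> (?a - ?b) * (1/2 - ?G * ?a)"
      by (rule mult_nonneg_nonneg; use ab Gle in linarith)+
    ultimately have "0 \<le> ?F + ?G * (?a * ?b) - (?a + ?b) / 2"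
      using excess_corner_nonneg[OF p] by linarith
    then have "0 \<le> excess p t q" unfolding ex2 by simp
    moreover have "excess p t q \<le> 1"
    proof -
      define E D where "E = exp (- 2 * p)" and "D = cosh (t + q) - sinh (t + q)"
      have ediff: "D \<le> 1" using tq cosh_minus_sinh[of "t + q"] by (simp add: D_def)
      have coshle: "E * cosh x \<le> 1" if "\<bar>x\<bar> \<le> 2 * p" for x
      proof -
        have "cosh x \<le> exp (2 * p)"
        proof -
          have "exp x \<le> exp (2 * p)" "exp (- x) \<le> exp (2 * p)" using that by auto
          then have "exp x + exp (- x) \<le> exp (2 * p) + exp (2 * p)" by (rule add_mono)
          then show ?thesis unfolding cosh_field_def by simp
        qed
        then have "E * cosh x \<le> E * exp (2 * p)" by (intro mult_left_mono) (auto simp: E_def)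
        then show ?thesis by (simp add: E_def flip: exp_add)
      qed
      have Fc: "?F * (cosh t * cosh q) \<le> (1 + E) / 2 * (cosh t * cosh q)"
        using eb by (intro mult_right_mono) (auto simp: E_def)
      have tmq: "cosh (t + q) = cosh t * cosh q + sinh t * sinh q" "cosh (t - q) = cosh t * cosh q - sinh t * sinh q"
        by (simp_all add: cosh_add cosh_diff)
      show ?thesis
      proof (cases "0 \<le> q")
        case True
        have "?G * (sinh t * sinh q) \<le> 1/2 * (sinh t * sinh q)"
          using lb True tq by (intro mult_right_mono) auto
        then have "excess p t q \<le> D / 2 + E * (cosh t * cosh q) / 2"
          using Fc unfolding ex tmq D_def by (simp add: field_simps)
        moreover have "E * (cosh t * cosh q) \<le> 1"
        proof -
          have "cosh t * cosh q = (cosh (t + q) + cosh (t - q)) / 2" unfolding tmq by simp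
          then have "E * (cosh t * cosh q) = (E * cosh (t + q) + E * cosh (t - q)) / 2"
            by (simp only: distrib_left times_divide_eq_right)
          moreover have "E * cosh (t + q) \<le> 1" "E * cosh (t - q) \<le> 1"
            by (rule coshle; use tq in linarith)+
          moreover have "x \<le> 1" if "x = (a + b) / 2" "a \<le> 1" "b \<le> 1" for x a b :: real
            using that by simp
          ultimately show ?thesis by blast
        qed
        ultimately show ?thesis using ediff by linarith
      next
        case False
        have "?G * (sinh t * sinh q) \<le> (1 - E) / 2 * (sinh t * sinh q)"
          using eb False tq by (intro mult_right_mono_neg) (auto simp: E_def mult_nonneg_nonpos)
        then have "excess p t q \<le> D / 2 + E * cosh (t - q) / 2"
          using Fc unfolding ex tmq D_def by (simp add: field_simps)
        moreover have "E * cosh (t - q) \<le> 1" by (rule coshle; use tq in linarith)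
        ultimately show ?thesis using ediff by linarith
      qed
    qed
    ultimately show ?thesis by simp
  qed
qed (use excess_swap12 excess_swap23 excess_flip12 in metis)+

section \<open>Crossing a face of the leading chamber\<close>

lemma le_sinh:
  assumes "0 \<le> z"
  shows "(z::real) \<le> sinh z"
proof -
  have "sinh 0 - 0 \<le> sinh z - z"
    by (rule nondecreasing_from_0[where f' = "\<lambda>x. cosh x - 1", OF assms])
       (auto intro!: derivative_eq_intros simp: cosh_real_ge_1)
  then show ?thesis by simp
qed

lemma sinh_le:
  assumes "0 \<le> (z::real)" "z \<le> 1"
  shows "sinh z \<le> 3/2 * z"
proof -
  have "z * z \<le> z" using assms by (simp add: mult_left_le)
  moreover have "exp z - exp (- z) \<le> (1 + z + z^2) - (1 + - z)"
    using exp_bound[OF assms] exp_ge_add_one_self[of "- z"] by (rule diff_mono)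
  ultimately show ?thesis unfolding sinh_field_def by (simp add: power2_eq_square)
qed

lemma cosh_le:
  assumes "\<bar>z::real\<bar> \<le> 1"
  shows "cosh z \<le> 1 + z^2"
proof -
  have "1 + 0^2 - cosh 0 \<le> 1 + \<bar>z\<bar>^2 - cosh \<bar>z\<bar>"
  proof (rule nondecreasing_from_0[where f' = "\<lambda>x. 2 * x - sinh x"])
    fix x :: real assume "0 \<le> x" "x \<le> \<bar>z\<bar>"
    then show "0 \<le> 2 * x - sinh x" using sinh_le[of x] assms by auto
  qed (auto intro!: derivative_eq_intros)
  then show ?thesis by simp
qed

lemma sinh_cubic:
  assumes "0 \<le> (z::real)" "z \<le> 1"
  shows "sinh z \<le> z + z^3"
proof -
  have "0 + 0^3 - sinh 0 \<le> z + z^3 - sinh z"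
  proof (rule nondecreasing_from_0[where f' = "\<lambda>x. 1 + 3 * x^2 - cosh x"])
    fix x :: real assume "0 \<le> x" "x \<le> z"
    then have "cosh x \<le> 1 + x^2" using cosh_le[of x] assms by auto
    then show "0 \<le> 1 + 3 * x^2 - cosh x" using zero_le_power2[of x] by linarith
  qed (use assms in \<open>auto intro!: derivative_eq_intros\<close>)
  then show ?thesis by simp
qed

lemma cosh_quadratic:
  assumes "0 \<le> (h::real)" "h \<le> 1"
  shows "h^2 \<le> 2 * (cosh h - 1)" "2 * (cosh h - 1) \<le> h^2 + h^3"
proof -
  have "2 * (cosh 0 - 1) - 0^2 \<le> 2 * (cosh h - 1) - h^2"
  proof (rule nondecreasing_from_0[where f' = "\<lambda>x. 2 * sinh x - 2 * x"])
    fix x :: real assume "0 \<le> x" "x \<le> h"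
    then show "0 \<le> 2 * sinh x - 2 * x" using le_sinh[of x] by auto
  qed (use assms in \<open>auto intro!: derivative_eq_intros\<close>)
  then show "h^2 \<le> 2 * (cosh h - 1)" by simp
  have "0^2 + 0^3 - 2 * (cosh 0 - 1) \<le> h^2 + h^3 - 2 * (cosh h - 1)"
  proof (rule nondecreasing_from_0[where f' = "\<lambda>x. 2 * x + 3 * x^2 - 2 * sinh x"])
    fix x :: real assume x: "0 \<le> x" "x \<le> h"
    have "x^3 \<le> x^2" using x assms power_decreasing[of 2 3 x] by auto
    moreover have "0 \<le> x^2" by simp
    ultimately show "0 \<le> 2 * x + 3 * x^2 - 2 * sinh x" using sinh_cubic[of x] x assms by linarith
  qed (use assms in \<open>auto intro!: derivative_eq_intros\<close>)
  then show "2 * (cosh h - 1) \<le> h^2 + h^3" by simp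
qed

lemma arctan_exp_deriv: "((\<lambda>u. arctan (exp (- u))) has_real_derivative - 1 / (2 * cosh u)) (at u)"
proof -
  have "exp (- u) * (1 / (1 + (exp (- u))^2)) = 1 / (2 * cosh u)"
  proof -
    have "exp u * exp (- u) = 1" by (simp flip: exp_add)
    then have "(1 + (exp (- u))^2) = exp (- u) * (2 * cosh u)"
      by (simp add: cosh_field_def power2_eq_square algebra_simps)
    then show ?thesis by simp
  qed
  then show ?thesis
    by (auto intro!: derivative_eq_intros simp: inverse_eq_divide)
qed

lemma artanh_exp_deriv:
  assumes "0 < u"
  shows "((\<lambda>u. artanh (exp (- u))) has_real_derivative - 1 / (2 * sinh u)) (at u)"
proof -
  have eq: "exp (- u) * (1 / (1 - (exp (- u))^2)) = 1 / (2 * sinh u)"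
  proof -
    have "exp u * exp (- u) = 1" by (simp flip: exp_add)
    then have "(1 - (exp (- u))^2) = exp (- u) * (2 * sinh u)"
      by (simp add: sinh_field_def power2_eq_square algebra_simps)
    then show ?thesis by simp
  qed
  have "-1 < exp (- u)" "exp (- u) < 1"
    using assms exp_gt_zero[of "-u"] by (auto simp del: exp_gt_zero intro: order_less_trans[of _ 0])
  then have d: "(artanh has_real_derivative 1 / (1 - (exp (- u))^2)) (at (exp (- u)))"
    by (intro artanh_real_has_field_derivative) auto
  have "((\<lambda>u. exp (- u)) has_real_derivative - exp (- u)) (at u)"
    by (auto intro!: derivative_eq_intros)
  from DERIV_chain2[OF d this] eq show ?thesis by (simp add: mult.commute)
qed

text \<open>
  The two formulas that meet at \<open>t = p\<close> agree there to second order, so beyond the wall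
  they separate only cubically. Dividing the difference into its \<open>cosh q\<close> and \<open>sinh
  q\<close> parts and each part by the product of hyperbolic functions in front leaves functions
  \<open>X\<close> and \<open>Y\<close> whose derivatives are explicitly proportional to \<open>cosh
  (u - p) - 1\<close>. The constant does not depend on \<open>p\<close>, although the formulas
  degenerate as \<open>p \<rightarrow> 0\<close>.
\<close>

lemma chamber_diff_ordered:
  assumes p: "0 < p" and pt: "p \<le> t" "t \<le> p + k" and k: "k \<le> 1" and q: "\<bar>q\<bar> \<le> t"
  shows "\<bar>chamber p t q - chamber t p q\<bar> \<le> 21 * k^3"
proof (cases "p = t")
  case True
  then show ?thesis using pt by simp
next
  case False
  then have lt: "p < t" using pt by simp
  have k0: "0 < k" using pt lt by linarith
  let ?X = "\<lambda>u. arctan (exp (- p)) - arctan (exp (- u)) - (sinh u - sinh p) / (2 * cosh p * cosh u)"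
  let ?Y = "\<lambda>u. artanh (exp (- p)) - artanh (exp (- u)) - (cosh u - cosh p) / (2 * sinh p * sinh u)"
  have sp: "0 < sinh p" using p by simp
  obtain u where u: "p < u" "u < t" "?X t - ?X p = (t - p) * ((cosh (u - p) - 1) / (2 * cosh p * (cosh u)^2))"
  proof -
    have "\<exists>u>p. u < t \<and> ?X t - ?X p = (t - p) * ((cosh (u - p) - 1) / (2 * cosh p * (cosh u)^2))"
    proof (rule MVT2[OF lt])
      fix u assume "p \<le> u" "u \<le> t"
      have n: "cosh u * (2 * cosh p * cosh u) - (sinh u - sinh p) * (2 * cosh p * sinh u) = 2 * cosh p * ((cosh u)^2 - (sinh u)^2 + sinh p * sinh u)"
        by (simp add: algebra_simps power2_eq_square)
      have n': "(cosh u)^2 - (sinh u)^2 + sinh p * sinh u = 1 + sinh p * sinh u" by (simp add: cosh_square_eq)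
      have "0 - (- 1 / (2 * cosh u)) - (cosh u * (2 * cosh p * cosh u) - (sinh u - sinh p) * (2 * cosh p * sinh u)) / ((2 * cosh p * cosh u) * (2 * cosh p * cosh u))
        = (cosh (u - p) - 1) / (2 * cosh p * (cosh u)^2)"
        unfolding n n' by (simp add: cosh_diff field_simps power2_eq_square)
      then show "(?X has_real_derivative (cosh (u - p) - 1) / (2 * cosh p * (cosh u)^2)) (at u)"
      proof (rule subst)
        have "((\<lambda>u. (sinh u - sinh p) / (2 * cosh p * cosh u)) has_real_derivative
          (cosh u * (2 * cosh p * cosh u) - (sinh u - sinh p) * (2 * cosh p * sinh u)) / ((2 * cosh p * cosh u) * (2 * cosh p * cosh u))) (at u)"
          by (auto intro!: derivative_eq_intros simp: algebra_simps)
        then show "(?X has_real_derivative 0 - (- 1 / (2 * cosh u)) - (cosh u * (2 * cosh p * cosh u) - (sinh u - sinh p) * (2 * cosh p * sinh u)) / ((2 * cosh p * cosh u) * (2 * cosh p * cosh u))) (at u)"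
          by (intro DERIV_diff DERIV_const arctan_exp_deriv)
      qed
    qed
    then show thesis using that by blast
  qed
  obtain v where v: "p < v" "v < t" "?Y t - ?Y p = (t - p) * (- (cosh (v - p) - 1) / (2 * sinh p * (sinh v)^2))"
  proof -
    have "\<exists>u>p. u < t \<and> ?Y t - ?Y p = (t - p) * (- (cosh (u - p) - 1) / (2 * sinh p * (sinh u)^2))"
    proof (rule MVT2[OF lt])
      fix u assume u: "p \<le> u" "u \<le> t"
      have su: "0 < sinh u" using p u by simp
      have n: "sinh u * (2 * sinh p * sinh u) - (cosh u - cosh p) * (2 * sinh p * cosh u) = 2 * sinh p * ((sinh u)^2 - (cosh u)^2 + cosh p * cosh u)"
        by (simp add: algebra_simps power2_eq_square)
      have n': "(sinh u)^2 - (cosh u)^2 + cosh p * cosh u = cosh p * cosh u - 1" by (simp add: cosh_square_eq)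
      have "0 - (- 1 / (2 * sinh u)) - (sinh u * (2 * sinh p * sinh u) - (cosh u - cosh p) * (2 * sinh p * cosh u)) / ((2 * sinh p * sinh u) * (2 * sinh p * sinh u))
        = - (cosh (u - p) - 1) / (2 * sinh p * (sinh u)^2)"
        unfolding n n' using sp su by (simp add: cosh_diff field_simps power2_eq_square)
      then show "(?Y has_real_derivative - (cosh (u - p) - 1) / (2 * sinh p * (sinh u)^2)) (at u)"
      proof (rule subst)
        have "((\<lambda>u. (cosh u - cosh p) / (2 * sinh p * sinh u)) has_real_derivative
          (sinh u * (2 * sinh p * sinh u) - (cosh u - cosh p) * (2 * sinh p * cosh u)) / ((2 * sinh p * sinh u) * (2 * sinh p * sinh u))) (at u)"
          using sp su by (auto intro!: derivative_eq_intros simp: algebra_simps)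
        then show "(?Y has_real_derivative 0 - (- 1 / (2 * sinh u)) - (sinh u * (2 * sinh p * sinh u) - (cosh u - cosh p) * (2 * sinh p * cosh u)) / ((2 * sinh p * sinh u) * (2 * sinh p * sinh u))) (at u)"
          using u p by (intro DERIV_diff DERIV_const artanh_exp_deriv) auto
      qed
    qed
    then show thesis using that by blast
  qed
  have su: "0 < sinh u" and sv: "0 < sinh v" and st: "0 < sinh t" using p u v by auto
  \<comment> \<open>The hyperbolic splitting presumes \<open>0 \<le> p + q\<close>; otherwise \<open>-(p + q) \<le> k\<close> and the correction \<open>e\<close> is cubic.\<close>
  define e where "e = kink (p + q) - (p + q - sinh (p + q)) / 2"
  have e: "\<bar>e\<bar> \<le> k^3"
  proof (cases "0 \<le> p + q")
    case True
    then show ?thesis using k0 by (simp add: e_def kink_def)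
  next
    case False
    let ?z = "- (p + q)"
    have z: "0 \<le> ?z" "?z \<le> k" using False q pt by linarith+
    have abs: "\<bar>p + q\<bar> = ?z" using False by simp
    have sm: "sinh (p + q) = - sinh ?z" by (metis minus_minus sinh_minus)
    have "e = ?z - sinh ?z" unfolding e_def kink_def abs sm by (simp add: field_simps)
    moreover have "?z^3 \<le> k^3" using z by (intro power_mono) auto
    ultimately show ?thesis using le_sinh[of ?z] sinh_cubic[of ?z] z k by linarith
  qed
  have tq: "0 \<le> t + q" using q by linarith
  have cmp: "cosh q \<le> cosh t" using cosh_real_nonneg_le_iff[of "\<bar>q\<bar>" t] q p pt by simp
  have smp: "\<bar>sinh q\<bar> \<le> sinh t"
    using q sinh_real_le_iff[of q t] sinh_real_le_iff[of "- q" t] by (auto simp: abs_le_iff)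
  have eq: "chamber p t q - chamber t p q = - e + cosh q * cosh p * cosh t * ?X t + sinh q * sinh p * sinh t * ?Y t"
    using sp st tq unfolding chamber_def e_def lead_even_def lead_odd_def kink_def[of "t + q"]
    by (simp add: field_simps sinh_add)
  have "cosh q * cosh p * cosh t * ?X t = (t - p) * (cosh q * cosh t * (cosh (u - p) - 1) / (2 * (cosh u)^2))"
  proof -
    have X: "?X t = (t - p) * ((cosh (u - p) - 1) / (2 * cosh p * (cosh u)^2))" using u(3) by simp
    show ?thesis unfolding X by (simp add: field_simps)
  qed
  moreover have "0 \<le> cosh q * cosh t * (cosh (u - p) - 1) / (2 * (cosh u)^2)" 
    using cosh_real_ge_1[of "u - p"] by simp
  moreover have "cosh q * cosh t * (cosh (u - p) - 1) / (2 * (cosh u)^2) \<le> 5 * k^2"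
  proof -
    have "cosh t = cosh u * cosh (t - u) + sinh u * sinh (t - u)"
      using cosh_add[of u "t - u"] by simp
    also have "\<dots> \<le> cosh u * cosh (t - u) + cosh u * sinh (t - u)"
      using u by (intro add_left_mono mult_right_mono) (auto simp: sinh_le_cosh_real)
    also have "\<dots> = cosh u * exp (t - u)"
      using cosh_plus_sinh[of "t - u"] by (simp flip: distrib_left)
    also have "\<dots> \<le> cosh u * 3"
    proof -
      have "exp (t - u) \<le> exp 1" using u pt k by simp
      then have "exp (t - u) \<le> 3" using exp_le by linarith
      then show ?thesis by (intro mult_left_mono) auto
    qed
    finally have ct: "cosh t \<le> cosh u * 3" .
    have "cosh (u - p) - 1 \<le> (u - p)^2" using cosh_le[of "u - p"] u pt k by simp
    also have "\<dots> \<le> k^2" using u pt by (intro power_mono) auto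
    finally have cd: "cosh (u - p) - 1 \<le> k^2" .
    have "cosh q * cosh t * (cosh (u - p) - 1) \<le> (cosh u * 3) * (cosh u * 3) * k^2"
      using cmp ct cd cosh_real_ge_1[of "u - p"] by (intro mult_mono) auto
    also have "\<dots> \<le> (5 * k^2) * (2 * (cosh u)^2)" by (simp add: power2_eq_square)
    finally show ?thesis by (subst pos_divide_le_eq) auto
  qed
  ultimately have b1: "\<bar>cosh q * cosh p * cosh t * ?X t\<bar> \<le> k * (5 * k^2)"
    using u pt lt by (simp only: abs_mult) (intro mult_mono, auto)
  have "sinh q * sinh p * sinh t * ?Y t = - (t - p) * (sinh q * (sinh t * (cosh (v - p) - 1) / (2 * (sinh v)^2)))"
  proof -
    have Y: "?Y t = (t - p) * (- (cosh (v - p) - 1) / (2 * sinh p * (sinh v)^2))" using v(3) by simp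
    have "sinh p \<noteq> 0" "sinh v \<noteq> 0" using sp sv by simp_all
    then show ?thesis unfolding Y by (simp add: field_simps)
  qed
  then have "\<bar>sinh q * sinh p * sinh t * ?Y t\<bar> = (t - p) * (\<bar>sinh q\<bar> * (sinh t * (cosh (v - p) - 1) / (2 * (sinh v)^2)))"
    using st lt cosh_real_ge_1[of "v - p"] by (simp add: abs_mult)
  also have "\<dots> \<le> k * (15 * k^2)"
  proof (rule mult_mono)
    have "\<bar>sinh q\<bar> * (sinh t * (cosh (v - p) - 1) / (2 * (sinh v)^2)) \<le> sinh t * (sinh t * (cosh (v - p) - 1) / (2 * (sinh v)^2))"
      using smp st cosh_real_ge_1[of "v - p"] by (intro mult_right_mono) auto
    also have "\<dots> = (sinh t * sinh ((v - p) / 2) / sinh v)^2"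
    proof -
      have "2 * ((v - p) / 2) = v - p" by simp
      then have "cosh (v - p) - 1 = 2 * (sinh ((v - p) / 2))^2"
        using cosh_double[of "(v - p) / 2"] cosh_square_eq[of "(v - p) / 2"] by (simp only:)
      then show ?thesis using sv by (simp add: power2_eq_square field_simps)
    qed
    also have "\<dots> \<le> (15/4 * k)^2"
    proof (rule power_mono)
      let ?d = "v - p" and ?r = "t - v"
      have dr: "0 \<le> ?d" "?d \<le> k" "0 \<le> ?r" "?r \<le> k" "?d \<le> v" using v pt p by linarith+
      have sd: "sinh (?d / 2) \<le> 3/2 * (?d / 2)" using dr k by (intro sinh_le) auto
      have sr: "sinh ?r \<le> 3/2 * ?r" using dr k by (intro sinh_le) auto
      have cr: "cosh ?r \<le> 2" using cosh_le[of ?r] dr k power_mono[of ?r 1 2] by auto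
      \<comment> \<open>This keeps the bound uniform as \<open>p \<rightarrow> 0\<close>, where \<open>cosh v / sinh v\<close> is unbounded: \<open>v - p \<le> v\<close>.\<close>
      have dc: "?d * cosh v \<le> 2 * sinh v"
      proof -
        have "?d * cosh v = ?d * sinh v + ?d * exp (- v)"
          using cosh_minus_sinh[of v] by (simp flip: distrib_left)
        also have "\<dots> \<le> 1 * sinh v + v * 1" using dr k sv p v by (intro add_mono mult_mono) auto
        also have "\<dots> \<le> 2 * sinh v" using le_sinh[of v] p v by simp
        finally show ?thesis .
      qed
      have "sinh t * sinh (?d / 2) = (sinh v * cosh ?r + cosh v * sinh ?r) * sinh (?d / 2)"
        using sinh_add[of v ?r] by simp
      also have "\<dots> \<le> (sinh v * 2 + cosh v * (3/2 * k)) * (3/4 * ?d)"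
        using sv sd sr cr dr by (intro mult_mono add_mono) auto
      also have "\<dots> = 3/2 * (sinh v * ?d) + 9/8 * (k * (?d * cosh v))" by (simp add: field_simps)
      also have "\<dots> \<le> 3/2 * (sinh v * k) + 9/8 * (k * (2 * sinh v))"
        using dc dr sv k0 by (intro add_mono mult_left_mono) auto
      also have "\<dots> = 15/4 * k * sinh v" by simp
      finally show "sinh t * sinh (?d / 2) / sinh v \<le> 15/4 * k" using sv by (simp add: field_simps)
      show "0 \<le> sinh t * sinh (?d / 2) / sinh v" using st sv dr by simp
    qed
    also have "\<dots> \<le> 15 * k^2" by (simp add: power_mult_distrib power2_eq_square)
    finally show "\<bar>sinh q\<bar> * (sinh t * (cosh (v - p) - 1) / (2 * (sinh v)^2)) \<le> 15 * k^2" .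
  qed (use pt k0 st cosh_real_ge_1[of "v - p"] in auto)
  finally have b2: "\<bar>sinh q * sinh p * sinh t * ?Y t\<bar> \<le> k * (15 * k^2)" .
  have "k * (5 * k^2) + k * (15 * k^2) + k^3 = 21 * k^3" by (simp add: power2_eq_square power3_eq_cube)
  then show ?thesis using b1 b2 e unfolding eq by linarith
qed

lemma chamber_swap: "chamber p t q = chamber p q t"
  and chamber_flip: "chamber p (- t) (- q) = chamber p t q"
proof -
  have "\<bar>- t - q\<bar> = \<bar>t + q\<bar>" by simp
  then show "chamber p (- t) (- q) = chamber p t q" by (simp add: chamber_def kink_def)
qed (simp add: chamber_def add.commute mult_ac)

lemma potential_flip23: "potential a (- b) (- c) = potential a b c"
  by (metis potential_flip12 potential_swap12 potential_swap23)

text \<open>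
  A point within distance \<open>k\<close> of the leading region may be evaluated with the formula of
  that region, at the price of a cubic error. This replaces any gluing of second derivatives across
  the walls.
\<close>

lemma potential_chamber_close:
  assumes p: "0 < p" and k: "0 \<le> k" "k \<le> 1" and "\<bar>t\<bar> \<le> p + k" "\<bar>q\<bar> \<le> p + k"
  shows "\<bar>potential p t q - chamber p t q\<bar> \<le> 21 * k^3"
proof -
  have 1: "\<bar>potential p t q - chamber p t q\<bar> \<le> 21 * k^3"
    if "\<bar>q\<bar> \<le> t" "p < t" "t \<le> p + k" for t q
  proof -
    have "potential p t q = chamber t p q"
      using potential_chamber[of p t q] that p by (simp add: potential_swap12[of p])
    then show ?thesis using chamber_diff_ordered[of p t k q] that p k by (simp add: abs_minus_commute)
  qed
  have outer: "\<bar>potential p t q - chamber p t q\<bar> \<le> 21 * k^3"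
    if "\<bar>q\<bar> \<le> \<bar>t\<bar>" "p < \<bar>t\<bar>" "\<bar>t\<bar> \<le> p + k" for t q
    using that 1[of q t] 1[of "- q" "- t"] unfolding potential_flip23 chamber_flip
    by (cases "0 \<le> t") auto
  consider "\<bar>t\<bar> \<le> p" "\<bar>q\<bar> \<le> p" | "\<bar>q\<bar> \<le> \<bar>t\<bar>" "p < \<bar>t\<bar>" | "\<bar>t\<bar> \<le> \<bar>q\<bar>" "p < \<bar>q\<bar>" by linarith
  then show ?thesis
  proof cases
    case 1
    then show ?thesis using k by (simp add: potential_chamber)
  next
    case 2
    then show ?thesis using outer[of q t] assms by blast
  next
    case 3
    then show ?thesis using outer[of t q] assms unfolding potential_swap23[of p t q] chamber_swap[of p t q] by simp
  qed
qed

text \<open>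
  The logarithmic singularity of \<open>artanh\<close> at the origin is absorbed by the product of the
  three \<open>sinh\<close>.
\<close>

lemma odd_term_bound:
  "\<bar>sinh a * sinh b * sinh c * artanh (exp (- maxabs a b c))\<bar> \<le> (sinh (maxabs a b c))^2 / 2"
proof (cases "maxabs a b c = 0")
  case True
  then have "a = 0" by (auto simp: maxabs_def max_def split: if_splits)
  then show ?thesis by simp
next
  case False
  let ?M = "maxabs a b c"
  have M: "0 < ?M" using False by (auto simp: maxabs_def max_def split: if_splits)
  have sle: "\<bar>sinh x\<bar> \<le> sinh ?M" if "\<bar>x\<bar> \<le> ?M" for x
    using that sinh_real_le_iff[of x ?M] sinh_real_le_iff[of "- x" ?M] by (auto simp: abs_le_iff)
  have le: "\<bar>a\<bar> \<le> ?M" "\<bar>b\<bar> \<le> ?M" "\<bar>c\<bar> \<le> ?M" by (auto simp: maxabs_def)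
  have lo: "lead_odd ?M \<le> 1/2" "0 \<le> lead_odd ?M" "0 < tanh ?M" "tanh ?M / 2 \<le> lead_odd ?M"
    using lead_bounds[OF M] by linarith+
  have sM: "0 < sinh ?M" using M by simp
  have at: "0 \<le> artanh (exp (- ?M))"
    using lo(2) sM by (simp add: lead_odd_def zero_le_mult_iff)
  have "\<bar>sinh a * sinh b * sinh c * artanh (exp (- ?M))\<bar>
    = \<bar>sinh a\<bar> * \<bar>sinh b\<bar> * (\<bar>sinh c\<bar> * artanh (exp (- ?M)))"
    using at by (simp add: abs_mult mult.assoc)
  also have "\<dots> \<le> sinh ?M * sinh ?M * (sinh ?M * artanh (exp (- ?M)))"
    using sle le at sM by (intro mult_mono) auto
  also have "\<dots> \<le> sinh ?M * sinh ?M * (1/2)"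
    using lo sM by (intro mult_left_mono) (auto simp: lead_odd_def)
  finally show ?thesis by (simp add: power2_eq_square)
qed

lemma potential_tendsto:
  assumes f: "(f \<longlongrightarrow> a) X" and g: "(g \<longlongrightarrow> b) X" and k: "(k \<longlongrightarrow> c) X"
  shows "((\<lambda>x. potential (f x) (g x) (k x)) \<longlongrightarrow> potential a b c) X"
proof -
  have m: "((\<lambda>x. maxabs (f x) (g x) (k x)) \<longlongrightarrow> maxabs a b c) X"
    unfolding maxabs_def by (intro tendsto_intros f g k tendsto_max)
  have l: "((\<lambda>x. evenmax (f x) (g x) (k x)) \<longlongrightarrow> evenmax a b c) X"
    unfolding evenmax_def by (intro tendsto_intros f g k tendsto_max)
  have o: "((\<lambda>x. sinh (f x) * sinh (g x) * sinh (k x) * artanh (exp (- maxabs (f x) (g x) (k x))))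
      \<longlongrightarrow> sinh a * sinh b * sinh c * artanh (exp (- maxabs a b c))) X"
  proof (cases "maxabs a b c = 0")
    case True
    then have "a = 0" by (auto simp: maxabs_def max_def split: if_splits)
    have "((\<lambda>x. (sinh (maxabs (f x) (g x) (k x)))^2 / 2) \<longlongrightarrow> (sinh (maxabs a b c))^2 / 2) X"
      by (intro tendsto_intros m) simp
    then have "((\<lambda>x. (sinh (maxabs (f x) (g x) (k x)))^2 / 2) \<longlongrightarrow> 0) X" using True by simp
    then have "((\<lambda>x. sinh (f x) * sinh (g x) * sinh (k x) * artanh (exp (- maxabs (f x) (g x) (k x)))) \<longlongrightarrow> 0) X"
      by (rule Lim_null_comparison[rotated]) (use odd_term_bound in auto)
    then show ?thesis using \<open>a = 0\<close> by simp
  next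
    case False
    then have "0 < maxabs a b c" by (auto simp: maxabs_def max_def split: if_splits)
    then have "exp (- maxabs a b c) < 1" "-1 < exp (- maxabs a b c)"
      using exp_gt_zero[of "- maxabs a b c"] by (simp, linarith)
    then show ?thesis by (intro tendsto_intros f g k m) auto
  qed
  show ?thesis
    unfolding potential_def excess_def by (intro tendsto_intros f g k m l o) auto
qed

lemma kink_bound:
  assumes "\<bar>y\<bar> \<le> 1"
  shows "\<bar>kink y\<bar> \<le> \<bar>y\<bar>^3 / 2"
proof -
  have "kink y \<le> 0" using le_sinh[of "\<bar>y\<bar>"] by (simp add: kink_def)
  moreover have "- kink y \<le> \<bar>y\<bar>^3 / 2" using sinh_cubic[of "\<bar>y\<bar>"] assms by (simp add: kink_def field_simps)
  ultimately show ?thesis by linarith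
qed

text \<open>
  For \<open>h \<le> \<bar>z\<bar>\<close> the expression vanishes, because \<open>sinh\<close> is an
  eigenfunction of the second difference; for smaller \<open>\<bar>z\<bar>\<close> every term is cubic
  in \<open>h\<close>.
\<close>

lemma kink_second_difference:
  assumes h: "0 < h" "h \<le> 1/2"
  shows "\<bar>kink (z + h) + kink (z - h) - 2 * kink z + (cosh h - 1) * sinh \<bar>z\<bar>\<bar> \<le> 11 * h^3"
proof -
  have 1: "\<bar>kink (z + h) + kink (z - h) - 2 * kink z + (cosh h - 1) * sinh \<bar>z\<bar>\<bar> \<le> 11 * h^3" if "0 \<le> z" for z
  proof (cases "h \<le> z")
    case True
    then have "kink (z + h) + kink (z - h) - 2 * kink z + (cosh h - 1) * sinh \<bar>z\<bar> = 0"
      using h by (simp add: kink_def sinh_add sinh_diff field_simps)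
    then show ?thesis using h by simp
  next
    case False
    have kb: "\<bar>kink y\<bar> \<le> 4 * h^3" if "\<bar>y\<bar> \<le> 2 * h" for y
    proof -
      have "\<bar>y\<bar>^3 \<le> (2 * h)^3" using that by (intro power_mono) auto
      then show ?thesis using kink_bound[of y] that h by (simp add: power_mult_distrib)
    qed
    have kz: "\<bar>kink z\<bar> \<le> h^3 / 2"
    proof -
      have "\<bar>z\<bar>^3 \<le> h^3" using False that by (intro power_mono) auto
      moreover have "\<bar>kink z\<bar> \<le> \<bar>z\<bar>^3 / 2" using that h False by (intro kink_bound) auto
      ultimately show ?thesis by linarith
    qed
    have "sinh \<bar>z\<bar> \<le> 3/2 * h" using sinh_le[of z] that False h by auto
    moreover have "cosh h - 1 \<le> h^2" using cosh_le[of h] h by simp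
    ultimately have "(cosh h - 1) * sinh \<bar>z\<bar> \<le> h^2 * (3/2 * h)"
      using cosh_real_ge_1[of h] that h by (intro mult_mono) auto
    moreover define S where "S = (cosh h - 1) * sinh \<bar>z\<bar>"
    moreover have "h^2 * (3/2 * h) = 3/2 * h^3" by (simp add: power2_eq_square power3_eq_cube)
    ultimately have "S \<le> 3/2 * h^3" by (simp only: S_def)
    moreover have "0 \<le> S" using cosh_real_ge_1[of h] by (simp add: S_def)
    moreover have "\<bar>kink (z + h)\<bar> \<le> 4 * h^3" "\<bar>kink (z - h)\<bar> \<le> 4 * h^3"
      using that False h by (auto intro!: kb)
    ultimately show ?thesis using kz unfolding S_def[symmetric] by linarith
  qed
  have sym: "kink (- y) = kink y" for y by (simp add: kink_def)
  show ?thesis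
  proof (cases "0 \<le> z")
    case False
    have "kink (- z + h) = kink (z - h)" "kink (- z - h) = kink (z + h)"
      using sym[of "z - h"] sym[of "z + h"] by simp_all
    then show ?thesis using 1[of "- z"] False sym[of z] by (simp add: add.commute)
  qed (use 1 in auto)
qed

section \<open>Second differences and second derivatives\<close>

text \<open>
  No calculus is needed here: \<open>cosh\<close> and \<open>sinh\<close> are eigenfunctions of the
  second difference operator with eigenvalue \<open>2 * (cosh h - 1)\<close>, which is
  \<open>h^2\<close> up to a cubic error.
\<close>

lemma potential_second_difference_leading:
  assumes p: "0 < p" and tq: "\<bar>t\<bar> \<le> p" "\<bar>q\<bar> \<le> p" and h: "0 < h" "h \<le> 1/2"
  shows "\<bar>potential p (t + h) q + potential p (t - h) q - 2 * potential p t q - h^2 * excess p t q\<bar> \<le> 54 * h^3"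
proof -
  have c: "\<bar>potential p (t + h) q - chamber p (t + h) q\<bar> \<le> 21 * h^3"
    "\<bar>potential p (t - h) q - chamber p (t - h) q\<bar> \<le> 21 * h^3"
    using p tq h by (auto intro!: potential_chamber_close)
  have e: "potential p t q = chamber p t q" using potential_chamber[OF tq] .
  define R where "R = kink (t + q + h) + kink (t + q - h) - 2 * kink (t + q) + (cosh h - 1) * sinh \<bar>t + q\<bar>"
  have R: "\<bar>R\<bar> \<le> 11 * h^3" unfolding R_def using h by (rule kink_second_difference)
  define E where "E = excess p t q"
  have E: "0 \<le> E" "E \<le> 1" using excess_bounds by (auto simp: E_def)
  have "chamber p (t + h) q + chamber p (t - h) q - 2 * chamber p t q = R + 2 * (cosh h - 1) * E"
    unfolding chamber_def R_def E_def excess_chamber[OF tq]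
    by (simp add: cosh_add cosh_diff sinh_add sinh_diff field_simps)
  moreover have "\<bar>2 * (cosh h - 1) * E - h^2 * E\<bar> \<le> h^3"
  proof -
    have "0 \<le> 2 * (cosh h - 1) - h^2" "2 * (cosh h - 1) - h^2 \<le> h^3"
      using cosh_quadratic[of h] h by auto
    then have "0 \<le> (2 * (cosh h - 1) - h^2) * E" using E by (intro mult_nonneg_nonneg)
    moreover have "(2 * (cosh h - 1) - h^2) * E \<le> h^3 * 1"
      by (rule mult_mono) (use \<open>2 * (cosh h - 1) - h^2 \<le> h^3\<close> E h in auto)
    ultimately show ?thesis by (simp add: left_diff_distrib)
  qed
  ultimately show ?thesis using c R unfolding e E_def[symmetric] by linarith
qed

text \<open>
  The equation along the comb axis in discrete form, with an error that is uniform in the state.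
\<close>

lemma potential_second_difference:
  assumes tq: "\<bar>t\<bar> \<le> \<bar>p\<bar>" "\<bar>q\<bar> \<le> \<bar>p\<bar>" and h: "0 < h" "h \<le> 1/2"
  shows "\<bar>potential p (t + h) q + potential p (t - h) q - 2 * potential p t q - h^2 * excess p t q\<bar> \<le> 54 * h^3"
proof -
  consider "0 < p" | "p < 0" | "p = 0" by linarith
  then show ?thesis
  proof cases
    case 1
    then show ?thesis using potential_second_difference_leading[of p t q h] assms by simp
  next
    case 2
    have "potential p (t + h) q = potential (- p) (- t - h) q" "potential p (t - h) q = potential (- p) (- t + h) q"
      "potential p t q = potential (- p) (- t) q" "excess p t q = excess (- p) (- t) q"
      using potential_flip12[of p] excess_flip12[of p] by (simp_all flip: potential_flip12[of p])
    then show ?thesis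
      using potential_second_difference_leading[of "- p" "- t" q h] assms 2 by (simp add: add.commute)
  next
    case 3
    then have z: "t = 0" "q = 0" using tq by auto
    \<comment> \<open>At the origin the estimate is the limit of those at \<open>(x, 0, 0)\<close> as \<open>x\<close> tends to \<open>0\<close> from above.\<close>
    let ?f = "\<lambda>x. \<bar>potential x h 0 + potential x (- h) 0 - 2 * potential x 0 0 - h^2 * (potential x 0 0 - evenmax x 0 0 / 2)\<bar>"
    have "(?f \<longlongrightarrow> ?f 0) (at_right 0)"
      unfolding evenmax_def by (intro tendsto_intros potential_tendsto tendsto_max) auto
    moreover have "\<forall>\<^sub>F x in at_right 0. ?f x \<le> 54 * h^3"
      using eventually_at_right_less
    proof eventually_elim
      case (elim x)
      then show ?case
        using potential_second_difference_leading[of x 0 0 h] h by (simp add: potential_def[of x 0 0])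
    qed
    ultimately have "?f 0 \<le> 54 * h^3" by (intro tendsto_upperbound) auto
    then show ?thesis by (simp add: 3 z potential_def[of 0 0 0])
  qed
qed

text \<open>
  L'Hopital's rule reduces the claim to the symmetric difference quotient of \<open>f'\<close> at
  \<open>0\<close>. Continuity of the second derivative is not required, only its existence at
  \<open>0\<close>.
\<close>

lemma second_difference_quotient_limit:
  fixes f f' :: "real \<Rightarrow> real"
  assumes d: "0 < d" "\<And>t. \<bar>t\<bar> < d \<Longrightarrow> (f has_real_derivative f' t) (at t)"
    and D: "(f' has_real_derivative D) (at 0)"
  shows "((\<lambda>h. (f h + f (- h) - 2 * f 0) / h^2) \<longlongrightarrow> D) (at_right 0)"
proof (rule lhopital_right_0[where f' = "\<lambda>h. f' h - f' (- h)" and g' = "\<lambda>h. 2 * h"])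
  have c: "isCont f 0" using d(2)[of 0] d(1) by (auto intro: DERIV_isCont)
  then have l: "(f \<longlongrightarrow> f 0) (at_right 0)" by (simp add: isCont_def filterlim_at_split)
  have m: "((\<lambda>h. f (- h)) \<longlongrightarrow> f 0) (at_right 0)"
    using c unfolding isCont_def filterlim_at_split by (simp add: filterlim_at_left_to_right)
  show "((\<lambda>h. f h + f (- h) - 2 * f 0) \<longlongrightarrow> 0) (at_right 0)"
    using tendsto_diff[OF tendsto_add[OF l m] tendsto_const[of "2 * f 0"]] by simp
  show "((\<lambda>h::real. h^2) \<longlongrightarrow> 0) (at_right 0)" by (rule tendsto_eq_intros | simp)+
  show "\<forall>\<^sub>F x::real in at_right 0. x^2 \<noteq> 0" "\<forall>\<^sub>F x::real in at_right 0. 2 * x \<noteq> 0"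
    using eventually_at_right_less[of "0::real"] by (auto elim!: eventually_mono)
  have near: "\<forall>\<^sub>F x in at_right 0. 0 < x \<and> x < d"
    using d(1) by (auto simp: eventually_at_right)
  then show "\<forall>\<^sub>F x in at_right 0. ((\<lambda>h. f h + f (- h) - 2 * f 0) has_real_derivative f' x - f' (- x)) (at x)"
  proof eventually_elim
    case (elim x)
    have "((\<lambda>h. f (- h)) has_real_derivative - f' (- x)) (at x)"
    proof -
      have "(f has_real_derivative f' (- x)) (at (- x))" using d(2)[of "- x"] elim by simp
      from DERIV_chain2[OF this DERIV_minus[OF DERIV_ident]] show ?thesis by simp
    qed
    then show ?case using d(2)[of x] elim by (auto intro!: derivative_eq_intros)
  qed
  show "\<forall>\<^sub>F x::real in at_right 0. ((\<lambda>h. h^2) has_real_derivative 2 * x) (at x)"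
    by (auto intro!: derivative_eq_intros always_eventually)
  have q: "((\<lambda>h. (f' h - f' 0) / h) \<longlongrightarrow> D) (at 0)"
    using D by (simp add: has_field_derivative_iff)
  have ql: "((\<lambda>h. (f' h - f' 0) / h) \<longlongrightarrow> D) (at_right 0)"
    and qm: "((\<lambda>h. (f' (- h) - f' 0) / (- h)) \<longlongrightarrow> D) (at_right 0)"
    using q unfolding filterlim_at_split by (simp_all add: filterlim_at_left_to_right)
  have mean: "((\<lambda>h. ((f' h - f' 0) / h + (f' (- h) - f' 0) / (- h)) / 2) \<longlongrightarrow> (D + D) / 2) (at_right 0)"
    by (intro tendsto_intros ql qm) auto
  have "\<forall>\<^sub>F h in at_right 0. ((f' h - f' 0) / h + (f' (- h) - f' 0) / (- h)) / 2 = (f' h - f' (- h)) / (2 * h)"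
    using near by eventually_elim (auto simp: field_simps)
  from Lim_transform_eventually[OF mean this]
  show "((\<lambda>h. (f' h - f' (- h)) / (2 * h)) \<longlongrightarrow> D) (at_right 0)" by simp
qed

definition kink' :: "real \<Rightarrow> real" where
  "kink' z = sgn z * (1 - cosh z) / 2"

lemma kink_deriv: "(kink has_real_derivative kink' z) (at z)"
proof -
  consider "0 < z" | "z < 0" | "z = 0" by linarith
  then show ?thesis
  proof cases
    case 1
    have "((\<lambda>z. (z - sinh z) / 2) has_real_derivative kink' z) (at z)"
      using 1 by (auto intro!: derivative_eq_intros simp: kink'_def)
    then show ?thesis
      by (rule has_field_derivative_transform_within_open[where S = "{0<..}"]) (use 1 in \<open>auto simp: kink_def\<close>)
  next
    case 2
    have "((\<lambda>z. (- z + sinh z) / 2) has_real_derivative kink' z) (at z)"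
      using 2 by (auto intro!: derivative_eq_intros simp: kink'_def)
    then show ?thesis
      by (rule has_field_derivative_transform_within_open[where S = "{..<0}"]) (use 2 in \<open>auto simp: kink_def\<close>)
  next
    case 3
    have "((\<lambda>h. (kink h - kink 0) / (h - 0)) \<longlongrightarrow> 0) (at 0)"
    proof (rule Lim_null_comparison)
      have "\<forall>\<^sub>F h::real in at 0. \<bar>h\<bar> < 1" by (auto simp: eventually_at intro!: exI[of _ 1])
      then show "\<forall>\<^sub>F h in at 0. norm ((kink h - kink 0) / (h - 0)) \<le> h^2 / 2"
      proof eventually_elim
        case (elim h)
        have "\<bar>kink h\<bar> \<le> h^2 / 2 * \<bar>h\<bar>" using kink_bound[of h] elim by (simp add: power3_eq_cube power2_eq_square abs_mult)
        moreover have "kink 0 = 0" by (simp add: kink_def)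
        ultimately show ?case by (cases "h = 0") (auto simp: abs_divide pos_divide_le_eq)
      qed
      show "((\<lambda>h::real. h^2 / 2) \<longlongrightarrow> 0) (at 0)" by (rule tendsto_eq_intros | simp)+
    qed
    then show ?thesis unfolding 3 by (simp add: has_field_derivative_iff kink'_def)
  qed
qed

lemma kink'_deriv: "(kink' has_real_derivative - sinh \<bar>z\<bar> / 2) (at z)"
proof -
  consider "0 < z" | "z < 0" | "z = 0" by linarith
  then show ?thesis
  proof cases
    case 1
    have "((\<lambda>z. (1 - cosh z) / 2) has_real_derivative - sinh \<bar>z\<bar> / 2) (at z)"
      using 1 by (auto intro!: derivative_eq_intros)
    then show ?thesis
      by (rule has_field_derivative_transform_within_open[where S = "{0<..}"]) (use 1 in \<open>auto simp: kink'_def\<close>)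
  next
    case 2
    have "((\<lambda>z. - (1 - cosh z) / 2) has_real_derivative - sinh \<bar>z\<bar> / 2) (at z)"
      using 2 by (auto intro!: derivative_eq_intros)
    then show ?thesis
      by (rule has_field_derivative_transform_within_open[where S = "{..<0}"]) (use 2 in \<open>auto simp: kink'_def\<close>)
  next
    case 3
    have "((\<lambda>h. (kink' h - kink' 0) / (h - 0)) \<longlongrightarrow> 0) (at 0)"
    proof (rule Lim_null_comparison)
      have "\<forall>\<^sub>F h::real in at 0. \<bar>h\<bar> < 1" by (auto simp: eventually_at intro!: exI[of _ 1])
      then show "\<forall>\<^sub>F h in at 0. norm ((kink' h - kink' 0) / (h - 0)) \<le> \<bar>h\<bar> / 2"
      proof eventually_elim
        case (elim h)
        have "cosh h - 1 \<le> \<bar>h\<bar> * \<bar>h\<bar>" using cosh_le[of h] elim by (simp add: power2_eq_square)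
        then have "\<bar>kink' h\<bar> \<le> \<bar>h\<bar> / 2 * \<bar>h\<bar>"
          using cosh_real_ge_1[of h] by (simp add: kink'_def abs_mult sgn_if)
        moreover have "kink' 0 = 0" by (simp add: kink'_def)
        ultimately show ?case by (cases "h = 0") (auto simp: abs_divide pos_divide_le_eq)
      qed
      show "((\<lambda>h::real. \<bar>h\<bar> / 2) \<longlongrightarrow> 0) (at 0)" by (rule tendsto_eq_intros | simp)+
    qed
    then show ?thesis unfolding 3 by (simp add: has_field_derivative_iff kink'_def)
  qed
qed

definition lead_even' :: "real \<Rightarrow> real" where
  "lead_even' p = sinh p * arctan (exp (- p)) - 1/2"

definition lead_odd' :: "real \<Rightarrow> real" where
  "lead_odd' p = cosh p * artanh (exp (- p)) - 1/2"

lemma lead_even_deriv: "(lead_even has_real_derivative lead_even' p) (at p)"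
proof -
  have "(cosh has_real_derivative sinh p) (at p)" by (auto intro!: derivative_eq_intros)
  from DERIV_mult[OF this arctan_exp_deriv] show ?thesis
    unfolding lead_even_def[abs_def] lead_even'_def by simp
qed

lemma lead_even'_deriv: "(lead_even' has_real_derivative lead_even p - tanh p / 2) (at p)"
proof -
  have "(sinh has_real_derivative cosh p) (at p)" by (auto intro!: derivative_eq_intros)
  from DERIV_diff[OF DERIV_mult[OF this arctan_exp_deriv] DERIV_const[of "1/2"]] show ?thesis
    unfolding lead_even_def lead_even'_def[abs_def] by (rule DERIV_cong) (simp add: tanh_def)
qed

lemma lead_odd_deriv:
  assumes "0 < p"
  shows "(lead_odd has_real_derivative lead_odd' p) (at p)"
proof -
  have "(sinh has_real_derivative cosh p) (at p)" by (auto intro!: derivative_eq_intros)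
  from DERIV_mult[OF this artanh_exp_deriv[OF assms]] assms show ?thesis
    unfolding lead_odd_def[abs_def] lead_odd'_def by simp
qed

lemma lead_odd'_deriv:
  assumes "0 < p"
  shows "(lead_odd' has_real_derivative lead_odd p - 1 / (2 * tanh p)) (at p)"
proof -
  have "(cosh has_real_derivative sinh p) (at p)" by (auto intro!: derivative_eq_intros)
  from DERIV_diff[OF DERIV_mult[OF this artanh_exp_deriv[OF assms]] DERIV_const[of "1/2"]] show ?thesis
    unfolding lead_odd_def lead_odd'_def[abs_def] by (rule DERIV_cong) (simp add: tanh_def)
qed

text \<open>
  The limit is the second directional derivative of the chamber formula along \<open>(a, b,
  c)\<close>. The zero multiples on the left keep the expression an instance of the general quotient
  at \<open>0\<close>.
\<close>

lemma chamber_line_second_derivative: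
  fixes p t q a b c :: real
  assumes p: "0 < p"
  defines "F \<equiv> lead_even p" and "G \<equiv> lead_odd p"
  shows "((\<lambda>h. (chamber (p + h*a) (t + h*b) (q + h*c) + chamber (p + (-h)*a) (t + (-h)*b) (q + (-h)*c)
      - 2 * chamber (p + 0*a) (t + 0*b) (q + 0*c)) / h^2) \<longlongrightarrow>
    a^2 * ((F - tanh p / 2) * (cosh t * cosh q) + (G - 1 / (2 * tanh p)) * (sinh t * sinh q))
    + (b^2 + c^2) * (F * (cosh t * cosh q) + G * (sinh t * sinh q))
    - (b + c)^2 * sinh \<bar>t + q\<bar> / 2
    + 2*a*b * (lead_even' p * (sinh t * cosh q) + lead_odd' p * (cosh t * sinh q))
    + 2*a*c * (lead_even' p * (cosh t * sinh q) + lead_odd' p * (sinh t * cosh q))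
    + 2*b*c * (F * (sinh t * sinh q) + G * (cosh t * cosh q))) (at_right 0)"
proof (rule second_difference_quotient_limit)
  define d where "d = p / (\<bar>a\<bar> + 1)"
  show "0 < d" using p by (simp add: d_def add_nonneg_pos)
  have lin: "((\<lambda>h. x + h * y) has_real_derivative y) (at h)" for x y h :: real
    by (auto intro!: derivative_eq_intros)
  have Fc: "((\<lambda>h. lead_even (p + h*a)) has_real_derivative lead_even' (p + h*a) * a) (at h)" for h
    using DERIV_chain2[OF lead_even_deriv lin] .
  have F'c: "((\<lambda>h. lead_even' (p + h*a)) has_real_derivative (F - tanh p / 2) * a) (at 0)"
  proof -
    have "((\<lambda>h. lead_even' (p + h*a)) has_real_derivative (lead_even (p + 0*a) - tanh (p + 0*a) / 2) * a) (at 0)"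
      by (rule DERIV_chain2[OF lead_even'_deriv lin])
    then show ?thesis by (simp add: F_def)
  qed
  have Gc: "((\<lambda>h. lead_odd (p + h*a)) has_real_derivative lead_odd' (p + h*a) * a) (at h)" if "0 < p + h*a" for h
    using DERIV_chain2[OF lead_odd_deriv lin] that .
  have G'c: "((\<lambda>h. lead_odd' (p + h*a)) has_real_derivative (G - 1 / (2 * tanh p)) * a) (at 0)"
  proof -
    have "((\<lambda>h. lead_odd' (p + h*a)) has_real_derivative (lead_odd (p + 0*a) - 1 / (2 * tanh (p + 0*a))) * a) (at 0)"
      by (rule DERIV_chain2[OF lead_odd'_deriv lin]) (use p in simp)
    then show ?thesis by (simp add: G_def)
  qed
  have kc: "((\<lambda>h. kink (t + h*b + (q + h*c))) has_real_derivative kink' (t + h*b + (q + h*c)) * (b + c)) (at h)" for h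
    by (rule DERIV_chain2[OF kink_deriv]) (auto intro!: derivative_eq_intros)
  have k'c: "((\<lambda>h. kink' (t + h*b + (q + h*c))) has_real_derivative - sinh \<bar>t + q\<bar> / 2 * (b + c)) (at 0)"
  proof -
    have "((\<lambda>h. kink' (t + h*b + (q + h*c))) has_real_derivative - sinh \<bar>t + 0*b + (q + 0*c)\<bar> / 2 * (b + c)) (at 0)"
      by (rule DERIV_chain2[OF kink'_deriv]) (auto intro!: derivative_eq_intros)
    then show ?thesis by simp
  qed
  have Gc0: "((\<lambda>h. lead_odd (p + h*a)) has_real_derivative lead_odd' (p + 0*a) * a) (at 0)"
    by (rule Gc) (use p in simp)
  have ct: "((\<lambda>h. cosh (t + h*b)) has_real_derivative sinh (t + h*b) * b) (at h)"
    and st: "((\<lambda>h. sinh (t + h*b)) has_real_derivative cosh (t + h*b) * b) (at h)"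
    and cq: "((\<lambda>h. cosh (q + h*c)) has_real_derivative sinh (q + h*c) * c) (at h)"
    and sq: "((\<lambda>h. sinh (q + h*c)) has_real_derivative cosh (q + h*c) * c) (at h)" for h
    by (auto intro!: derivative_eq_intros)
  let ?f' = "\<lambda>h. a / 2 + kink' (t + h*b + (q + h*c)) * (b + c)
    + (lead_even' (p + h*a) * a * (cosh (t + h*b) * cosh (q + h*c))
       + lead_even (p + h*a) * (b * (sinh (t + h*b) * cosh (q + h*c)) + c * (cosh (t + h*b) * sinh (q + h*c))))
    + (lead_odd' (p + h*a) * a * (sinh (t + h*b) * sinh (q + h*c))
       + lead_odd (p + h*a) * (b * (cosh (t + h*b) * sinh (q + h*c)) + c * (sinh (t + h*b) * cosh (q + h*c))))"
  show "((\<lambda>h. chamber (p + h*a) (t + h*b) (q + h*c)) has_real_derivative ?f' h) (at h)" if "\<bar>h\<bar> < d" for h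
  proof -
    have "\<bar>h\<bar> * (\<bar>a\<bar> + 1) < p" using that by (simp add: d_def pos_less_divide_eq add_nonneg_pos)
    moreover have "\<bar>h * a\<bar> \<le> \<bar>h\<bar> * (\<bar>a\<bar> + 1)" by (simp add: abs_mult algebra_simps)
    ultimately have pos: "0 < p + h*a" by linarith
    show ?thesis
      unfolding chamber_def
      by (rule DERIV_cong[OF DERIV_add[OF DERIV_add[OF DERIV_add[OF DERIV_cdivide[OF lin] kc]
            DERIV_mult[OF Fc DERIV_mult[OF ct cq]]] DERIV_mult[OF Gc[OF pos] DERIV_mult[OF st sq]]]])
         (simp add: algebra_simps)
  qed
  show "(?f' has_real_derivative
    a^2 * ((F - tanh p / 2) * (cosh t * cosh q) + (G - 1 / (2 * tanh p)) * (sinh t * sinh q))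
    + (b^2 + c^2) * (F * (cosh t * cosh q) + G * (sinh t * sinh q))
    - (b + c)^2 * sinh \<bar>t + q\<bar> / 2
    + 2*a*b * (lead_even' p * (sinh t * cosh q) + lead_odd' p * (cosh t * sinh q))
    + 2*a*c * (lead_even' p * (cosh t * sinh q) + lead_odd' p * (sinh t * cosh q))
    + 2*b*c * (F * (sinh t * sinh q) + G * (cosh t * cosh q))) (at 0)"
    by (rule DERIV_cong, (rule k'c F'c G'c Fc Gc0 ct cq st sq DERIV_add DERIV_mult DERIV_const)+)
       (simp add: F_def G_def power2_eq_square field_simps)
qed

section \<open>No step direction beats the comb direction\<close>

text \<open>
  The directions in which a choice of \<open>J\<close> moves the state: pairs of experts move along a
  coordinate axis, single experts and triples along a diagonal. Per coordinate a diagonal move is half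
  as long as an axis move. The weight \<open>\<kappa>\<close> compensates for this: bounding the
  second derivative along \<open>(a, b, c)\<close> by \<open>\<kappa>\<close> times the excess amounts
  to the same bound for every \<open>J\<close>.
\<close>

definition step_direction :: "real \<Rightarrow> real \<Rightarrow> real \<Rightarrow> real \<Rightarrow> bool" where
  "step_direction a b c \<kappa> \<longleftrightarrow>
     (\<bar>a\<bar> = 1 \<and> \<bar>b\<bar> = 1 \<and> \<bar>c\<bar> = 1 \<and> \<kappa> = 4) \<or>
     (((\<bar>a\<bar> = 1 \<and> b = 0 \<and> c = 0) \<or> (a = 0 \<and> \<bar>b\<bar> = 1 \<and> c = 0) \<or> (a = 0 \<and> b = 0 \<and> \<bar>c\<bar> = 1)) \<and> \<kappa> = 1)"

text \<open>
  The second derivative along every step direction is at most that along the comb axis. For diagonals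
  this is the bilinear inequality; for the leading axis the difference factors as \<open>(T - x) * (T
  - y)\<close>; along the two other axes there is equality.
\<close>

lemma sector_inequality:
  assumes p: "0 < p" and tq: "\<bar>q\<bar> \<le> t" "t \<le> p" and abc: "step_direction a b c \<kappa>"
  defines "F \<equiv> lead_even p" and "G \<equiv> lead_odd p"
  shows "a^2 * ((F - tanh p / 2) * (cosh t * cosh q) + (G - 1 / (2 * tanh p)) * (sinh t * sinh q))
    + (b^2 + c^2) * (F * (cosh t * cosh q) + G * (sinh t * sinh q))
    - (b + c)^2 * sinh \<bar>t + q\<bar> / 2
    + 2*a*b * (lead_even' p * (sinh t * cosh q) + lead_odd' p * (cosh t * sinh q))
    + 2*a*c * (lead_even' p * (cosh t * sinh q) + lead_odd' p * (sinh t * cosh q))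
    + 2*b*c * (F * (sinh t * sinh q) + G * (cosh t * cosh q)) \<le> \<kappa> * excess p t q" (is "?Q \<le> _")
proof -
  define T U C K x y where "T = tanh p" and "U = 1 / tanh p" and "C = cosh t" and "K = cosh q"
    and "x = tanh t" and "y = tanh q"
  have pos: "0 < C" "0 < K" by (simp_all add: C_def K_def)
  have st: "sinh t = C * x" and sq: "sinh q = K * y" by (simp_all add: C_def K_def x_def y_def tanh_def)
  have tq0: "0 \<le> t + q" "\<bar>t\<bar> \<le> p" "\<bar>q\<bar> \<le> p" using tq by linarith+
  have s2: "sinh \<bar>t + q\<bar> = C * K * (x + y)"
    using tq0(1) by (simp add: sinh_add st sq flip: C_def K_def) (simp add: algebra_simps)
  note lb = lead_bounds[OF p]
  have T: "0 < T" "T < 1" "T * U = 1" using lb by (auto simp: T_def U_def)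
  have le': "lead_even' p = F * T - 1/2" by (simp add: lead_even'_def F_def T_def lead_even_def tanh_def)
  have lo': "lead_odd' p = G * U - 1/2"
    using p by (simp add: lead_odd'_def G_def U_def lead_odd_def tanh_def)
  have ex: "excess p t q = F * (C * K) + G * (C * x * (K * y)) - C * K * (x + y) / 2"
    using excess_chamber[OF tq0(2,3)] unfolding s2 st sq by (simp add: F_def G_def C_def K_def)
  have xy: "\<bar>y\<bar> \<le> x" "x \<le> T"
    using tq by (auto simp: x_def y_def T_def abs_le_iff) (metis minus_le_iff tanh_minus tanh_real_le_iff)
  have Qe: "?Q = a^2 * ((F - T/2) * (C*K) + (G - U/2) * (C * x * (K * y)))
    + (b^2 + c^2) * (F * (C*K) + G * (C * x * (K * y)))
    - (b + c)^2 * (C * K * (x + y)) / 2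
    + 2*(a*b) * ((F*T - 1/2) * (C * x * K) + (G*U - 1/2) * (C * (K * y)))
    + 2*(a*c) * ((F*T - 1/2) * (C * (K * y)) + (G*U - 1/2) * (C * x * K))
    + 2*(b*c) * (F * (C * x * (K * y)) + G * (C * K))"
    unfolding s2 st sq le' lo' by (simp add: T_def U_def C_def K_def mult.assoc)
  consider (corner) "\<bar>a\<bar> = 1" "\<bar>b\<bar> = 1" "\<bar>c\<bar> = 1" "\<kappa> = 4" | (first) "\<bar>a\<bar> = 1" "b = 0" "c = 0" "\<kappa> = 1"
    | (second) "a = 0" "\<bar>b\<bar> = 1" "c = 0" "\<kappa> = 1" | (third) "a = 0" "b = 0" "\<bar>c\<bar> = 1" "\<kappa> = 1"
    using abc by (auto simp: step_direction_def)
  then show ?thesis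
  proof cases
    case corner
    define \<sigma> \<tau> where "\<sigma> = a*b" and "\<tau> = a*c"
    have sq1: "a^2 = 1" "b^2 = 1" "c^2 = 1" using corner by (simp_all add: abs_square_eq_1)
    have bc: "b*c = \<sigma>*\<tau>" using sq1(1) by (simp add: \<sigma>_def \<tau>_def power2_eq_square algebra_simps)
    have bpc: "(b + c)^2 = 2 + 2*(\<sigma>*\<tau>)" using sq1 bc by (simp add: power2_sum)
    have sg: "\<sigma> = 1 \<or> \<sigma> = -1" "\<tau> = 1 \<or> \<tau> = -1" using corner by (auto simp: \<sigma>_def \<tau>_def abs_if split: if_splits)
    have "0 \<le> F * (1 - 2*\<sigma>*T*x - 2*\<tau>*T*y - 2*\<sigma>*\<tau>*x*y)
           + G * (x*y - 2*\<sigma>*y*U - 2*\<tau>*x*U - 2*\<sigma>*\<tau>)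
           + (- (x + y) + T/2 + x*y*U/2 + (\<sigma> + \<tau> + \<sigma>*\<tau>) * (x + y))" (is "0 \<le> ?D")
      using sector_bilinear_nonneg[of T U F G y x \<sigma> \<tau>] lb corner_minus_nonneg[OF p] corner_plus_nonneg[OF p] corner_leader_nonneg[OF p] slope_dominates_curvature[OF p] curvature_nonneg[OF p] xy sg
      by (simp add: T_def U_def F_def G_def)
    then have "0 \<le> C * K * ?D" using pos by simp
    also have "C * K * ?D = \<kappa> * excess p t q - ?Q"
      unfolding Qe ex unfolding sq1 bc bpc \<sigma>_def[symmetric] \<tau>_def[symmetric] corner(4)
      by (simp add: field_simps)
    finally show ?thesis by simp
  next
    case first
    have sq1: "a^2 = 1" using first by (simp add: abs_square_eq_1)
    have "0 \<le> C * K * (U/2) * ((T - x) * (T - y))"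
      using pos T xy by (intro mult_nonneg_nonneg) (auto simp: U_def T_def)
    also have "\<dots> = C * K / 2 * (T * U * T - T * U * x - T * U * y + U * x * y)"
      by (simp add: algebra_simps add_divide_distrib diff_divide_distrib)
    also have "\<dots> = \<kappa> * excess p t q - ?Q"
      unfolding Qe ex unfolding sq1 first(2-4) T(3) by (simp add: field_simps)
    finally show ?thesis by simp
  next
    case second
    have sq1: "b^2 = 1" using second by (simp add: abs_square_eq_1)
    show ?thesis unfolding Qe ex by (simp add: second sq1)
  next
    case third
    have sq1: "c^2 = 1" using third by (simp add: abs_square_eq_1)
    show ?thesis unfolding Qe ex by (simp add: third sq1)
  qed
qed

lemma potential_axis:
  assumes "0 \<le> h" "\<bar>s\<bar> = h"
  shows "potential s 0 0 = h/2 + lead_even h" "potential 0 s 0 = h/2 + lead_even h" "potential 0 0 s = h/2 + lead_even h"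
proof -
  have c: "potential h 0 0 = h/2 + lead_even h"
    using potential_chamber[of 0 h 0] assms by (simp add: chamber_def kink_def)
  have "s = h \<or> s = - h" using assms by linarith
  then show 1: "potential s 0 0 = h/2 + lead_even h" using c potential_flip12[of h 0 0] by auto
  show 2: "potential 0 s 0 = h/2 + lead_even h" using 1 by (simp add: potential_swap12[of 0])
  show "potential 0 0 s = h/2 + lead_even h" using 2 by (simp add: potential_swap23[of 0 0])
qed

text \<open>
  A diagonal line through the origin meets one ray on which the three coordinates have positive
  product and one on which they have negative product.
\<close>

lemma potential_corner:
  assumes "0 < h" "\<bar>x\<bar> = h" "\<bar>y\<bar> = h" "\<bar>z\<bar> = h"
  shows "potential x y z + potential (- x) (- y) (- z) = chamber h h h + chamber h h (- h)"
proof -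
  have e: "potential h h h = chamber h h h" "potential h h (- h) = chamber h h (- h)"
    using assms by (auto intro!: potential_chamber)
  have e2: "potential h (- h) h = chamber h h (- h)" using e by (simp add: potential_swap23[of h "- h"])
  then have e3: "potential (- h) h h = chamber h h (- h)" by (simp add: potential_swap12[of "- h"])
  have f: "potential (- h) (- h) h = chamber h h h" "potential (- h) (- h) (- h) = chamber h h (- h)"
    using e by (simp_all add: potential_flip12)
  have f2: "potential (- h) h (- h) = chamber h h h" using f by (simp add: potential_swap23[of "- h" h])
  then have f3: "potential h (- h) (- h) = chamber h h h" by (simp add: potential_swap12[of h "- h"])
  have "x = h \<or> x = - h" "y = h \<or> y = - h" "z = h \<or> z = - h" using assms by linarith+
  then show ?thesis using e e2 e3 f f2 f3 by auto
qed

lemma excess_origin: "excess 0 0 0 = potential 0 0 0"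
  by (simp add: potential_def evenmax_def)

text \<open>
  The comb equation at the origin doubles as a Taylor estimate for the scalar function
  \<open>lead_even\<close> at \<open>0\<close>.
\<close>

lemma lead_even_near_0:
  assumes "0 < h" "h \<le> 1/2"
  shows "h/2 + lead_even h \<le> excess 0 0 0 + h^2 * excess 0 0 0 / 2 + 27 * h^3"
  using potential_second_difference[of 0 0 0 h] potential_axis(2)[of h h] potential_axis(2)[of h "- h"] assms
  by (simp add: excess_origin[symmetric] abs_le_iff)

text \<open>
  At the origin the chamber formula is not differentiable, so diagonal steps are estimated directly.
  The factor \<open>3\<close>, the squared length of a diagonal, is smaller than the admissible
  \<open>4\<close>.
\<close>

lemma corner_near_0:
  assumes h: "0 < h" "h \<le> 1/2"
  shows "chamber h h h + chamber h h (- h) - 2 * excess 0 0 0 \<le> 3 * (h^2 * excess 0 0 0) + 230 * h^3"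
proof -
  define E where "E = excess 0 0 0"
  have E: "0 \<le> E" "E \<le> 1" using excess_bounds by (auto simp: E_def)
  define c where "c = (cosh h)^2"
  have c1: "1 \<le> c" using cosh_real_ge_1[of h] by (simp add: c_def one_le_power)
  have ch: "cosh h \<le> 1 + h^2/2 + h^3/2" using cosh_quadratic(2)[of h] h by simp
  have h3: "0 < h^3" "0 < h^2" "h^2 \<le> 1/4" "h^4 \<le> h^3" "h^5 \<le> h^3" "h^6 \<le> h^3"
    using h power_decreasing[of 3 4 h] power_decreasing[of 3 5 h] power_decreasing[of 3 6 h]
      power_mono[of h "1/2" 2] by (auto simp: power2_eq_square)
  have "c \<le> (1 + h^2/2 + h^3/2)^2" unfolding c_def using ch by (intro power_mono) auto
  also have "\<dots> = 1 + h^2 + h^3 + h^4/4 + h^5/2 + h^6/4" by (simp add: field_simps eval_nat_numeral)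
  finally have c2: "c \<le> 1 + h^2 + 2 * h^3" using h3 by linarith
  have c3: "c \<le> 2" using c2 h3 h power_mono[of h "1/2" 3] by (simp add: power3_eq_cube)
  have "kink (2 * h) \<le> 0" using le_sinh[of "2 * h"] h by (simp add: kink_def)
  then have "chamber h h h + chamber h h (- h) \<le> h + 2 * lead_even h * c"
    by (simp add: chamber_def c_def power2_eq_square) (simp add: kink_def)
  moreover have "2 * lead_even h * c \<le> (2 * E - h + h^2 * E + 54 * h^3) * c"
    using lead_even_near_0[OF h] c1 by (intro mult_right_mono) (auto simp: E_def)
  moreover have "2 * E * c \<le> 2 * E * (1 + h^2 + 2 * h^3)" using c2 E by (intro mult_left_mono) auto
  moreover have "h * 1 \<le> h * c" using c1 h by (intro mult_left_mono) auto
  ultimately have 1: "chamber h h h + chamber h h (- h) \<le> 2*E + 2*(h^2*E) + 4*(E*h^3) + h^2*E*c + 54*h^3*c"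
    by (simp add: algebra_simps)
  have "h^2*E*c \<le> h^2*E*(1 + (h^2 + 2*h^3))" using c2 E by (intro mult_left_mono) auto
  also have "\<dots> = h^2*E + E*(h^4 + 2*h^5)" by (simp add: algebra_simps eval_nat_numeral)
  also have "E*(h^4 + 2*h^5) \<le> 1*(h^3 + 2*h^3)" using E h3 by (intro mult_mono) auto
  finally have 2: "h^2*E*c \<le> h^2*E + 3*h^3" by simp
  have 3: "54*h^3*c \<le> 54*h^3*2" using c3 h by (intro mult_left_mono) auto
  have 4: "E*h^3 \<le> 1*h^3" using E h by (intro mult_right_mono) auto
  show ?thesis
  proof -
    have "X - 2 * E \<le> 3 * m + 230 * n"
      if "X \<le> 2*E + 2*m + 4*k + v + w" "v \<le> m + 3*n" "w \<le> 54*n*2" "k \<le> 1*n" "0 < n" for X m k v w n :: real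
      using that by linarith
    from this[OF 1 2 3 4 h3(1)] show ?thesis by (simp add: E_def)
  qed
qed

lemma step_direction_abs: "step_direction a b c \<kappa> \<Longrightarrow> \<bar>a\<bar> \<le> 1 \<and> \<bar>b\<bar> \<le> 1 \<and> \<bar>c\<bar> \<le> 1"
  by (auto simp: step_direction_def)

text \<open>
  By symmetry the state may be taken in the fundamental domain. Away from the origin both displaced
  states have first coordinate within \<open>2 * h\<close> of being the largest in absolute value,
  whatever ties occur, so the chamber formula serves on both sides.
\<close>

lemma potential_second_difference_upper:
  assumes "step_direction a b c \<kappa>" "0 < \<epsilon>"
  shows "\<forall>\<^sub>F h in at_right 0. potential (x + h*a) (y + h*b) (z + h*c) + potential (x - h*a) (y - h*b) (z - h*c)
           - 2 * potential x y z \<le> h^2 * (\<kappa> * excess x y z + \<epsilon>)"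
  using assms
proof (induction x y z arbitrary: a b c rule: tetrahedral_wlog)
  case (1 x y z)
  have "step_direction b a c \<kappa>" using 1 by (auto simp: step_direction_def)
  from 1(1)[OF this] 1 show ?case
    by (simp add: potential_swap12[of y] potential_swap12[of "y + _"] potential_swap12[of "y - _"] excess_swap12[of y])
next
  case (2 x y z)
  have "step_direction a c b \<kappa>" using 2 by (auto simp: step_direction_def)
  from 2(1)[OF this] 2 show ?case
    by (simp add: potential_swap23[of _ z] potential_swap23[of _ "z + _"] potential_swap23[of _ "z - _"] excess_swap23[of _ z])
next
  case (3 x y z)
  have "step_direction (- a) (- b) c \<kappa>" using 3 by (auto simp: step_direction_def)
  from 3(1)[OF this] 3 show ?case
    using potential_flip12[of "x - _ * a" "y - _ * b"] potential_flip12[of "x + _ * a" "y + _ * b"]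
    by (simp add: potential_flip12[of x] excess_flip12[of x] add.commute)
next
  case (4 p t q)
  note abs = step_direction_abs[OF 4(3)]
  show ?case
  proof (cases "p = 0")
    case True
    then have z: "t = 0" "q = 0" using 4 by auto
    define E where "E = excess 0 0 0"
    have E: "0 \<le> E" using excess_bounds by (simp add: E_def)
    have ev: "\<forall>\<^sub>F h in at_right 0. 0 < h \<and> h < min (1/2) (\<epsilon> / 230)"
      using \<open>0 < \<epsilon>\<close> by (auto simp: eventually_at_right intro!: exI[of _ "min (1/2) (\<epsilon> / 230)"])
    then show ?thesis
    proof eventually_elim
      case (elim h)
      then have h: "0 < h" "h \<le> 1/2" "230 * h \<le> \<epsilon>" by (auto simp: field_simps)
      have h3: "230 * h^3 \<le> h^2 * \<epsilon>"
        using mult_left_mono[OF h(3), of "h^2"] by (simp add: power3_eq_cube power2_eq_square)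
      have "potential (h*a) (h*b) (h*c) + potential (- (h*a)) (- (h*b)) (- (h*c)) - 2 * E \<le> \<kappa> * (h^2 * E) + 230 * h^3"
      proof (cases "\<kappa> = 4")
        case True
        then have "\<bar>h*a\<bar> = h" "\<bar>h*b\<bar> = h" "\<bar>h*c\<bar> = h" using 4(3) h by (auto simp: step_direction_def abs_mult)
        then have "potential (h*a) (h*b) (h*c) + potential (- (h*a)) (- (h*b)) (- (h*c)) = chamber h h h + chamber h h (- h)"
          using h by (intro potential_corner) auto
        moreover have "0 \<le> h^2 * E" using E by simp
        ultimately show ?thesis using corner_near_0[OF h(1,2)] True unfolding E_def[symmetric] by simp
      next
        case False
        then have k: "\<kappa> = 1" using 4(3) by (auto simp: step_direction_def)
        have "potential (h*a) (h*b) (h*c) + potential (- (h*a)) (- (h*b)) (- (h*c)) = 2 * (h/2 + lead_even h)"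
          using 4(3) h False by (auto simp: step_direction_def potential_axis[OF less_imp_le[OF h(1)]] abs_mult)
        moreover have "0 < h^3" using h by simp
        moreover have "X - 2 * E \<le> 1 * m + 230 * n" if "X = 2 * u" "0 < n" "u \<le> E + m / 2 + 27 * n" for X m n u
          using that by linarith
        ultimately show ?thesis using lead_even_near_0[OF h(1,2)] unfolding E_def[symmetric] k by blast
      qed
      then show ?case using h3 by (simp add: True z excess_origin[symmetric] E_def[symmetric] algebra_simps)
    qed
  next
    case False
    then have p: "0 < p" using 4 by linarith
    define Q where "Q = \<kappa> * excess p t q"
    note lim = chamber_line_second_derivative[OF p, of a t b q c]
    have "\<forall>\<^sub>F h in at_right 0. (chamber (p + h*a) (t + h*b) (q + h*c) + chamber (p + (-h)*a) (t + (-h)*b) (q + (-h)*c)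
      - 2 * chamber (p + 0*a) (t + 0*b) (q + 0*c)) / h^2 < Q + \<epsilon> / 2"
      by (rule order_tendstoD(2)[OF lim])
         (use sector_inequality[OF p 4(1,2,3)] \<open>0 < \<epsilon>\<close> in \<open>simp add: Q_def\<close>)
    moreover have "\<forall>\<^sub>F h in at_right 0. 0 < h \<and> h < min (min (1/2) p) (\<epsilon> / 672)"
      using \<open>0 < \<epsilon>\<close> p by (auto simp: eventually_at_right intro!: exI[of _ "min (min (1/2) p) (\<epsilon> / 672)"])
    ultimately show ?thesis
    proof eventually_elim
      case (elim h)
      then have h: "0 < h" "h \<le> 1/2" "h < p" "672 * h \<le> \<epsilon>" by (auto simp: field_simps)
      have hb: "\<bar>h*a\<bar> \<le> h" "\<bar>h*b\<bar> \<le> h" "\<bar>h*c\<bar> \<le> h"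
        using abs h by (auto simp: abs_mult mult_left_le)
      have close1: "\<bar>potential (p + h*a) (t + h*b) (q + h*c) - chamber (p + h*a) (t + h*b) (q + h*c)\<bar> \<le> 21 * (2*h)^3"
        by (rule potential_chamber_close) (use hb h 4(1,2) in linarith)+
      have close2: "\<bar>potential (p - h*a) (t - h*b) (q - h*c) - chamber (p - h*a) (t - h*b) (q - h*c)\<bar> \<le> 21 * (2*h)^3"
        by (rule potential_chamber_close) (use hb h 4(1,2) in linarith)+
      have e: "potential p t q = chamber p t q" using 4(1,2) by (intro potential_chamber) linarith+
      have "0 < h^2" using h by simp
      then have "chamber (p + h*a) (t + h*b) (q + h*c) + chamber (p - h*a) (t - h*b) (q - h*c) - 2 * chamber p t q < (Q + \<epsilon> / 2) * h^2"
        using elim by (simp add: pos_divide_less_eq)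
      moreover have "2 * (21 * (2*h)^3) \<le> h^2 * \<epsilon> / 2"
        using mult_left_mono[OF h(4), of "h^2"] by (simp add: power3_eq_cube power2_eq_square)
      ultimately show ?case using close1 close2 unfolding e Q_def[symmetric] by (simp add: algebra_simps)
    qed
  qed
qed

section \<open>From experts to the tetrahedral coordinates\<close>

text \<open>
  The three ways to split the experts into two pairs. In these coordinates, shifts of all experts
  disappear and permutations of the experts act by permutations and even sign changes.
\<close>

definition pairing1 :: "real^4 \<Rightarrow> real" where "pairing1 x = x $ 4 + x $ 3 - x $ 2 - x $ 1"
definition pairing2 :: "real^4 \<Rightarrow> real" where "pairing2 x = x $ 4 + x $ 2 - x $ 3 - x $ 1"
definition pairing3 :: "real^4 \<Rightarrow> real" where "pairing3 x = x $ 4 + x $ 1 - x $ 3 - x $ 2"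

lemmas pairing_defs = pairing1_def pairing2_def pairing3_def

definition pair_potential :: "real^4 \<Rightarrow> real" where
  "pair_potential x = potential (pairing1 x / sqrt 2) (pairing2 x / sqrt 2) (pairing3 x / sqrt 2)"

definition pair_excess :: "real^4 \<Rightarrow> real" where
  "pair_excess x = excess (pairing1 x / sqrt 2) (pairing2 x / sqrt 2) (pairing3 x / sqrt 2)"

definition comb_limit :: "real^4 \<Rightarrow> real" where
  "comb_limit x = \<Phi> x + pair_excess x / sqrt 2"

definition mean4 :: "real^4 \<Rightarrow> real" where
  "mean4 x = (x $ 1 + x $ 2 + x $ 3 + x $ 4) / 4"

lemma \<Phi>_eq_max: "\<Phi> x = max (max (x $ 1) (x $ 2)) (max (x $ 3) (x $ 4))"
  unfolding \<Phi>_def UNIV_4 by (simp add: max.assoc)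

lemma evenmax_pairing: "evenmax (pairing1 x) (pairing2 x) (pairing3 x) = 4 * (\<Phi> x - mean4 x)"
proof -
  have "evenmax (pairing1 x) (pairing2 x) (pairing3 x) = 4 * \<Phi> x - (x $ 1 + x $ 2 + x $ 3 + x $ 4)"
    unfolding evenmax_def pairing_defs \<Phi>_eq_max by (auto simp: max_def)
  moreover have "4 * mean4 x = x $ 1 + x $ 2 + x $ 3 + x $ 4" by (simp add: mean4_def)
  ultimately show ?thesis by (simp only: right_diff_distrib)
qed

lemma evenmax_divide: "0 < r \<Longrightarrow> evenmax (a / r) (b / r) (c / r) = evenmax a b c / r"
  unfolding evenmax_def by (simp add: max_divide_distrib_right add_divide_distrib diff_divide_distrib)

lemma comb_limit_eq: "comb_limit x = mean4 x + pair_potential x / sqrt 2"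
proof -
  have "evenmax (pairing1 x / sqrt 2) (pairing2 x / sqrt 2) (pairing3 x / sqrt 2) = 4 * (\<Phi> x - mean4 x) / sqrt 2"
    by (simp add: evenmax_divide evenmax_pairing)
  then have "evenmax (pairing1 x / sqrt 2) (pairing2 x / sqrt 2) (pairing3 x / sqrt 2) / 2 / sqrt 2
      = 4 * (\<Phi> x - mean4 x) / sqrt 2 / 2 / sqrt 2" by (simp only:)
  also have "4 * d / sqrt 2 / 2 / sqrt 2 = d" for d :: real by (simp add: field_simps)
  finally show ?thesis
    unfolding comb_limit_def pair_potential_def potential_def pair_excess_def add_divide_distrib by simp
qed

lemma pair_excess_bounds: "0 \<le> pair_excess x" "pair_excess x \<le> 1"
  using excess_bounds by (auto simp: pair_excess_def)

lemma comb_limit_minus_\<Phi>: "0 \<le> comb_limit x - \<Phi> x" "comb_limit x - \<Phi> x \<le> 1"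
proof -
  show "0 \<le> comb_limit x - \<Phi> x" using pair_excess_bounds[of x] by (simp add: comb_limit_def)
  have "pair_excess x / sqrt 2 \<le> 1 / 1"
    using pair_excess_bounds[of x] by (intro frac_le) auto
  then show "comb_limit x - \<Phi> x \<le> 1" by (simp add: comb_limit_def)
qed

lemma abs_\<Phi>_le: "\<bar>\<Phi> x\<bar> \<le> norm x"
  using component_le_norm_cart[of x 1] component_le_norm_cart[of x 2]
    component_le_norm_cart[of x 3] component_le_norm_cart[of x 4]
  unfolding \<Phi>_eq_max by (auto simp: max_def abs_le_iff)

lemma linear_growth_comb_limit: "linear_growth comb_limit"
proof -
  have "\<bar>comb_limit x\<bar> \<le> 1 * (1 + norm x)" for x
    using comb_limit_minus_\<Phi>[of x] abs_le_D1[OF abs_\<Phi>_le[of x]] abs_le_D2[OF abs_\<Phi>_le[of x]]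
    unfolding abs_le_iff by simp
  then show ?thesis unfolding linear_growth_def by blast
qed

lemma continuous_comb_limit: "continuous_on UNIV comb_limit"
proof -
  have "(comb_limit \<longlongrightarrow> comb_limit x) (at x)" for x
    unfolding comb_limit_eq[abs_def] pair_potential_def mean4_def pairing_defs
    by (intro tendsto_intros potential_tendsto) auto
  then show ?thesis by (simp add: continuous_on_def)
qed

lemma pairing_line:
  "pairing1 (x + r *\<^sub>R e) = pairing1 x + r * pairing1 e"
  "pairing2 (x + r *\<^sub>R e) = pairing2 x + r * pairing2 e"
  "pairing3 (x + r *\<^sub>R e) = pairing3 x + r * pairing3 e"
  "mean4 (x + r *\<^sub>R e) = mean4 x + r * mean4 e"
  by (simp_all add: pairing_defs mean4_def algebra_simps add_divide_distrib)

lemma comb_limit_second_difference: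
  "comb_limit (x + r *\<^sub>R e) + comb_limit (x - r *\<^sub>R e) - 2 * comb_limit x
   = (pair_potential (x + r *\<^sub>R e) + pair_potential (x - r *\<^sub>R e) - 2 * pair_potential x) / sqrt 2"
  using pairing_line(4)[of x r e] pairing_line(4)[of x "- r" e]
  by (simp add: comb_limit_eq add_divide_distrib diff_divide_distrib)

lemma eJ_component: "eJ J $ i = of_bool (i \<in> J)"
  by (simp add: eJ_def axis_def if_distrib sum.delta)

text \<open>
  The empty and the full set do not move the state, the other fourteen sets move it along a step
  direction.
\<close>

lemma eJ_pairing_cases:
  obtains "pairing1 (eJ J) = 0" "pairing2 (eJ J) = 0" "pairing3 (eJ J) = 0"
  | a b c \<kappa> r where "step_direction a b c \<kappa>" "0 < r" "r^2 * \<kappa> = 4"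
      "pairing1 (eJ J) = r * a" "pairing2 (eJ J) = r * b" "pairing3 (eJ J) = r * c"
proof -
  let ?a = "pairing1 (eJ J)" and ?b = "pairing2 (eJ J)" and ?c = "pairing3 (eJ J)"
  have "(?a = 0 \<and> ?b = 0 \<and> ?c = 0) \<or> step_direction ?a ?b ?c 4 \<or> step_direction (?a/2) (?b/2) (?c/2) 1"
    unfolding pairing_defs eJ_component step_direction_def
    by (cases "(1::4) \<in> J"; cases "(2::4) \<in> J"; cases "(3::4) \<in> J"; cases "(4::4) \<in> J"; simp)
  then consider "?a = 0 \<and> ?b = 0 \<and> ?c = 0" | "step_direction ?a ?b ?c 4" | "step_direction (?a/2) (?b/2) (?c/2) 1" by blast
  then show ?thesis
  proof cases
    case 1 then show ?thesis using that(1) by blast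
  next
    case 2 then show ?thesis using that(2)[of ?a ?b ?c 4 1] by simp
  next
    case 3 then show ?thesis using that(2)[of "?a/2" "?b/2" "?c/2" 1 2] by simp
  qed
qed

lemma ranking_props:
  obtains i j k l where "ranking x = [i, j, k, l]" "distinct [i, j, k, l]"
    "x $ i \<le> x $ j" "x $ j \<le> x $ k" "x $ k \<le> x $ l"
proof -
  have len: "length (ranking x) = 4" by (simp add: ranking_def)
  then obtain i j k l where r: "ranking x = [i, j, k, l]"
    by (auto simp: numeral_eq_Suc length_Suc_conv)
  have "distinct (ranking x)" by (simp add: ranking_def)
  moreover have "sorted (map (\<lambda>i. x $ i) (ranking x))" by (simp add: ranking_def)
  ultimately show ?thesis using that r by auto
qed

lemma pairing_eJ:
  "pairing1 (eJ J) = of_bool (4 \<in> J) + of_bool (3 \<in> J) - of_bool (2 \<in> J) - of_bool (1 \<in> J)"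
  "pairing2 (eJ J) = of_bool (4 \<in> J) + of_bool (2 \<in> J) - of_bool (3 \<in> J) - of_bool (1 \<in> J)"
  "pairing3 (eJ J) = of_bool (4 \<in> J) + of_bool (1 \<in> J) - of_bool (3 \<in> J) - of_bool (2 \<in> J)"
  by (simp_all add: pairing_defs eJ_component)

text \<open>
  With the experts ordered as \<open>i, j, k, l\<close>, the comb set \<open>{l, j}\<close> belongs to
  the coordinate of middle absolute value: the coordinate of the split \<open>{l, k}\<close> is at
  least as large.
\<close>

lemma comb_axis:
  obtains
    "\<bar>pairing1 (eJ (comb x))\<bar> = 2" "pairing2 (eJ (comb x)) = 0" "pairing3 (eJ (comb x)) = 0"
    "\<bar>pairing1 x\<bar> \<le> max \<bar>pairing2 x\<bar> \<bar>pairing3 x\<bar>"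
  | "pairing1 (eJ (comb x)) = 0" "\<bar>pairing2 (eJ (comb x))\<bar> = 2" "pairing3 (eJ (comb x)) = 0"
    "\<bar>pairing2 x\<bar> \<le> max \<bar>pairing1 x\<bar> \<bar>pairing3 x\<bar>"
  | "pairing1 (eJ (comb x)) = 0" "pairing2 (eJ (comb x)) = 0" "\<bar>pairing3 (eJ (comb x))\<bar> = 2"
    "\<bar>pairing3 x\<bar> \<le> max \<bar>pairing1 x\<bar> \<bar>pairing2 x\<bar>"
proof -
  define S where "S = x $ 1 + x $ 2 + x $ 3 + x $ 4"
  define d where "d a b = \<bar>2 * (x $ a + x $ b) - S\<bar>" for a b :: 4
  have d: "d 4 3 = \<bar>pairing1 x\<bar>" "d 3 4 = \<bar>pairing1 x\<bar>" "d 1 2 = \<bar>pairing1 x\<bar>" "d 2 1 = \<bar>pairing1 x\<bar>"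
    "d 4 2 = \<bar>pairing2 x\<bar>" "d 2 4 = \<bar>pairing2 x\<bar>" "d 1 3 = \<bar>pairing2 x\<bar>" "d 3 1 = \<bar>pairing2 x\<bar>"
    "d 4 1 = \<bar>pairing3 x\<bar>" "d 1 4 = \<bar>pairing3 x\<bar>" "d 2 3 = \<bar>pairing3 x\<bar>" "d 3 2 = \<bar>pairing3 x\<bar>"
    unfolding d_def S_def pairing_defs by (simp_all add: abs_eq_iff)
  obtain i j k l where r: "ranking x = [i, j, k, l]" "distinct [i, j, k, l]"
    and o: "x $ i \<le> x $ j" "x $ j \<le> x $ k" "x $ k \<le> x $ l"
    by (rule ranking_props)
  have c: "comb x = {l, j}" by (simp add: comb_def r(1))
  have "card {i, j, k, l} = CARD(4)" using r(2) by simp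
  then have U: "{i, j, k, l} = UNIV" by (intro card_subset_eq) auto
  have "S = (\<Sum>m\<in>{i, j, k, l}. x $ m)" unfolding U by (simp add: S_def sum_4)
  then have "S = x $ i + x $ j + x $ k + x $ l" using r(2) by simp
  then have "\<bar>2 * (x $ l + x $ j) - S\<bar> \<le> 2 * (x $ l + x $ k) - S"
    using o unfolding abs_le_iff by auto
  also have "\<dots> \<le> d l k" by (simp add: d_def)
  finally have le: "d l j \<le> d l k" by (simp add: d_def)
  have "\<forall>l j::4. l \<noteq> j \<longrightarrow> (\<forall>k. k \<noteq> l \<longrightarrow> k \<noteq> j \<longrightarrow> d l j \<le> d l k \<longrightarrow>
    (\<bar>pairing1 (eJ {l, j})\<bar> = 2 \<and> pairing2 (eJ {l, j}) = 0 \<and> pairing3 (eJ {l, j}) = 0 \<and>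
      \<bar>pairing1 x\<bar> \<le> max \<bar>pairing2 x\<bar> \<bar>pairing3 x\<bar>) \<or>
    (pairing1 (eJ {l, j}) = 0 \<and> \<bar>pairing2 (eJ {l, j})\<bar> = 2 \<and> pairing3 (eJ {l, j}) = 0 \<and>
      \<bar>pairing2 x\<bar> \<le> max \<bar>pairing1 x\<bar> \<bar>pairing3 x\<bar>) \<or>
    (pairing1 (eJ {l, j}) = 0 \<and> pairing2 (eJ {l, j}) = 0 \<and> \<bar>pairing3 (eJ {l, j})\<bar> = 2 \<and>
      \<bar>pairing3 x\<bar> \<le> max \<bar>pairing1 x\<bar> \<bar>pairing2 x\<bar>))"
    by (simp add: forall_4 d pairing_eJ le_max_iff_disj)
  moreover have "l \<noteq> j" "k \<noteq> l" "k \<noteq> j" using r(2) by auto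
  ultimately show thesis using that le unfolding c by blast
qed

section \<open>The viscosity equation\<close>

lemma comb_limit_second_difference_upper:
  assumes "0 < \<epsilon>"
  shows "\<forall>\<^sub>F r in at_right 0. comb_limit (x + r *\<^sub>R eJ J) + comb_limit (x - r *\<^sub>R eJ J) - 2 * comb_limit x
           \<le> r^2 * (2 * (comb_limit x - \<Phi> x) + \<epsilon>)"
proof (cases rule: eJ_pairing_cases[of J])
  case 1
  have "pair_potential (x + r *\<^sub>R eJ J) = pair_potential x" "pair_potential (x - r *\<^sub>R eJ J) = pair_potential x" for r
    using pairing_line(1-3)[of x r "eJ J"] pairing_line(1-3)[of x "- r" "eJ J"] 1 by (simp_all add: pair_potential_def)
  then show ?thesis
    using assms comb_limit_minus_\<Phi>[of x] unfolding comb_limit_second_difference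
    by (intro always_eventually) simp
next
  case (2 a b c \<kappa> s)
  let ?k = "s / sqrt 2"
  have k: "0 < ?k" using 2 by simp
  have sk: "?k^2 * \<kappa> = 2" using 2(3) by (simp add: power_divide)
  have k2: "0 < \<kappa>" using 2(1) by (auto simp: step_direction_def)
  have e: "0 < sqrt 2 * \<epsilon> / ?k^2" using assms 2(2) by (intro divide_pos_pos mult_pos_pos zero_less_power) auto
  have fl: "filterlim (\<lambda>r. r * ?k) (at_right 0) (at_right 0)"
  proof -
    have "((\<lambda>r. r * ?k) \<longlongrightarrow> 0 * ?k) (at_right 0)" by (intro tendsto_intros)
    moreover have "\<forall>\<^sub>F r in at_right 0. r * ?k \<in> {0<..}"
      using eventually_at_right_less[of "0::real"] by (rule eventually_mono) (use 2(2) in simp)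
    ultimately show ?thesis by (auto simp: filterlim_at elim: eventually_mono)
  qed
  have "\<forall>\<^sub>F r in at_right 0. pair_potential (x + r *\<^sub>R eJ J) + pair_potential (x - r *\<^sub>R eJ J) - 2 * pair_potential x
      \<le> (r * ?k)^2 * (\<kappa> * pair_excess x + sqrt 2 * \<epsilon> / ?k^2)"
    using eventually_compose_filterlim[OF potential_second_difference_upper[OF 2(1) e,
        of "pairing1 x / sqrt 2" "pairing2 x / sqrt 2" "pairing3 x / sqrt 2"] fl]
  proof eventually_elim
    case (elim r)
    have "pair_potential (x + r *\<^sub>R eJ J) = potential (pairing1 x / sqrt 2 + r * ?k * a) (pairing2 x / sqrt 2 + r * ?k * b) (pairing3 x / sqrt 2 + r * ?k * c)"
      using pairing_line(1-3)[of x r "eJ J"] 2(4-6) by (simp add: pair_potential_def add_divide_distrib mult.assoc)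
    moreover have "pair_potential (x - r *\<^sub>R eJ J) = potential (pairing1 x / sqrt 2 - r * ?k * a) (pairing2 x / sqrt 2 - r * ?k * b) (pairing3 x / sqrt 2 - r * ?k * c)"
      using pairing_line(1-3)[of x "- r" "eJ J"] 2(4-6) by (simp add: pair_potential_def diff_divide_distrib mult.assoc)
    ultimately show ?case using elim
      by (simp add: pair_potential_def pair_excess_def)
  qed
  then show ?thesis
  proof eventually_elim
    case (elim r)
    have "(r * ?k)^2 * (\<kappa> * pair_excess x + sqrt 2 * \<epsilon> / ?k^2) = r^2 * ((?k^2 * \<kappa>) * pair_excess x + sqrt 2 * \<epsilon>)"
    proof -
      have "(r * K)^2 * (\<kappa> * X + Y / K^2) = r^2 * ((K^2 * \<kappa>) * X + Y)" if "K \<noteq> 0" for K X Y :: real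
        using that by (simp add: field_simps)
      from this[of ?k "pair_excess x" "sqrt 2 * \<epsilon>"] 2(2) show ?thesis by simp
    qed
    also have "\<dots> = r^2 * (2 * pair_excess x + sqrt 2 * \<epsilon>)" unfolding sk ..
    finally have "pair_potential (x + r *\<^sub>R eJ J) + pair_potential (x - r *\<^sub>R eJ J) - 2 * pair_potential x
      \<le> r^2 * (2 * pair_excess x + sqrt 2 * \<epsilon>)" using elim by simp
    then have "(pair_potential (x + r *\<^sub>R eJ J) + pair_potential (x - r *\<^sub>R eJ J) - 2 * pair_potential x) / sqrt 2
      \<le> r^2 * (2 * pair_excess x + sqrt 2 * \<epsilon>) / sqrt 2" by (intro divide_right_mono) auto
    also have "\<dots> = r^2 * (2 * (comb_limit x - \<Phi> x) + \<epsilon>)"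
      by (simp add: comb_limit_def add_divide_distrib distrib_left)
    finally show ?case unfolding comb_limit_second_difference .
  qed
qed

lemma potential_rotate: "potential c a b = potential a b c"
  and excess_rotate: "excess c a b = excess a b c"
  by (metis potential_swap12 potential_swap23, metis excess_swap12 excess_swap23)

text \<open>
  In the scaled coordinates a comb move of size \<open>sqrt \<delta>\<close> is an axis step of length
  \<open>h = sqrt (2 * \<delta>)\<close> along a coordinate that is dominated by another one, which is
  the situation of \<open>potential_second_difference\<close>.
\<close>

lemma comb_second_difference:
  fixes x :: "real^4"
  assumes \<delta>: "0 < \<delta>" "\<delta> \<le> 1/8"
  defines "e \<equiv> eJ (comb x)"
  shows "\<bar>comb_limit (x + sqrt \<delta> *\<^sub>R e) + comb_limit (x - sqrt \<delta> *\<^sub>R e) - 2 * comb_limit x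
    - 2 * \<delta> * (comb_limit x - \<Phi> x)\<bar> \<le> 108 * (\<delta> * sqrt \<delta>)"
proof -
  define h where "h = sqrt 2 * sqrt \<delta>"
  have h2: "h^2 = 2 * \<delta>" using \<delta> by (simp add: h_def power_mult_distrib)
  have h: "0 < h" "h \<le> 1/2"
  proof -
    show "0 < h" using \<delta> by (simp add: h_def)
    have "h^2 \<le> (1/2)^2" using \<delta> unfolding h2 by (simp add: power_divide)
    then show "h \<le> 1/2" by (rule power2_le_imp_le) simp
  qed
  let ?p = "pairing1 x / sqrt 2" and ?q = "pairing2 x / sqrt 2" and ?r = "pairing3 x / sqrt 2"
  have s: "sqrt \<delta> * v / sqrt 2 = h \<or> sqrt \<delta> * v / sqrt 2 = - h" if "\<bar>v\<bar> = 2" for v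
  proof -
    have "v = 2 \<or> v = - 2" using that by linarith
    moreover have "sqrt \<delta> * 2 / sqrt 2 = h" by (simp add: h_def real_div_sqrt field_simps)
    ultimately show ?thesis by auto
  qed
  have core: "\<bar>potential (u + k) v w + potential (u - k) v w - 2 * potential u v w - h^2 * excess u v w\<bar> \<le> 54 * h^3"
    if k: "k = h \<or> k = - h" and uvw: "\<bar>u\<bar> \<le> max \<bar>v\<bar> \<bar>w\<bar>" for u v w k
  proof -
    have "\<bar>potential (u + h) v w + potential (u - h) v w - 2 * potential u v w - h^2 * excess u v w\<bar> \<le> 54 * h^3"
    proof -
      have "(\<bar>u\<bar> \<le> \<bar>v\<bar> \<and> \<bar>w\<bar> \<le> \<bar>v\<bar>) \<or> (\<bar>u\<bar> \<le> \<bar>w\<bar> \<and> \<bar>v\<bar> \<le> \<bar>w\<bar>)"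
        using uvw by linarith
      then show ?thesis
      proof
      assume "\<bar>u\<bar> \<le> \<bar>v\<bar> \<and> \<bar>w\<bar> \<le> \<bar>v\<bar>"
      then show ?thesis
        using potential_second_difference[of u v w h] h
        unfolding potential_swap12[of v _ w] excess_swap12[of v u w] by blast
    next
      assume "\<bar>u\<bar> \<le> \<bar>w\<bar> \<and> \<bar>v\<bar> \<le> \<bar>w\<bar>"
      then show ?thesis
        using potential_second_difference[of u w v h] h
        unfolding potential_rotate[of w] excess_rotate[of w] by blast
      qed
    qed
    then show ?thesis using k by (auto simp: add.commute)
  qed
  have main: "\<bar>pair_potential (x + sqrt \<delta> *\<^sub>R e) + pair_potential (x - sqrt \<delta> *\<^sub>R e) - 2 * pair_potential x
     - h^2 * pair_excess x\<bar> \<le> 54 * h^3"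
  proof -
    have plus: "pair_potential (x + sqrt \<delta> *\<^sub>R e) = potential (?p + sqrt \<delta> * pairing1 e / sqrt 2)
        (?q + sqrt \<delta> * pairing2 e / sqrt 2) (?r + sqrt \<delta> * pairing3 e / sqrt 2)"
      using pairing_line(1-3)[of x "sqrt \<delta>" e] by (simp add: pair_potential_def add_divide_distrib)
    have minus: "pair_potential (x - sqrt \<delta> *\<^sub>R e) = potential (?p - sqrt \<delta> * pairing1 e / sqrt 2)
        (?q - sqrt \<delta> * pairing2 e / sqrt 2) (?r - sqrt \<delta> * pairing3 e / sqrt 2)"
      using pairing_line(1-3)[of x "- sqrt \<delta>" e] by (simp add: pair_potential_def diff_divide_distrib)
    have le: "\<bar>a / sqrt 2\<bar> \<le> max \<bar>b / sqrt 2\<bar> \<bar>c / sqrt 2\<bar> \<longleftrightarrow> \<bar>a\<bar> \<le> max \<bar>b\<bar> \<bar>c\<bar>" for a b c :: real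
      by (simp add: abs_divide divide_le_cancel le_max_iff_disj)
    show ?thesis
    proof (cases rule: comb_axis[of x])
      case 1
      show ?thesis
        using core[OF s[OF 1(1)], of ?p ?q ?r] 1
        unfolding plus minus unfolding e_def pair_potential_def[of x] pair_excess_def le by simp
    next
      case 2
      show ?thesis
        using core[OF s[OF 2(2)], of ?q ?p ?r] 2
        unfolding plus minus unfolding e_def pair_potential_def[of x] pair_excess_def le
          potential_swap12[of _ ?p ?r] excess_swap12[of _ ?p ?r] by simp
    next
      case 3
      show ?thesis
        using core[OF s[OF 3(3)], of ?r ?p ?q] 3
        unfolding plus minus unfolding e_def pair_potential_def[of x] pair_excess_def le
          potential_rotate[of _ ?p ?q] excess_rotate[of _ ?p ?q] by simp
    qed
  qed
  let ?S = "pair_potential (x + sqrt \<delta> *\<^sub>R e) + pair_potential (x - sqrt \<delta> *\<^sub>R e) - 2 * pair_potential x"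
  have "?S / sqrt 2 - 2 * \<delta> * (comb_limit x - \<Phi> x) = (?S - h^2 * pair_excess x) / sqrt 2"
    unfolding h2 by (simp add: comb_limit_def diff_divide_distrib)
  then have "\<bar>?S / sqrt 2 - 2 * \<delta> * (comb_limit x - \<Phi> x)\<bar> \<le> 54 * h^3 / sqrt 2"
    using main by (simp add: abs_divide divide_right_mono)
  also have "54 * h^3 / sqrt 2 = 108 * (\<delta> * sqrt \<delta>)"
  proof -
    have "h^3 = 2 * \<delta> * (sqrt 2 * sqrt \<delta>)" using h2 by (simp add: power3_eq_cube power2_eq_square h_def)
    then show ?thesis by simp
  qed
  finally show ?thesis unfolding comb_limit_second_difference .
qed

lemma test_function_second_difference:
  assumes "C2_with \<phi> g H"
  shows "((\<lambda>r. (\<phi> (x + r *\<^sub>R e) + \<phi> (x - r *\<^sub>R e) - 2 * \<phi> x) / r^2) \<longlongrightarrow> e \<bullet> (H x *v e)) (at_right 0)"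
proof -
  have line: "((\<lambda>r. x + r *\<^sub>R e) has_vector_derivative e) (at r)" for r
    by (auto intro!: derivative_eq_intros)
  have "((\<lambda>r. \<phi> (x + r *\<^sub>R e)) has_real_derivative g (x + r *\<^sub>R e) \<bullet> e) (at r)" for r
  proof -
    have "(\<phi> has_derivative (\<lambda>h. g (x + r *\<^sub>R e) \<bullet> h)) (at (x + r *\<^sub>R e))"
      using assms by (simp add: C2_with_def)
    from vector_derivative_diff_chain_within[OF line has_derivative_at_withinI[OF this]]
    show ?thesis by (simp add: o_def has_real_derivative_iff_has_vector_derivative)
  qed
  moreover have "((\<lambda>r. g (x + r *\<^sub>R e) \<bullet> e) has_real_derivative e \<bullet> (H x *v e)) (at 0)"
  proof -
    have "(g has_derivative (\<lambda>h. H x *v h)) (at (x + 0 *\<^sub>R e))"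
      using assms by (simp add: C2_with_def)
    from vector_derivative_diff_chain_within[OF line has_derivative_at_withinI[OF this]]
    have "((\<lambda>r. g (x + r *\<^sub>R e)) has_vector_derivative H x *v e) (at 0)" by (simp add: o_def)
    then have "((\<lambda>r. g (x + r *\<^sub>R e) \<bullet> e) has_vector_derivative (H x *v e) \<bullet> e) (at 0)"
      by (rule bounded_linear.has_vector_derivative[OF bounded_linear_inner_left])
    then show ?thesis by (simp add: has_real_derivative_iff_has_vector_derivative inner_commute)
  qed
  ultimately have "((\<lambda>r. (\<phi> (x + r *\<^sub>R e) + \<phi> (x + (- r) *\<^sub>R e) - 2 * \<phi> (x + 0 *\<^sub>R e)) / r^2) \<longlongrightarrow> e \<bullet> (H x *v e)) (at_right 0)"
    by (intro second_difference_quotient_limit[where d = 1]) auto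
  then show ?thesis by simp
qed

lemma eventually_line:
  fixes x e :: "real^4"
  assumes "\<forall>\<^sub>F y in nhds x. P y"
  shows "\<forall>\<^sub>F r in at_right 0. P (x + r *\<^sub>R e) \<and> P (x - r *\<^sub>R e)"
proof -
  have "((\<lambda>r. x + r *\<^sub>R e) \<longlongrightarrow> x + 0 *\<^sub>R e) (at_right 0)" "((\<lambda>r. x - r *\<^sub>R e) \<longlongrightarrow> x - 0 *\<^sub>R e) (at_right 0)"
    by (intro tendsto_intros)+
  then have "((\<lambda>r. x + r *\<^sub>R e) \<longlongrightarrow> x) (at_right 0)" "((\<lambda>r. x - r *\<^sub>R e) \<longlongrightarrow> x) (at_right 0)"
    by simp_all
  from this[THEN eventually_compose_filterlim[OF assms]] show ?thesis by (rule eventually_conj)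
qed

text \<open>
  The comb set itself attains the required curvature.
\<close>

lemma viscosity_subsolution_comb_limit: "viscosity_subsolution comb_limit"
  unfolding viscosity_subsolution_def
proof (intro allI impI)
  fix \<phi> g H x
  assume C2: "C2_with \<phi> g H" and max: "\<forall>\<^sub>F y in nhds x. comb_limit y - \<phi> y \<le> comb_limit x - \<phi> x"
  define e where "e = eJ (comb x)"
  let ?w = "\<lambda>r. comb_limit (x + r *\<^sub>R e) + comb_limit (x - r *\<^sub>R e) - 2 * comb_limit x"
  have "2 * (comb_limit x - \<Phi> x) \<le> e \<bullet> (H x *v e)"
  proof (rule tendsto_le)
    show "((\<lambda>r. (\<phi> (x + r *\<^sub>R e) + \<phi> (x - r *\<^sub>R e) - 2 * \<phi> x) / r^2) \<longlongrightarrow> e \<bullet> (H x *v e)) (at_right 0)"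
      by (rule test_function_second_difference[OF C2])
    have "((\<lambda>r. 2 * (comb_limit x - \<Phi> x) - 108 * r) \<longlongrightarrow> 2 * (comb_limit x - \<Phi> x) - 108 * 0) (at_right 0)"
      by (intro tendsto_intros)
    then show "((\<lambda>r. 2 * (comb_limit x - \<Phi> x) - 108 * r) \<longlongrightarrow> 2 * (comb_limit x - \<Phi> x)) (at_right 0)" by simp
    have "\<forall>\<^sub>F r::real in at_right 0. 0 < r \<and> r < 1/4"
      by (auto simp: eventually_at_right_field intro!: exI[of _ "1/4"])
    with eventually_line[OF max, of e]
    show "\<forall>\<^sub>F r in at_right 0. 2 * (comb_limit x - \<Phi> x) - 108 * r
        \<le> (\<phi> (x + r *\<^sub>R e) + \<phi> (x - r *\<^sub>R e) - 2 * \<phi> x) / r^2"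
    proof eventually_elim
      case (elim r)
      have r2: "0 < r^2" "r^2 \<le> 1/8" using elim power_mono[of r "1/4" 2] by (auto simp: power2_eq_square)
      have "\<bar>?w r - 2 * r^2 * (comb_limit x - \<Phi> x)\<bar> \<le> 108 * (r^2 * r)"
        using comb_second_difference[OF r2, of x] elim by (simp add: e_def)
      then have "(2 * (comb_limit x - \<Phi> x) - 108 * r) * r^2 \<le> \<phi> (x + r *\<^sub>R e) + \<phi> (x - r *\<^sub>R e) - 2 * \<phi> x"
        using elim by (simp add: abs_le_iff algebra_simps)
      then show ?case using r2 by (simp add: pos_le_divide_eq)
    qed
  qed simp
  also have "e \<bullet> (H x *v e) \<le> max_curvature (H x)"
    unfolding max_curvature_def e_def by (intro cSUP_upper) auto
  finally show "comb_limit x - 1/2 * max_curvature (H x) \<le> \<Phi> x" by simp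
qed

text \<open>
  A test function that touches from below has, along each \<open>eJ J\<close>, at most the second
  difference of the limit.
\<close>

lemma viscosity_supersolution_comb_limit: "viscosity_supersolution comb_limit"
  unfolding viscosity_supersolution_def
proof (intro allI impI)
  fix \<phi> g H x
  assume C2: "C2_with \<phi> g H" and min: "\<forall>\<^sub>F y in nhds x. comb_limit x - \<phi> x \<le> comb_limit y - \<phi> y"
  have "eJ J \<bullet> (H x *v eJ J) \<le> 2 * (comb_limit x - \<Phi> x)" for J
  proof (rule field_le_epsilon)
    fix \<epsilon> :: real assume \<epsilon>: "0 < \<epsilon>"
    let ?e = "eJ J"
    have "\<forall>\<^sub>F r in at_right 0. (\<phi> (x + r *\<^sub>R ?e) + \<phi> (x - r *\<^sub>R ?e) - 2 * \<phi> x) / r^2 \<le> 2 * (comb_limit x - \<Phi> x) + \<epsilon>"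
      using eventually_line[OF min, of ?e] comb_limit_second_difference_upper[OF \<epsilon>, of x J] eventually_at_right_less[of "0::real"]
    proof eventually_elim
      case (elim r)
      then have "\<phi> (x + r *\<^sub>R ?e) + \<phi> (x - r *\<^sub>R ?e) - 2 * \<phi> x \<le> (2 * (comb_limit x - \<Phi> x) + \<epsilon>) * r^2"
        by (simp add: mult.commute)
      then show ?case using elim by (simp add: pos_divide_le_eq)
    qed
    then show "?e \<bullet> (H x *v ?e) \<le> 2 * (comb_limit x - \<Phi> x) + \<epsilon>"
      by (rule tendsto_upperbound[OF test_function_second_difference[OF C2]]) simp
  qed
  then have "max_curvature (H x) \<le> 2 * (comb_limit x - \<Phi> x)"
    unfolding max_curvature_def by (intro cSUP_least) auto
  then show "\<Phi> x \<le> comb_limit x - 1/2 * max_curvature (H x)" by simp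
qed

section \<open>The game against the balanced comb\<close>

lemma finite_play: "finite (set_pmf (play \<alpha> \<beta> X0 t))"
  by (induction t) auto

lemma expectation_bind_finite:
  fixes f :: "'b \<Rightarrow> real"
  assumes "finite (set_pmf p)" "\<And>x. x \<in> set_pmf p \<Longrightarrow> finite (set_pmf (K x))"
  shows "measure_pmf.expectation (bind_pmf p K) f = measure_pmf.expectation p (\<lambda>x. measure_pmf.expectation (K x) f)"
  using pmf_expectation_bind[of "set_pmf p" K p f] assms
  by (simp add: integral_measure_pmf[of "set_pmf p" p])

lemma \<Phi>_shift: "\<Phi> (x + c *\<^sub>R 1) = \<Phi> x + c"
  unfolding \<Phi>_eq_max by (simp add: max_add_distrib_left)

lemma comb_limit_shift: "comb_limit (x + c *\<^sub>R 1) = comb_limit x + c"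
proof -
  have "pairing1 (1::real^4) = 0" "pairing2 (1::real^4) = 0" "pairing3 (1::real^4) = 0" by (simp_all add: pairing_defs)
  then show ?thesis
    using pairing_line(1-3)[of x c 1] unfolding comb_limit_def pair_excess_def \<Phi>_shift by simp
qed

lemma eJ_compl: "eJ (- J) = 1 - eJ J"
  by (simp add: vec_eq_iff eJ_component)

lemma state_update: "state (update g (I, J)) = state g + eJ J - of_bool (I \<in> J) *\<^sub>R 1"
  by (simp add: vec_eq_iff state_def update_def)

text \<open>
  Choosing \<open>J\<close> or its complement with equal probability, the player is in the chosen set
  exactly once out of the two cases, whatever \<open>I\<close> is. This is why the player has no
  influence against the balanced comb.
\<close>

lemma comb_round_average:
  fixes y :: "real^4" and s :: real
  shows "(comb_limit (y + s *\<^sub>R (eJ J - of_bool (I \<in> J) *\<^sub>R 1)) + comb_limit (y + s *\<^sub>R (eJ (- J) - of_bool (I \<in> - J) *\<^sub>R 1))) / 2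
    = (comb_limit (y + s *\<^sub>R eJ J) + comb_limit (y - s *\<^sub>R eJ J)) / 2"
proof -
  have "y + s *\<^sub>R (eJ J - of_bool (I \<in> J) *\<^sub>R 1) = (y + s *\<^sub>R eJ J) + (- s * of_bool (I \<in> J)) *\<^sub>R 1"
    by (simp add: algebra_simps)
  moreover have "y + s *\<^sub>R (eJ (- J) - of_bool (I \<in> - J) *\<^sub>R 1) = (y - s *\<^sub>R eJ J) + (s * (1 - of_bool (I \<in> - J))) *\<^sub>R 1"
    by (simp add: eJ_compl algebra_simps)
  ultimately show ?thesis by (simp only: comb_limit_shift) (simp add: of_bool_def)
qed

definition scaled_state :: "real \<Rightarrow> history \<Rightarrow> real^4" where
  "scaled_state \<delta> h = sqrt \<delta> *\<^sub>R state (hd h)"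

lemma play_comb_step:
  "measure_pmf.expectation (play \<alpha> (balanced_comb \<delta>) X0 (Suc t)) (\<lambda>h. comb_limit (scaled_state \<delta> h))
   = measure_pmf.expectation (play \<alpha> (balanced_comb \<delta>) X0 t)
      (\<lambda>h. (comb_limit (scaled_state \<delta> h + sqrt \<delta> *\<^sub>R eJ (comb (scaled_state \<delta> h)))
         + comb_limit (scaled_state \<delta> h - sqrt \<delta> *\<^sub>R eJ (comb (scaled_state \<delta> h)))) / 2)"
proof -
  have round: "measure_pmf.expectation (map_pmf (\<lambda>IJ. update (hd h) IJ # h) (pair_pmf (\<alpha> h) (balanced_comb \<delta> h))) (\<lambda>h. comb_limit (scaled_state \<delta> h))
    = (comb_limit (scaled_state \<delta> h + sqrt \<delta> *\<^sub>R eJ (comb (scaled_state \<delta> h)))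
         + comb_limit (scaled_state \<delta> h - sqrt \<delta> *\<^sub>R eJ (comb (scaled_state \<delta> h)))) / 2" for h
  proof -
    let ?y = "scaled_state \<delta> h" and ?s = "sqrt \<delta>"
    let ?F = "\<lambda>I J. comb_limit (?y + ?s *\<^sub>R (eJ J - of_bool (I \<in> J) *\<^sub>R 1))"
    have F: "comb_limit (scaled_state \<delta> (update (hd h) (I, J) # h)) = ?F I J" for I J
      by (simp add: scaled_state_def state_update algebra_simps)
    have "measure_pmf.expectation (map_pmf (\<lambda>IJ. update (hd h) IJ # h) (pair_pmf (\<alpha> h) (balanced_comb \<delta> h))) (\<lambda>h. comb_limit (scaled_state \<delta> h))
      = measure_pmf.expectation (\<alpha> h) (\<lambda>I. measure_pmf.expectation (balanced_comb \<delta> h) (\<lambda>J. ?F I J))"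
      by (simp add: pair_pmf_def expectation_bind_finite F)
    also have "\<dots> = measure_pmf.expectation (\<alpha> h) (\<lambda>I. (?F I (comb ?y) + ?F I (- comb ?y)) / 2)"
      by (simp add: balanced_comb_def Let_def scaled_state_def[symmetric] integral_bernoulli_pmf add_divide_distrib)
    also have "\<dots> = measure_pmf.expectation (\<alpha> h) (\<lambda>I. (comb_limit (?y + ?s *\<^sub>R eJ (comb ?y)) + comb_limit (?y - ?s *\<^sub>R eJ (comb ?y))) / 2)"
      unfolding comb_round_average ..
    finally show ?thesis by simp
  qed
  have "measure_pmf.expectation (play \<alpha> (balanced_comb \<delta>) X0 (Suc t)) (\<lambda>h. comb_limit (scaled_state \<delta> h))
    = measure_pmf.expectation (play \<alpha> (balanced_comb \<delta>) X0 t)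
        (\<lambda>h. measure_pmf.expectation (map_pmf (\<lambda>IJ. update (hd h) IJ # h) (pair_pmf (\<alpha> h) (balanced_comb \<delta> h)))
          (\<lambda>h. comb_limit (scaled_state \<delta> h)))"
    unfolding play.simps by (rule expectation_bind_finite) (auto simp: finite_play)
  then show ?thesis by (simp only: round)
qed

lemma abs_expectation_le:
  fixes f :: "'a \<Rightarrow> real"
  assumes fin: "finite (set_pmf p)" and le: "\<And>x. x \<in> set_pmf p \<Longrightarrow> \<bar>f x\<bar> \<le> c"
  shows "\<bar>measure_pmf.expectation p f\<bar> \<le> c"
proof -
  have i: "integrable p f" using fin by (rule integrable_measure_pmf_finite)
  have "f x \<le> c" "- c \<le> f x" if "x \<in> set_pmf p" for x using le[OF that] by linarith+
  then have "measure_pmf.expectation p f \<le> c" "- c \<le> measure_pmf.expectation p f"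
    by (auto intro!: measure_pmf.integral_le_const measure_pmf.integral_ge_const i AE_pmfI)
  then show ?thesis by linarith
qed

text \<open>
  The limit function nearly satisfies the dynamic programming equation of the game in which nature
  plays the balanced comb.
\<close>

lemma comb_one_step:
  assumes \<delta>: "0 < \<delta>" "\<delta> \<le> 1/8"
  shows "\<bar>comb_limit y - (1 - \<delta>) * ((comb_limit (y + sqrt \<delta> *\<^sub>R eJ (comb y)) + comb_limit (y - sqrt \<delta> *\<^sub>R eJ (comb y))) / 2)
    - \<delta> * \<Phi> y\<bar> \<le> 55 * (\<delta> * sqrt \<delta>)"
proof -
  define D where "D = comb_limit y - \<Phi> y"
  define r where "r = (comb_limit (y + sqrt \<delta> *\<^sub>R eJ (comb y)) + comb_limit (y - sqrt \<delta> *\<^sub>R eJ (comb y))) / 2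
    - comb_limit y - \<delta> * D"
  have r: "\<bar>r\<bar> \<le> 54 * (\<delta> * sqrt \<delta>)"
  proof -
    have "2 * r = comb_limit (y + sqrt \<delta> *\<^sub>R eJ (comb y)) + comb_limit (y - sqrt \<delta> *\<^sub>R eJ (comb y)) - 2 * comb_limit y
      - 2 * \<delta> * (comb_limit y - \<Phi> y)"
      unfolding r_def D_def by (simp add: field_simps)
    then have "\<bar>2 * r\<bar> \<le> 108 * (\<delta> * sqrt \<delta>)" using comb_second_difference[OF \<delta>, of y] by (simp only:)
    then show ?thesis by (simp add: abs_mult)
  qed
  have D: "0 \<le> D" "D \<le> 1" using comb_limit_minus_\<Phi> by (auto simp: D_def)
  have "comb_limit y - (1 - \<delta>) * ((comb_limit (y + sqrt \<delta> *\<^sub>R eJ (comb y)) + comb_limit (y - sqrt \<delta> *\<^sub>R eJ (comb y))) / 2)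
    - \<delta> * \<Phi> y = \<delta> * \<delta> * D - (1 - \<delta>) * r"
    unfolding r_def D_def by (simp add: field_simps)
  moreover have "\<bar>(1 - \<delta>) * r\<bar> \<le> 1 * (54 * (\<delta> * sqrt \<delta>))"
    unfolding abs_mult using r \<delta> by (intro mult_mono) auto
  moreover have "\<delta> \<le> sqrt \<delta>" using \<delta> by (intro real_le_rsqrt) (simp add: power2_eq_square mult_left_le)
  then have "\<delta> * \<delta> * D \<le> \<delta> * sqrt \<delta> * 1" using D \<delta> by (intro mult_mono) auto
  moreover have "0 \<le> \<delta> * \<delta> * D" using D \<delta> by simp
  ultimately show ?thesis by linarith
qed

lemma norm_state_le: "h \<in> set_pmf (play \<alpha> \<beta> X0 t) \<Longrightarrow> norm (state (hd h)) \<le> norm X0 + 4 * real t"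
proof (induction t arbitrary: h)
  case 0
  have "state (X0, 0) = X0" by (simp add: state_def vec_eq_iff)
  then show ?case using 0 by simp
next
  case (Suc t)
  then obtain h' I J where h': "h' \<in> set_pmf (play \<alpha> \<beta> X0 t)" and h: "h = update (hd h') (I, J) # h'"
    by auto
  have "norm (eJ J - of_bool (I \<in> J) *\<^sub>R 1) \<le> (\<Sum>i\<in>UNIV. \<bar>(eJ J - of_bool (I \<in> J) *\<^sub>R 1) $ i\<bar>)"
    by (rule norm_le_l1_cart)
  also have "\<dots> \<le> (\<Sum>i\<in>(UNIV :: 4 set). 1)"
    by (intro sum_mono) (simp add: eJ_component of_bool_def)
  finally have "norm (eJ J - of_bool (I \<in> J) *\<^sub>R 1) \<le> 4" by simp
  moreover have "norm (state (hd h)) \<le> norm (state (hd h')) + norm (eJ J - of_bool (I \<in> J) *\<^sub>R 1)"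
    using norm_triangle_ineq[of "state (hd h')" "eJ J - of_bool (I \<in> J) *\<^sub>R 1"]
    by (simp add: h state_update add_diff_eq)
  ultimately show ?case using Suc.IH[OF h'] by simp
qed

text \<open>
  The regret is unbounded over all maturities, so the expectation over a random time is computed
  through integrals of nonnegative functions, where sums and integrals may be exchanged without
  integrability conditions.
\<close>

lemma expectation_bind_nat_sums_nonneg:
  fixes f :: "'a \<Rightarrow> real" and p :: "nat pmf"
  assumes fin: "\<And>t. finite (set_pmf (K t))" and pos: "\<And>h. 0 \<le> f h"
    and bnd: "\<And>t h. h \<in> set_pmf (K t) \<Longrightarrow> f h \<le> B t" and sm: "summable (\<lambda>t. pmf p t * B t)"
  shows "(\<lambda>t. pmf p t * measure_pmf.expectation (K t) f) sums measure_pmf.expectation (bind_pmf p K) f"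
    and "integrable (bind_pmf p K) f"
proof -
  have i: "integrable (K t) f" for t using fin by (rule integrable_measure_pmf_finite)
  have E0: "0 \<le> measure_pmf.expectation (K t) f" for t using pos by simp
  have EB: "measure_pmf.expectation (K t) f \<le> B t" for t
    using i bnd by (intro measure_pmf.integral_le_const) (auto simp: AE_measure_pmf_iff)
  have s: "summable (\<lambda>t. pmf p t * measure_pmf.expectation (K t) f)"
    by (rule summable_comparison_test'[OF sm, of 0]) (simp add: E0 EB mult_left_mono)
  have "(\<integral>\<^sup>+h. ennreal (f h) \<partial>bind_pmf p K) = (\<integral>\<^sup>+t. ennreal (measure_pmf.expectation (K t) f) \<partial>p)"
    using i pos by (simp add: nn_integral_eq_integral)
  also have "\<dots> = (\<Sum>t. ennreal (pmf p t * measure_pmf.expectation (K t) f))"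
    by (simp add: nn_integral_measure_pmf nn_integral_count_space_nat ennreal_mult' E0)
  also have "\<dots> = ennreal (\<Sum>t. pmf p t * measure_pmf.expectation (K t) f)"
    using s E0 by (intro suminf_ennreal2) auto
  finally have nn: "(\<integral>\<^sup>+h. ennreal (f h) \<partial>bind_pmf p K) = ennreal (\<Sum>t. pmf p t * measure_pmf.expectation (K t) f)" .
  have S0: "0 \<le> (\<Sum>t. pmf p t * measure_pmf.expectation (K t) f)" using s E0 by (intro suminf_nonneg) auto
  have "measure_pmf.expectation (bind_pmf p K) f = (\<Sum>t. pmf p t * measure_pmf.expectation (K t) f)"
    using S0 pos by (subst integral_eq_nn_integral) (simp_all only: nn, simp_all)
  then show "(\<lambda>t. pmf p t * measure_pmf.expectation (K t) f) sums measure_pmf.expectation (bind_pmf p K) f"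
    using s by (simp add: sums_iff)
  show "integrable (bind_pmf p K) f"
    by (rule integrableI_nonneg) (simp_all only: nn, simp_all add: pos)
qed

lemma expectation_bind_nat_sums:
  fixes f :: "'a \<Rightarrow> real" and p :: "nat pmf"
  assumes fin: "\<And>t. finite (set_pmf (K t))"
    and bnd: "\<And>t h. h \<in> set_pmf (K t) \<Longrightarrow> \<bar>f h\<bar> \<le> B t" and sm: "summable (\<lambda>t. pmf p t * B t)"
  shows "(\<lambda>t. pmf p t * measure_pmf.expectation (K t) f) sums measure_pmf.expectation (bind_pmf p K) f"
proof -
  let ?P = "\<lambda>h. max 0 (f h)" and ?N = "\<lambda>h. max 0 (- f h)"
  have f: "f = (\<lambda>h. ?P h - ?N h)" by auto
  have mx: "?P h \<le> B t" "?N h \<le> B t" if "h \<in> set_pmf (K t)" for h t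
    using bnd[OF that] by linarith+
  have P: "(\<lambda>t. pmf p t * measure_pmf.expectation (K t) ?P) sums measure_pmf.expectation (bind_pmf p K) ?P" "integrable (bind_pmf p K) ?P"
    by (rule expectation_bind_nat_sums_nonneg[OF fin _ _ sm]; use mx in simp)+
  have N: "(\<lambda>t. pmf p t * measure_pmf.expectation (K t) ?N) sums measure_pmf.expectation (bind_pmf p K) ?N" "integrable (bind_pmf p K) ?N"
    by (rule expectation_bind_nat_sums_nonneg[OF fin _ _ sm]; use mx in simp)+
  have K: "measure_pmf.expectation (K t) f = measure_pmf.expectation (K t) ?P - measure_pmf.expectation (K t) ?N" for t
    by (subst f, rule Bochner_Integration.integral_diff) (intro integrable_measure_pmf_finite fin)+
  have "measure_pmf.expectation (bind_pmf p K) f = measure_pmf.expectation (bind_pmf p K) ?P - measure_pmf.expectation (bind_pmf p K) ?N"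
    by (subst f, rule Bochner_Integration.integral_diff) (rule P N)+
  then show ?thesis using sums_diff[OF P(1) N(1)] by (simp add: K right_diff_distrib)
qed

lemma expected_regret_sums:
  assumes \<delta>: "0 < \<delta>" "\<delta> < 1"
  shows "(\<lambda>t. (1 - \<delta>)^t * \<delta> * measure_pmf.expectation (play \<alpha> \<beta> X0 t) (\<lambda>h. \<Phi> (state (hd h))))
    sums expected_regret \<delta> \<alpha> \<beta> X0"
proof -
  have "summable (\<lambda>t. (1 - \<delta>)^t * real t)"
    using geometric_sums_times_n[of "1 - \<delta>"] \<delta> by (auto simp: sums_iff)
  moreover have "summable (\<lambda>t. (1 - \<delta>)^t)" using \<delta> by (intro summable_geometric) auto
  ultimately have "summable (\<lambda>t. \<delta> * norm X0 * (1 - \<delta>)^t + 4 * \<delta> * ((1 - \<delta>)^t * real t))"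
    by (intro summable_add summable_mult)
  then have "summable (\<lambda>t. pmf (geometric_pmf \<delta>) t * (norm X0 + 4 * real t))"
    using \<delta> by (simp add: algebra_simps)
  moreover have "\<bar>\<Phi> (state (hd h))\<bar> \<le> norm X0 + 4 * real t" if "h \<in> set_pmf (play \<alpha> \<beta> X0 t)" for t h
    using norm_state_le[OF that] abs_\<Phi>_le[of "state (hd h)"] by linarith
  ultimately show ?thesis
    using expectation_bind_nat_sums[of "play \<alpha> \<beta> X0" "\<lambda>h. \<Phi> (state (hd h))" "\<lambda>t. norm X0 + 4 * real t" "geometric_pmf \<delta>"] \<delta>
    by (simp add: expected_regret_def finite_play)
qed

lemma \<Phi>_scaleR: "0 \<le> c \<Longrightarrow> \<Phi> (c *\<^sub>R x) = c * \<Phi> x"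
  unfolding \<Phi>_eq_max by (simp add: max_mult_distrib_left)

text \<open>
  Along the play the one-step estimate bounds \<open>a t - (1 - \<delta>) * a (t + 1) - \<delta> * b
  t\<close>, where \<open>a\<close> and \<open>b\<close> are the expected values of the limit function
  and of \<open>\<Phi>\<close>. Weighted with \<open>(1 - \<delta>)^t\<close> and summed, the first
  two terms telescope to the initial value and the last one gives the expected regret. The errors, of
  size \<open>\<delta> * sqrt \<delta>\<close>, are multiplied by \<open>1 / \<delta>\<close>.
\<close>

lemma balanced_comb_regret:
  assumes \<delta>: "0 < \<delta>" "\<delta> \<le> 1/8"
  shows "\<bar>sqrt \<delta> * expected_regret \<delta> \<alpha> (balanced_comb \<delta>) (x /\<^sub>R sqrt \<delta>) - comb_limit x\<bar> \<le> 55 * sqrt \<delta>"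
proof -
  define X0 where "X0 = x /\<^sub>R sqrt \<delta>"
  define P where "P t = play \<alpha> (balanced_comb \<delta>) X0 t" for t
  define a where "a t = measure_pmf.expectation (P t) (\<lambda>h. comb_limit (scaled_state \<delta> h))" for t
  define b where "b t = measure_pmf.expectation (P t) (\<lambda>h. \<Phi> (scaled_state \<delta> h))" for t
  have int: "integrable (measure_pmf (P t)) f" for t and f :: "history \<Rightarrow> real"
    unfolding P_def by (intro integrable_measure_pmf_finite finite_play)
  have fin: "finite (set_pmf (P t))" for t unfolding P_def by (rule finite_play)
  have step: "\<bar>a t - (1 - \<delta>) * a (Suc t) - \<delta> * b t\<bar> \<le> 55 * (\<delta> * sqrt \<delta>)" for t
  proof -
    let ?A = "\<lambda>h. (comb_limit (scaled_state \<delta> h + sqrt \<delta> *\<^sub>R eJ (comb (scaled_state \<delta> h)))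
         + comb_limit (scaled_state \<delta> h - sqrt \<delta> *\<^sub>R eJ (comb (scaled_state \<delta> h)))) / 2"
    let ?f = "\<lambda>h. comb_limit (scaled_state \<delta> h) - (1 - \<delta>) * ?A h - \<delta> * \<Phi> (scaled_state \<delta> h)"
    have "a (Suc t) = measure_pmf.expectation (P t) ?A"
      unfolding a_def P_def by (rule play_comb_step)
    moreover have "measure_pmf.expectation (P t) ?f = a t - (1 - \<delta>) * measure_pmf.expectation (P t) ?A - \<delta> * b t"
      unfolding a_def b_def by (simp only: Bochner_Integration.integral_diff int integral_mult_right_zero)
    moreover have "\<bar>measure_pmf.expectation (P t) ?f\<bar> \<le> 55 * (\<delta> * sqrt \<delta>)"
      by (rule abs_expectation_le[OF fin comb_one_step[OF \<delta>]])
    ultimately show ?thesis by (simp only:)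
  qed
  have abound: "\<bar>a t\<bar> \<le> (1 + sqrt \<delta> * norm X0) + 4 * sqrt \<delta> * real t" for t
  proof -
    have "\<bar>comb_limit (scaled_state \<delta> h)\<bar> \<le> (1 + sqrt \<delta> * norm X0) + 4 * sqrt \<delta> * real t" if "h \<in> set_pmf (P t)" for h
    proof -
      have "\<bar>comb_limit (scaled_state \<delta> h)\<bar> \<le> 1 + norm (scaled_state \<delta> h)"
        using comb_limit_minus_\<Phi>[of "scaled_state \<delta> h"] abs_le_D1[OF abs_\<Phi>_le[of "scaled_state \<delta> h"]]
          abs_le_D2[OF abs_\<Phi>_le[of "scaled_state \<delta> h"]]
        unfolding abs_le_iff by simp
      also have "norm (scaled_state \<delta> h) = sqrt \<delta> * norm (state (hd h))" using \<delta> by (simp add: scaled_state_def)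
      also have "\<dots> \<le> sqrt \<delta> * (norm X0 + 4 * real t)"
        using norm_state_le[of h \<alpha> "balanced_comb \<delta>" X0 t] that \<delta> by (intro mult_left_mono) (auto simp: P_def)
      finally show ?thesis by (simp add: algebra_simps)
    qed
    then show ?thesis unfolding a_def by (rule abs_expectation_le[OF fin])
  qed
  let ?d = "1 - \<delta>"
  have d: "0 \<le> ?d" "?d < 1" "\<bar>?d\<bar> < 1" using \<delta> by auto
  have "(\<lambda>t. ?d^t * a t) \<longlonglongrightarrow> 0"
  proof (rule Lim_null_comparison)
    show "\<forall>\<^sub>F t in sequentially. norm (?d^t * a t) \<le> (1 + sqrt \<delta> * norm X0) * ?d^t + 4 * sqrt \<delta> * (real t * ?d^t)"
    proof (rule always_eventually, rule allI)
      fix t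
      have "norm (?d^t * a t) \<le> ?d^t * ((1 + sqrt \<delta> * norm X0) + 4 * sqrt \<delta> * real t)"
        using abound[of t] d by (simp add: abs_mult mult_left_mono)
      then show "norm (?d^t * a t) \<le> (1 + sqrt \<delta> * norm X0) * ?d^t + 4 * sqrt \<delta> * (real t * ?d^t)"
        by (simp add: algebra_simps)
    qed
    have "(\<lambda>t. (1 + sqrt \<delta> * norm X0) * ?d^t + 4 * sqrt \<delta> * (real t * ?d^t))
      \<longlonglongrightarrow> (1 + sqrt \<delta> * norm X0) * 0 + 4 * sqrt \<delta> * 0"
      using d by (intro tendsto_intros LIMSEQ_power_zero powser_times_n_limit_0) auto
    then show "(\<lambda>t. (1 + sqrt \<delta> * norm X0) * ?d^t + 4 * sqrt \<delta> * (real t * ?d^t)) \<longlonglongrightarrow> 0" by simp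
  qed
  from telescope_sums'[OF this]
  have tele: "(\<lambda>t. ?d^t * a t - ?d^Suc t * a (Suc t)) sums a 0" by simp
  have "b t = sqrt \<delta> * measure_pmf.expectation (P t) (\<lambda>h. \<Phi> (state (hd h)))" for t
    using \<delta> by (simp add: b_def scaled_state_def \<Phi>_scaleR)
  then have reg: "(\<lambda>t. ?d^t * \<delta> * b t) sums (sqrt \<delta> * expected_regret \<delta> \<alpha> (balanced_comb \<delta>) X0)"
    using sums_mult[OF expected_regret_sums[of \<delta> \<alpha> "balanced_comb \<delta>" X0], of "sqrt \<delta>"] \<delta>
    by (simp add: P_def mult_ac)
  have geo: "(\<lambda>t. 55 * (\<delta> * sqrt \<delta>) * ?d^t) sums (55 * (\<delta> * sqrt \<delta>) * (1 / (1 - ?d)))"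
    using d by (intro sums_mult geometric_sums) auto
  have "norm (a 0 - sqrt \<delta> * expected_regret \<delta> \<alpha> (balanced_comb \<delta>) X0) \<le> 55 * (\<delta> * sqrt \<delta>) * (1 / (1 - ?d))"
  proof (rule norm_sums_le[OF sums_diff[OF tele reg] geo])
    fix t
    have "?d^t * a t - ?d^Suc t * a (Suc t) - ?d^t * \<delta> * b t = ?d^t * (a t - ?d * a (Suc t) - \<delta> * b t)"
      by (simp add: algebra_simps)
    then show "norm (?d^t * a t - ?d^Suc t * a (Suc t) - ?d^t * \<delta> * b t) \<le> 55 * (\<delta> * sqrt \<delta>) * ?d^t"
      using mult_left_mono[OF step[of t], of "?d^t"] d by (simp add: abs_mult mult.commute)
  qed
  also have "55 * (\<delta> * sqrt \<delta>) * (1 / (1 - ?d)) = 55 * sqrt \<delta>" using \<delta> by simp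
  also have "a 0 = comb_limit x"
  proof -
    have "state (X0, 0) = X0" by (simp add: state_def vec_eq_iff)
    then show ?thesis using \<delta> by (simp add: a_def P_def scaled_state_def X0_def)
  qed
  finally show ?thesis by (simp add: X0_def abs_minus_commute)
qed

lemma comb_value_close:
  assumes \<delta>: "0 < \<delta>" "\<delta> \<le> 1/8"
  shows "\<bar>comb_value \<delta> x - comb_limit x\<bar> \<le> 55 * sqrt \<delta>"
proof -
  let ?R = "\<lambda>\<alpha>. expected_regret \<delta> \<alpha> (balanced_comb \<delta>) (x /\<^sub>R sqrt \<delta>)"
  have s: "0 < sqrt \<delta>" using \<delta> by simp
  have R: "(comb_limit x - 55 * sqrt \<delta>) / sqrt \<delta> \<le> ?R \<alpha>" "?R \<alpha> \<le> (comb_limit x + 55 * sqrt \<delta>) / sqrt \<delta>" for \<alpha>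
    using balanced_comb_regret[OF \<delta>, of \<alpha> x] s by (simp_all add: pos_divide_le_eq pos_le_divide_eq abs_le_iff mult.commute)
  have "(comb_limit x - 55 * sqrt \<delta>) / sqrt \<delta> \<le> (INF \<alpha>. ?R \<alpha>)"
    using R by (intro cINF_greatest) auto
  moreover have "(INF \<alpha>. ?R \<alpha>) \<le> ?R undefined"
    using R by (intro cINF_lower bdd_belowI2) auto
  then have "(INF \<alpha>. ?R \<alpha>) \<le> (comb_limit x + 55 * sqrt \<delta>) / sqrt \<delta>"
    using R(2) by (rule order_trans)
  ultimately show ?thesis
    using s by (simp add: comb_value_def pos_divide_le_eq pos_le_divide_eq abs_le_iff mult.commute)
qed

theorem theorem3p2:
  fixes u :: "real^4 \<Rightarrow> real"
  assumes limit: "\<And>K. compact K \<Longrightarrow> uniform_limit K scaled_value u (at_right 0)"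
    and solution: "viscosity_solution u" "linear_growth u"
    and unique: "\<And>v. viscosity_solution v \<Longrightarrow> linear_growth v \<Longrightarrow> v = u"
  shows "\<forall>K. compact K \<longrightarrow> uniform_limit K comb_value u (at_right 0)"
proof (intro allI impI uniform_limitI)
  have u: "comb_limit = u"
    by (intro unique linear_growth_comb_limit)
      (simp add: viscosity_solution_def continuous_comb_limit viscosity_subsolution_comb_limit viscosity_supersolution_comb_limit)
  fix K :: "(real^4) set" and e :: real
  assume "0 < e"
  have "((\<lambda>\<delta>. 55 * sqrt \<delta>) \<longlongrightarrow> 55 * sqrt 0) (at_right 0)" by (intro tendsto_intros)
  then have "\<forall>\<^sub>F \<delta> in at_right 0. 55 * sqrt \<delta> < e" using \<open>0 < e\<close> by (intro order_tendstoD(2)) auto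
  moreover have "\<forall>\<^sub>F \<delta>::real in at_right 0. 0 < \<delta> \<and> \<delta> < 1/8"
    by (auto simp: eventually_at_right_field intro!: exI[of _ "1/8"])
  ultimately show "\<forall>\<^sub>F \<delta> in at_right 0. \<forall>x\<in>K. dist (comb_value \<delta> x) (u x) < e"
  proof eventually_elim
    case (elim \<delta>)
    then show ?case using comb_value_close[of \<delta>] unfolding u[symmetric] dist_real_def
      by (auto intro: le_less_trans)
  qed
qed

end
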